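(* Let $d\ge 1$ and let $\rho:\mathbb{R}^d\to(0,+\infty)$ be a continuous positive function such that $\rho(x)=O(|x|^{-1})$ as $|x|\to\infty$. There exists $\gamma\in(0,1)$ such that if $\mathcal{O}\subset\mathbb{R}^d$ is a measurable $(\gamma,\rho)$-thick set, then the free Schrödinger equation is observable in $(0,T)\times\mathcal{O}$ for some time $T>0$. More precisely, there exist $T_0>0$ and $C>0$ such that for every $T\ge T_0$, $$\|u_0\|_{L^2(\mathbb{R}^d)}^2\le C\int_0^T\int_{\mathcal{O}}|e^{it\Delta}u_0|^2\,dx\,dt\qquad\forall u_0\in L^2(\mathbb{R}^d).$$
   Context: The free Schrödinger equation is $i\partial_t u+\Delta u=0$ in $(0,+\infty)\times\mathbb{R}^d$, $u(0,\cdot)=u_0\in L^2(\mathbb{R}^d)$; $(e^{it\Delta})_{t\in\mathbb{R}}$ is the unitary group on $L^2(\mathbb{R}^d)$ generated by $i\Delta$. For $T>0$ and $\mathcal{O}\subset\mathbb{R}^d$ measurable, the equation is observable in $(0,T)\times\mathcal{O}$ if there is $C>0$ such that $\|u_0\|_{L^2(\mathbb{R}^d)}^2\le C\int_0^T\int_{\mathcal{O}}|e^{it\Delta}u_0|^2\,dx\,dt$ for all $u_0\in L^2(\mathbb{R}^d)$. For $\gamma\in(0,1]$ and a continuous positive function $\rho:\mathbb{R}^d\to(0,\infty)$, a set $\mathcal{O}\subset\mathbb{R}^d$ is $(\gamma,\rho)$-thick if $|\mathcal{O}\cap B(x,\rho(x))|\ge\gamma|B(x,\rho(x))|$ for all $x\in\mathbb{R}^d$,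 where $|\cdot|$ is Lebesgue measure and $B(x,r)$ is the Euclidean ball of center $x$ and radius $r$. *)

theory Defs
  imports "HOL-Analysis.Analysis" "HOL-Library.Landau_Symbols"
begin

section \<open>Square-integrable functions\<close>

text \<open>
  Elements of \<open>L\<^sup>2(\<real>\<^sup>d)\<close> are represented by functions; equality in \<open>L\<^sup>2\<close> is equality
  almost everywhere.
\<close>

definition L2 :: "((real^'d::finite) \<Rightarrow> complex) set" where
  "L2 = {f \<in> borel_measurable lebesgue. integrable lebesgue (\<lambda>x. (cmod (f x))\<^sup>2)}"

definition L2_inner :: "((real^'d::finite) \<Rightarrow> complex) \<Rightarrow> (real^'d \<Rightarrow> complex) \<Rightarrow> complex" where
  "L2_inner f g = (LINT x|lebesgue. f x * cnj (g x))"

definition L2_norm :: "((real^'d::finite) \<Rightarrow> complex) \<Rightarrow> real" where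
  "L2_norm f = sqrt (LINT x|lebesgue. (cmod (f x))\<^sup>2)"

definition L2_eq :: "((real^'d::finite) \<Rightarrow> complex) \<Rightarrow> (real^'d \<Rightarrow> complex) \<Rightarrow> bool" where
  "L2_eq f g \<longleftrightarrow> (AE x in lebesgue. f x = g x)"


section \<open>The Laplacian on its maximal domain\<close>

definition partial_derivative ::
  "'d \<Rightarrow> ((real^'d::finite) \<Rightarrow> complex) \<Rightarrow> real^'d \<Rightarrow> complex" where
  "partial_derivative i f x = vector_derivative (\<lambda>h. f (x + h *\<^sub>R axis i 1)) (at 0)"

text \<open>
  \<open>Ck (Suc k)\<close> need not demand continuity of \<open>f\<close>: a function all of whose first partial
  derivatives exist and are continuous is continuously differentiable.
\<close>

fun Ck :: "nat \<Rightarrow> ((real^'d::finite) \<Rightarrow> complex) \<Rightarrow> bool" where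
  "Ck 0 f \<longleftrightarrow> continuous_on UNIV f"
| "Ck (Suc k) f \<longleftrightarrow>
     (\<forall>i. (\<forall>x. (\<lambda>h::real. f (x + h *\<^sub>R axis i 1)) differentiable (at 0))
        \<and> Ck k (partial_derivative i f))"

definition test_functions :: "((real^'d::finite) \<Rightarrow> complex) set" where
  "test_functions = {\<phi>. (\<forall>k. Ck k \<phi>) \<and> compact (closure {x. \<phi> x \<noteq> 0})}"

definition laplacian :: "((real^'d::finite) \<Rightarrow> complex) \<Rightarrow> real^'d \<Rightarrow> complex" where
  "laplacian \<phi> x = (\<Sum>i\<in>UNIV. partial_derivative i (partial_derivative i \<phi>) x)"

text \<open>
  The graph of the Laplacian as an unbounded operator on \<open>L\<^sup>2(\<real>\<^sup>d)\<close>: both \<open>u\<close> and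
  \<open>\<Delta>u = w\<close>, understood in the sense of distributions, belong to \<open>L\<^sup>2(\<real>\<^sup>d)\<close>.  The
  domain of this self-adjoint operator is the Sobolev space \<open>H\<^sup>2(\<real>\<^sup>d)\<close>.
\<close>

definition L2_laplacian :: "((real^'d::finite) \<Rightarrow> complex) \<Rightarrow> (real^'d \<Rightarrow> complex) \<Rightarrow> bool" where
  "L2_laplacian u w \<longleftrightarrow> u \<in> L2 \<and> w \<in> L2 \<and>
     (\<forall>\<phi>\<in>test_functions.
        (LINT x|lebesgue. u x * laplacian \<phi> x) = (LINT x|lebesgue. w x * \<phi> x))"


section \<open>Unitary groups and the free Schroedinger equation\<close>

definition L2_unitary ::
  "(((real^'d::finite) \<Rightarrow> complex) \<Rightarrow> (real^'d \<Rightarrow> complex)) \<Rightarrow> bool" where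
  "L2_unitary V \<longleftrightarrow>
     (\<forall>f\<in>L2. V f \<in> L2) \<and>
     (\<forall>f\<in>L2. \<forall>g\<in>L2. \<forall>a b. L2_eq (V (\<lambda>x. a * f x + b * g x)) (\<lambda>x. a * V f x + b * V g x)) \<and>
     (\<forall>f\<in>L2. \<forall>g\<in>L2. L2_inner (V f) (V g) = L2_inner f g) \<and>
     (\<forall>g\<in>L2. \<exists>f\<in>L2. L2_eq (V f) g)"

definition L2_unitary_group ::
  "(real \<Rightarrow> ((real^'d::finite) \<Rightarrow> complex) \<Rightarrow> (real^'d \<Rightarrow> complex)) \<Rightarrow> bool" where
  "L2_unitary_group U \<longleftrightarrow>
     (\<forall>t. L2_unitary (U t)) \<and>
     (\<forall>f\<in>L2. L2_eq (U 0 f) f) \<and>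
     (\<forall>s t. \<forall>f\<in>L2. L2_eq (U (s + t) f) (U s (U t f))) \<and>
     (\<forall>f\<in>L2. ((\<lambda>t. L2_norm (\<lambda>x. U t f x - f x)) \<longlongrightarrow> 0) (at 0))"

text \<open>The graph of the infinitesimal generator.\<close>

definition L2_generator ::
  "(real \<Rightarrow> ((real^'d::finite) \<Rightarrow> complex) \<Rightarrow> (real^'d \<Rightarrow> complex)) \<Rightarrow>
   (real^'d \<Rightarrow> complex) \<Rightarrow> (real^'d \<Rightarrow> complex) \<Rightarrow> bool" where
  "L2_generator U u v \<longleftrightarrow> u \<in> L2 \<and> v \<in> L2 \<and>
     ((\<lambda>h. L2_norm (\<lambda>x. (U h u x - u x) / of_real h - v x)) \<longlongrightarrow> 0) (at 0)"

text \<open>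
  \<open>U\<close> is \<open>(e\<^bsup>it\<Delta>\<^esup>)\<close>, the unitary group whose generator is \<open>i\<Delta>\<close>, domains included.
  By Stone's theorem such a \<open>U\<close> exists and is unique up to equality almost everywhere.
\<close>

definition free_schroedinger_group ::
  "(real \<Rightarrow> ((real^'d::finite) \<Rightarrow> complex) \<Rightarrow> (real^'d \<Rightarrow> complex)) \<Rightarrow> bool" where
  "free_schroedinger_group U \<longleftrightarrow> L2_unitary_group U \<and>
     (\<forall>u v. L2_generator U u v \<longleftrightarrow> (\<exists>w. L2_laplacian u w \<and> L2_eq v (\<lambda>x. \<i> * w x) \<and> v \<in> L2))"


section \<open>Observability and thick sets\<close>

text \<open>
  For \<open>u\<^sub>0 \<in> L\<^sup>2\<close> the inner integral below is finite and continuous in \<open>t\<close>, so that the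
  iterated integral does not depend on the representatives chosen by \<open>U\<close>.
\<close>

definition observed_energy ::
  "(real \<Rightarrow> ((real^'d::finite) \<Rightarrow> complex) \<Rightarrow> (real^'d \<Rightarrow> complex)) \<Rightarrow>
   real \<Rightarrow> (real^'d) set \<Rightarrow> (real^'d \<Rightarrow> complex) \<Rightarrow> real" where
  "observed_energy U T \<Omega> u0 =
     (LINT t:{0<..<T}|lebesgue. (LINT x:\<Omega>|lebesgue. (cmod (U t u0 x))\<^sup>2))"

definition observable ::
  "(real \<Rightarrow> ((real^'d::finite) \<Rightarrow> complex) \<Rightarrow> (real^'d \<Rightarrow> complex)) \<Rightarrow>
   real \<Rightarrow> (real^'d) set \<Rightarrow> bool" where
  "observable U T \<Omega> \<longleftrightarrow>
     (\<exists>C>0. \<forall>u0\<in>L2. (L2_norm u0)\<^sup>2 \<le> C * observed_energy U T \<Omega> u0)"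

definition thick :: "real \<Rightarrow> ((real^'d::finite) \<Rightarrow> real) \<Rightarrow> (real^'d) set \<Rightarrow> bool" where
  "thick \<gamma> \<rho> \<Omega> \<longleftrightarrow>
     (\<forall>x. measure lebesgue (\<Omega> \<inter> ball x (\<rho> x)) \<ge> \<gamma> * measure lebesgue (ball x (\<rho> x)))"

end

theory Submission
  imports Defs "HOL-Probability.Distributions"
begin

text \<open>
  The Schroedinger evolution over a time \<open>\<tau>\<close> is, up to multiplication by functions of modulus
  one and a dilation, the Fourier transform.  With \<open>\<tau> = 1/(4\<pi>)\<close> the dilation disappears: if
  \<open>f(y) = e\<^bsup>i\<pi>|y|\<^sup>2\<^esup> u(y)\<close>, then \<open>|e\<^bsup>i\<tau>\<Delta>\<^esup> u|\<close> is the modulus of the Fourier transform \<open>g\<close> of \<open>f\<close>.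
  Observability therefore follows from an uncertainty principle of Shubin, Vakilian and Wolff:
  if \<open>E\<close> has density at most a small \<open>\<epsilon>\<close> in balls of radius about \<open>1/|x|\<close> around every \<open>x\<close>, then
  \<open>\<parallel>f\<parallel>\<^sup>2 \<le> C (\<integral> |f|\<^sup>2 + \<integral> |g|\<^sup>2)\<close>, both integrals over the complement of \<open>E\<close>
  (lemma \<open>uncertainty_thin\<close>).  Applied to \<open>e\<^bsup>is\<Delta>\<^esup> u\<close> and integrated over \<open>0 < s < 1\<close>, it bounds
  \<open>\<parallel>u\<parallel>\<^sup>2\<close> by \<open>2C\<close> times the energy observed up to any time \<open>T \<ge> 1 + \<tau>\<close>.

  For the uncertainty principle put \<open>N(r) = \<integral>\<integral> e\<^bsup>-\<pi>r(|x|\<^sup>2+|\<xi>|\<^sup>2)\<^esup> f(x) cnj(g(\<xi>)) e\<^bsup>-2\<pi>ix\<xi>\<^esup> dx d\<xi>\<close>.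
  Then \<open>N(r) \<longrightarrow> \<parallel>f\<parallel>\<^sup>2\<close> as \<open>r \<longrightarrow> 0\<close>, and \<open>-N'(r)\<close> is the sum of the same integral weighted by
  \<open>\<pi>|x|\<^sup>2\<close> and by \<open>\<pi>|\<xi>|\<^sup>2\<close>.  In the first summand the \<open>\<xi>\<close>-integral is the convolution of \<open>f\<close> with a
  Gaussian of variance about \<open>r\<close>, so that after integration over \<open>0 < r < 1\<close> it becomes a form
  \<open>\<integral>\<integral> K(x,y) |f(x)| |f(y)|\<close>, whose positive kernel \<open>K\<close> lives at the scale \<open>|x - y| \<approx> 1/|x|\<close>; the
  second summand gives the same form in \<open>g\<close>.  The kernel has total mass at most one in \<open>y\<close>, and its
  mass over \<open>x \<in> E\<close> is small when \<open>E\<close> is thin at its scale (\<open>thin_columns\<close>), so that the Schur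
  test bounds the part over \<open>E\<close> by a small multiple of \<open>\<parallel>f\<parallel>\<^sup>2\<close>, which is absorbed.

  The density of \<open>E\<close> is prescribed only in the balls \<open>B(x, \<rho>(x))\<close>, and \<open>\<rho>\<close> may be much smaller than
  \<open>1/|x|\<close> and oscillate.  A covering argument of Besicovitch type transfers thinness to all larger
  balls (\<open>thin_cball\<close>).

  Nothing is presupposed about Fourier analysis in \<open>\<real>\<^sup>d\<close>.  Gaussians evolve explicitly
  (\<open>gwave_evolution\<close>), the Plancherel theorem is the unitarity of the group, and the Parseval
  identities against Gaussians are the only form in which the Fourier transform occurs
  (\<open>fourier_link\<close>).  They suffice because Gaussians separate functions (\<open>gauss_separating\<close>).
\<close>

section \<open>Gaussians of unit mass\<close>

text \<open>
  The Gaussian \<open>e\<^bsup>-\<pi>r|x|\<^sup>2\<^esup>\<close>, normalised by its value one at the origin.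
\<close>

abbreviation bell :: "real \<Rightarrow> 'a::real_normed_vector \<Rightarrow> real" where
  "bell r x \<equiv> exp (- pi * r * (norm x)\<^sup>2)"

text \<open>
  The Gaussian of mass one with Fourier transform \<open>bell r\<close>; the parameter \<open>r\<close> is proportional to
  the variance.
\<close>

definition gauss :: "real \<Rightarrow> 'a::euclidean_space \<Rightarrow> real" where
  "gauss r v = r powr (- (real DIM('a) / 2)) * exp (- pi * (norm v)\<^sup>2 / r)"

lemma gauss_nonneg [simp]: "0 \<le> gauss r v"
  by (simp add: gauss_def)

lemma gauss_commute: "gauss r (x - y) = gauss r (y - x)"
  by (simp add: gauss_def norm_minus_commute)

lemma borel_measurable_gauss [measurable]: "gauss r \<in> borel_measurable borel"
  unfolding gauss_def[abs_def] by measurable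

lemma inverse_sqrt_power:
  assumes "r > 0"
  shows "(1 / sqrt r) ^ n = r powr (- (real n / 2))"
proof -
  have "1 / sqrt r = r powr (- (1/2))"
    using assms by (simp only: powr_minus powr_half_sqrt[OF less_imp_le]) (simp only: inverse_eq_divide)
  moreover have "(r powr (- (1/2))) ^ n = (r powr (- (1/2))) powr real n"
    using assms by (subst powr_realpow) auto
  ultimately show ?thesis by (simp add: powr_powr)
qed

lemma gauss_le: "r > 0 \<Longrightarrow> gauss r (v::'a::euclidean_space) \<le> r powr (- (real DIM('a) / 2))"
  by (simp add: gauss_def mult_left_le)

lemma gauss_eq_prod:
  assumes "r > 0"
  shows "gauss r (v::'a::euclidean_space) = (\<Prod>b\<in>Basis. normal_density 0 (sqrt (r / (2 * pi))) (v \<bullet> b))"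
proof -
  have "(\<Prod>b\<in>Basis. normal_density 0 (sqrt (r / (2 * pi))) (v \<bullet> b))
      = (\<Prod>b\<in>Basis. (1 / sqrt r) * exp (- pi * (v \<bullet> b)\<^sup>2 / r))"
    using assms by (intro prod.cong refl) (simp add: normal_density_def field_simps)
  also have "\<dots> = (1 / sqrt r) ^ DIM('a) * exp (\<Sum>b\<in>Basis. - pi * (v \<bullet> b)\<^sup>2 / r)"
    by (simp add: prod.distrib exp_sum prod_dividef power_one_over)
  also have "(\<Sum>b\<in>Basis. - pi * (v \<bullet> b)\<^sup>2 / r) = - pi * (norm v)\<^sup>2 / r"
  proof -
    have "(norm v)\<^sup>2 = (\<Sum>b\<in>Basis. (v \<bullet> b)\<^sup>2)"
      unfolding power2_norm_eq_inner by (subst euclidean_inner) (simp only: power2_eq_square)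
    then show ?thesis by (simp only: sum_distrib_left sum_divide_distrib)
  qed
  also have "(1 / sqrt r) ^ DIM('a) = r powr (- (real DIM('a) / 2))" by (rule inverse_sqrt_power[OF assms])
  finally show ?thesis by (simp add: gauss_def)
qed

lemma nn_integral_gauss:
  assumes "r > 0"
  shows "(\<integral>\<^sup>+v. ennreal (gauss r (v::'a::euclidean_space)) \<partial>lborel) = 1"
proof -
  let ?s = "sqrt (r / (2 * pi))"
  have s: "?s > 0" using assms by simp
  have 1: "(\<integral>\<^sup>+x. ennreal (normal_density 0 ?s x) \<partial>lborel) = 1"
    using prob_space.emeasure_space_1[OF prob_space_normal_density[OF s, of 0]]
    by (simp add: emeasure_density)
  have "(\<integral>\<^sup>+v. ennreal (gauss r (v::'a)) \<partial>lborel)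
      = (\<integral>\<^sup>+v. (\<Prod>b\<in>Basis. ennreal (normal_density 0 ?s ((v::'a) \<bullet> b))) \<partial>lborel)"
    by (intro nn_integral_cong) (simp add: gauss_eq_prod[OF assms] prod_ennreal)
  also have "\<dots> = 1"
    by (subst nn_integral_lborel_prod) (auto simp: 1)
  finally show ?thesis .
qed

lemma nn_integral_gauss_shift:
  assumes "r > 0"
  shows "(\<integral>\<^sup>+x. ennreal (gauss r (x - (y::'a::euclidean_space))) \<partial>lborel) = 1" (is ?A)
    and "(\<integral>\<^sup>+x. ennreal (gauss r (y - x)) \<partial>lborel) = 1" (is ?B)
proof -
  have "(\<integral>\<^sup>+v. ennreal (gauss r (v::'a)) \<partial>lborel) = (\<integral>\<^sup>+v. ennreal (gauss r v) \<partial>distr lborel borel ((+) (- y)))"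
    by (simp add: lborel_distr_plus)
  also have "\<dots> = (\<integral>\<^sup>+x. ennreal (gauss r (x - y)) \<partial>lborel)"
    by (subst nn_integral_distr) (auto simp: algebra_simps)
  finally show ?A using nn_integral_gauss[OF assms, where 'a='a] by simp
  then show ?B by (simp add: gauss_commute)
qed

lemma gauss_mult_aux: fixes a b i r s :: real assumes "r>0" "s>0"
 shows "(1/(r+s))\<^sup>2 * (s\<^sup>2 * a + r\<^sup>2 * b + 2 * r * s * i) / (r * s/(r+s)) + (a + b - 2 * i) / (r+s) = a/r + b/s"
proof -
  have "r + s \<noteq> 0" "r \<noteq> 0" "s \<noteq> 0" using assms by auto
  then have "(1/(r+s))\<^sup>2 * (s\<^sup>2 * a + r\<^sup>2 * b + 2 * r * s * i) / (r * s/(r+s)) = (s\<^sup>2 * a + r\<^sup>2 * b + 2 * r * s * i) / (r * s * (r+s))"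
    by (simp add: power2_eq_square)
  moreover have "(a + b - 2 * i) / (r+s) = (r * s) * (a + b - 2 * i) / (r * s * (r+s))"
     using \<open>r \<noteq> 0\<close> \<open>s \<noteq> 0\<close> by simp
  moreover have "a/r + b/s = (s * a + r * b) * (r + s) / (r * s * (r+s))"
    using \<open>r + s \<noteq> 0\<close> \<open>r \<noteq> 0\<close> \<open>s \<noteq> 0\<close> by (simp add: add_divide_distrib)
  ultimately show ?thesis
    by (simp only: add_divide_distrib[symmetric]) (simp add: algebra_simps power2_eq_square)
qed

text \<open>
  Completing the square: a product of two Gaussians in \<open>x\<close> is a Gaussian in \<open>x\<close> times the
  convolution of the two.
\<close>

lemma gauss_mult:
  fixes x y b :: "'a::euclidean_space"
  assumes r: "r > 0" and s: "s > 0"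
  shows "gauss r (x - y) * gauss s (x - b)
     = gauss (r * s / (r + s)) (x - (1 / (r + s)) *\<^sub>R (s *\<^sub>R y + r *\<^sub>R b)) * gauss (r + s) (y - b)"
proof -
  let ?c = "(1 / (r + s)) *\<^sub>R (s *\<^sub>R y + r *\<^sub>R b)"
  have rs: "r + s > 0" using r s by simp
  define u where "u = x - y"
  define w where "w = x - b"
  have 1: "x - ?c = (1 / (r + s)) *\<^sub>R (s *\<^sub>R u + r *\<^sub>R w)"
  proof -
    have "x = (1 / (r + s)) *\<^sub>R ((r + s) *\<^sub>R x)" using rs by simp
    then have "x - ?c = (1 / (r + s)) *\<^sub>R ((r + s) *\<^sub>R x) - ?c" by simp
    also have "\<dots> = (1 / (r + s)) *\<^sub>R (s *\<^sub>R u + r *\<^sub>R w)"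
      by (simp only: u_def w_def scaleR_diff_right[symmetric]) (simp add: algebra_simps)
    finally show ?thesis .
  qed
  have 2: "y - b = w - u" by (simp add: u_def w_def)
  have uw: "(norm (s *\<^sub>R u + r *\<^sub>R w))\<^sup>2 = s\<^sup>2 * (norm u)\<^sup>2 + r\<^sup>2 * (norm w)\<^sup>2 + 2 * r * s * (u \<bullet> w)"
    by (simp only: power2_norm_eq_inner) (simp add: algebra_simps inner_commute power2_eq_square)
  have uw2: "(norm (w - u))\<^sup>2 = (norm u)\<^sup>2 + (norm w)\<^sup>2 - 2 * (u \<bullet> w)"
    by (simp only: power2_norm_eq_inner) (simp add: algebra_simps inner_commute power2_eq_square)
  have "(norm (x - ?c))\<^sup>2 / (r * s / (r + s)) + (norm (y - b))\<^sup>2 / (r + s)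
      = (norm u)\<^sup>2 / r + (norm w)\<^sup>2 / s"
    unfolding 1 2 norm_scaleR power_mult_distrib uw uw2
    using gauss_mult_aux[OF r s, of "(norm u)\<^sup>2" "(norm w)\<^sup>2" "u \<bullet> w"] rs
    by (simp only: power2_abs[symmetric, of "1 / (r + s)"] real_norm_def)
  then have "- pi * ((norm u)\<^sup>2 / r + (norm w)\<^sup>2 / s) = - pi * ((norm (x - ?c))\<^sup>2 / (r * s / (r + s)) + (norm (y - b))\<^sup>2 / (r + s))"
    by simp
  then have 3: "- pi * (norm u)\<^sup>2 / r + - pi * (norm w)\<^sup>2 / s
     = - pi * (norm (x - ?c))\<^sup>2 / (r * s / (r + s)) + - pi * (norm (y - b))\<^sup>2 / (r + s)"
    by (simp only: distrib_left times_divide_eq_right)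
  have 4: "r powr a * s powr a = (r * s / (r + s)) powr a * (r + s) powr a" for a
  proof -
    have "r * s = (r * s / (r + s)) * (r + s)" using rs by simp
    then show ?thesis using r s rs by (metis powr_mult)
  qed
  have "gauss r u * gauss s w = (r powr (- (real DIM('a) / 2)) * s powr (- (real DIM('a) / 2)))
      * exp (- pi * (norm u)\<^sup>2 / r + - pi * (norm w)\<^sup>2 / s)"
    unfolding gauss_def exp_add by (simp only: mult.assoc mult.left_commute)
  also have "\<dots> = gauss (r * s / (r + s)) (x - ?c) * gauss (r + s) (y - b)"
    unfolding 3 4 exp_add gauss_def by (simp only: mult.assoc mult.left_commute)
  finally show ?thesis by (simp add: u_def w_def)
qed

lemma nn_integral_gauss_gauss:
  assumes r: "r > 0" and s: "s > 0"
  shows "(\<integral>\<^sup>+x. ennreal (gauss r (x - y) * gauss s (x - b)) \<partial>lborel) = ennreal (gauss (r + s) (y - b))"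
  unfolding gauss_mult[OF r s] using r s
  by (simp add: ennreal_mult nn_integral_multc nn_integral_gauss_shift)

text \<open>
  Trading half of the exponent for a Gaussian of twice the variance.  This is how decay is
  extracted from a Gaussian while its integral stays under control.
\<close>

lemma gauss_double:
  assumes "s > 0"
  shows "gauss s (v::'a::euclidean_space) * exp (pi * (norm v)\<^sup>2 / (2 * s)) = 2 powr (DIM('a) / 2) * gauss (2 * s) v"
proof -
  have 1: "s powr (- (real DIM('a) / 2)) = 2 powr (real DIM('a) / 2) * (2 * s) powr (- (real DIM('a) / 2))"
  proof -
    have "2 powr (real DIM('a) / 2) * 2 powr (- (real DIM('a) / 2)) = (1::real)"
      by (simp only: powr_add[symmetric]) simp
    moreover have "(2 * s) powr (- (real DIM('a) / 2)) = 2 powr (- (real DIM('a) / 2)) * s powr (- (real DIM('a) / 2))"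
      using assms by (simp only: powr_mult)
    ultimately show ?thesis by (metis mult.assoc mult_1)
  qed
  have 2: "- pi * (norm v)\<^sup>2 / s + pi * (norm v)\<^sup>2 / (2 * s) = - pi * (norm v)\<^sup>2 / (2 * s)"
    using assms by simp
  have "gauss s v * exp (pi * (norm v)\<^sup>2 / (2 * s))
    = s powr (- (real DIM('a) / 2)) * exp (- pi * (norm v)\<^sup>2 / s + pi * (norm v)\<^sup>2 / (2 * s))"
    by (simp only: gauss_def exp_add mult.assoc)
  also have "\<dots> = 2 powr (DIM('a) / 2) * gauss (2 * s) v"
    by (subst 2, subst 1) (simp only: gauss_def mult.assoc)
  finally show ?thesis .
qed

section \<open>Coverings by balls of variable radius\<close>

lemma bounded_diameter_cover:
  fixes K :: "'a::metric_space set"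
  assumes "compact K" "m > 0"
  shows "\<exists>F. finite F \<and> K \<subseteq> \<Union>F \<and> (\<forall>S\<in>F. \<forall>x\<in>S. \<forall>y\<in>S. dist x y < m)"
proof -
  obtain k where k: "finite k" "K \<subseteq> (\<Union>x\<in>k. ball x (m/2))"
    using assms unfolding compact_eq_totally_bounded by (meson half_gt_zero)
  have "dist x y < m" if "x \<in> ball c (m/2)" "y \<in> ball c (m/2)" for x y c
    using that by simp metric
  then show ?thesis
    by (intro exI[of _ "(\<lambda>x. ball x (m/2)) ` k"]) (use k in auto)
qed

text \<open>
  Greedy selection: the centre is always a point of maximal radius among those not yet covered.
  Since the radii are bounded below by \<open>m\<close>, each choice covers one of the \<open>n\<close> pieces of small
  diameter, and the selection ends after \<open>n\<close> steps.
\<close>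

lemma separated_ball_cover_aux:
  fixes \<rho> :: "'a::metric_space \<Rightarrow> real"
  assumes "continuous_on UNIV \<rho>"
  shows "\<lbrakk>compact K; finite F; card F = n; K \<subseteq> \<Union>F; \<forall>S\<in>F. \<forall>x\<in>S. \<forall>y\<in>S. dist x y < m;
    \<And>x. x \<in> K \<Longrightarrow> m \<le> \<rho> x\<rbrakk> \<Longrightarrow>
    \<exists>X. finite X \<and> X \<subseteq> K \<and> K \<subseteq> (\<Union>x\<in>X. ball x (\<rho> x)) \<and> (\<forall>x\<in>X. \<forall>y\<in>X. x \<noteq> y \<longrightarrow> \<rho> x \<le> dist x y)"
proof (induction n arbitrary: K F)
  case 0
  then show ?case by (intro exI[of _ "{}"]) auto
next
  case (Suc n)
  show ?case
  proof (cases "K = {}")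
    case True then show ?thesis by (intro exI[of _ "{}"]) auto
  next
    case False
    obtain x where x: "x \<in> K" "\<And>y. y \<in> K \<Longrightarrow> \<rho> y \<le> \<rho> x"
      using continuous_attains_sup[OF Suc.prems(1) False continuous_on_subset[OF assms subset_UNIV]] by blast
    obtain S where S: "S \<in> F" "x \<in> S" using Suc.prems(4) x(1) by blast
    let ?K = "K - ball x (\<rho> x)"
    have "S \<subseteq> ball x (\<rho> x)"
    proof
      fix y assume "y \<in> S"
      then have "dist x y < m" using Suc.prems(5) S by blast
      also have "m \<le> \<rho> x" using Suc.prems(6) x(1) by blast
      finally show "y \<in> ball x (\<rho> x)" by simp
    qed
    then have cov: "?K \<subseteq> \<Union>(F - {S})" using Suc.prems(4) by blast
    have "\<exists>X. finite X \<and> X \<subseteq> ?K \<and> ?K \<subseteq> (\<Union>x\<in>X. ball x (\<rho> x)) \<and> (\<forall>x\<in>X. \<forall>y\<in>X. x \<noteq> y \<longrightarrow> \<rho> x \<le> dist x y)"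
    proof (rule Suc.IH[OF _ _ _ cov])
      show "compact ?K" using Suc.prems(1) by (rule compact_diff) simp
      show "finite (F - {S})" "card (F - {S}) = n" using Suc.prems(2,3) S(1) by simp_all
      show "\<forall>S\<in>F - {S}. \<forall>x\<in>S. \<forall>y\<in>S. dist x y < m" using Suc.prems(5) by blast
      show "m \<le> \<rho> y" if "y \<in> ?K" for y
        by (rule Suc.prems(6)) (use that in simp)
    qed
    then obtain X where X: "finite X" "X \<subseteq> ?K" "?K \<subseteq> (\<Union>x\<in>X. ball x (\<rho> x))"
      "\<forall>x\<in>X. \<forall>y\<in>X. x \<noteq> y \<longrightarrow> \<rho> x \<le> dist x y" by (elim exE conjE)
    \<comment> \<open>By maximality of the radius at \<open>x\<close> both radii are at most the distance.\<close>
    have far: "\<rho> x \<le> dist x y" "\<rho> y \<le> dist y x" if "y \<in> X" for y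
    proof -
      have y: "y \<in> K" "y \<notin> ball x (\<rho> x)" using X(2) that by auto
      then show "\<rho> x \<le> dist x y" by simp
      then show "\<rho> y \<le> dist y x" using x(2)[OF y(1)] by (simp add: dist_commute)
    qed
    show ?thesis
    proof (intro exI[of _ "insert x X"] conjI)
      show "finite (insert x X)" "insert x X \<subseteq> K" "K \<subseteq> (\<Union>x\<in>insert x X. ball x (\<rho> x))"
        using X(1-3) x(1) by auto
      show "\<forall>u\<in>insert x X. \<forall>v\<in>insert x X. u \<noteq> v \<longrightarrow> \<rho> u \<le> dist u v"
        using X(4) far by blast
    qed
  qed
qed

text \<open>
  Besicovitch covering for a continuous radius function on a compact set: no selected centre
  lies in another selected ball.
\<close>

lemma separated_ball_cover:
  fixes \<rho> :: "'a::metric_space \<Rightarrow> real"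
  assumes "continuous_on UNIV \<rho>" "\<And>x. \<rho> x > 0" "compact K"
  shows "\<exists>X. finite X \<and> X \<subseteq> K \<and> K \<subseteq> (\<Union>x\<in>X. ball x (\<rho> x)) \<and> (\<forall>x\<in>X. \<forall>y\<in>X. x \<noteq> y \<longrightarrow> \<rho> x \<le> dist x y)"
proof (cases "K = {}")
  case True
  then show ?thesis by (intro exI[of _ "{}"]) auto
next
  case False
  obtain x0 where x0: "x0 \<in> K" "\<And>y. y \<in> K \<Longrightarrow> \<rho> x0 \<le> \<rho> y"
    using continuous_attains_inf[OF assms(3) False continuous_on_subset[OF assms(1) subset_UNIV]] by blast
  obtain F where F: "finite F" "K \<subseteq> \<Union>F" "\<forall>S\<in>F. \<forall>x\<in>S. \<forall>y\<in>S. dist x y < \<rho> x0"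
    using bounded_diameter_cover[OF assms(3) assms(2)[of x0]] by (elim exE conjE)
  show ?thesis
    by (rule separated_ball_cover_aux[OF assms(1,3) F(1) refl F(2,3) x0(2)])
qed

text \<open>
  Two vectors enclosing an angle of less than 60 degrees are closer to each other than the longer
  one is to the origin.
\<close>

lemma norm_diff_less_max:
  fixes p q :: "'a::real_inner"
  assumes "p \<noteq> 0" "q \<noteq> 0" and "norm (p /\<^sub>R norm p - q /\<^sub>R norm q) < 1"
  shows "norm (p - q) < max (norm p) (norm q)"
proof -
  define a b where "a = norm p" and "b = norm q"
  have ab: "a > 0" "b > 0" using assms by (auto simp: a_def b_def)
  have "(norm (p /\<^sub>R norm p - q /\<^sub>R norm q))\<^sup>2 < 1"
    using assms(3) by (simp add: power_less_one_iff abs_square_less_1)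
  moreover have "(norm (p /\<^sub>R norm p - q /\<^sub>R norm q))\<^sup>2 = 2 - 2 * ((p \<bullet> q) / (a * b))"
  proof -
    have "(p /\<^sub>R norm p) \<bullet> (p /\<^sub>R norm p) = 1" "(q /\<^sub>R norm q) \<bullet> (q /\<^sub>R norm q) = 1"
      using assms by (simp_all flip: power2_norm_eq_inner)
    moreover have "(p /\<^sub>R norm p) \<bullet> (q /\<^sub>R norm q) = (p \<bullet> q) / (a * b)"
      by (simp add: a_def b_def divide_inverse)
    ultimately show ?thesis
      unfolding power2_norm_eq_inner inner_diff_left inner_diff_right
      by (simp add: inner_commute)
  qed
  ultimately have "(p \<bullet> q) / (a * b) > 1/2" by linarith
  then have pq: "a * b < 2 * (p \<bullet> q)" using ab by (simp add: field_simps)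
  have "(norm (p - q))\<^sup>2 = a\<^sup>2 + b\<^sup>2 - 2 * (p \<bullet> q)"
    unfolding a_def b_def power2_norm_eq_inner by (simp add: inner_diff inner_commute)
  also have "\<dots> < a\<^sup>2 + b\<^sup>2 - a * b" using pq by simp
  also have "\<dots> \<le> (max a b)\<^sup>2"
  proof (cases "a \<le> b")
    case True
    then have "a\<^sup>2 \<le> a * b" using ab by (simp add: power2_eq_square)
    then show ?thesis using True by (simp add: max_def)
  next
    case False
    then have "b\<^sup>2 \<le> a * b" using ab by (simp add: power2_eq_square)
    then show ?thesis using False by (simp add: max_def)
  qed
  finally show ?thesis
    using ab by (simp add: a_def b_def power2_less_imp_less max_def split: if_splits)
qed

text \<open>
  Balls none of which contains the centre of another overlap a bounded number of times: seen from
  a common point, their centres lie in directions at least 60 degrees apart.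
\<close>

lemma separated_balls_overlap:
  "\<exists>N::nat. \<forall>(X::'a::euclidean_space set) \<rho> z. finite X \<longrightarrow>
    (\<forall>x\<in>X. \<forall>y\<in>X. x \<noteq> y \<longrightarrow> \<rho> x \<le> dist x y) \<longrightarrow> card {x \<in> X. z \<in> ball x (\<rho> x)} \<le> N"
proof -
  obtain F :: "'a set set" where F: "finite F" "sphere 0 1 \<subseteq> \<Union>F"
    "\<forall>S\<in>F. \<forall>x\<in>S. \<forall>y\<in>S. dist x y < 1"
    using bounded_diameter_cover[OF compact_sphere[of "0::'a" 1] zero_less_one] by (elim exE conjE)
  have "card {x \<in> X. z \<in> ball x (\<rho> x)} \<le> card F + 1"
    if X: "finite X" and sep: "\<forall>x\<in>X. \<forall>y\<in>X. x \<noteq> y \<longrightarrow> \<rho> x \<le> dist x y"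
    for X :: "'a set" and \<rho> z
  proof -
    let ?Y = "{x \<in> X. z \<in> ball x (\<rho> x)} - {z}"
    define dir where "dir x = (x - z) /\<^sub>R norm (x - z)" for x
    have "\<forall>x\<in>?Y. \<exists>S\<in>F. dir x \<in> S"
    proof
      fix x assume "x \<in> ?Y"
      then have "dir x \<in> sphere 0 1" by (simp add: dir_def)
      then show "\<exists>S\<in>F. dir x \<in> S" using F(2) by blast
    qed
    then obtain \<sigma> where \<sigma>: "\<And>x. x \<in> ?Y \<Longrightarrow> \<sigma> x \<in> F" "\<And>x. x \<in> ?Y \<Longrightarrow> dir x \<in> \<sigma> x"
      using bchoice[of ?Y "\<lambda>x S. S \<in> F \<and> dir x \<in> S"] by blast
    have "inj_on \<sigma> ?Y"
    proof (rule inj_onI, rule ccontr)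
      fix x y assume xy: "x \<in> ?Y" "y \<in> ?Y" "\<sigma> x = \<sigma> y" "x \<noteq> y"
      have "dist (dir x) (dir y) < 1" using F(3) \<sigma>(1)[OF xy(1)] \<sigma>(2)[OF xy(1)] \<sigma>(2)[OF xy(2)] xy(3) by simp
      then have "norm ((x - z) - (y - z)) < max (norm (x - z)) (norm (y - z))"
        using xy by (intro norm_diff_less_max) (auto simp: dir_def dist_norm)
      moreover have "norm (x - z) < \<rho> x" "norm (y - z) < \<rho> y" using xy by (auto simp: dist_norm)
      moreover have "\<rho> x \<le> norm (x - y)" "\<rho> y \<le> norm (x - y)"
        using sep xy by (auto simp: dist_norm norm_minus_commute)
      ultimately show False by (auto simp: max_def split: if_splits)
    qed
    then have "card ?Y \<le> card F"
      by (rule card_inj_on_le) (use \<sigma> F in auto)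
    then show ?thesis using card_Diff1_le[of "{x \<in> X. z \<in> ball x (\<rho> x)}" z]
      by (cases "z \<in> {x \<in> X. z \<in> ball x (\<rho> x)}") (auto simp: card_Diff_singleton_if X)
  qed
  then show ?thesis by (intro exI[of _ "card F + 1"]) simp
qed

text \<open>
  If \<open>E\<close> has density at most \<open>\<epsilon>\<close> in the balls \<open>B(x, \<rho>(x))\<close>, and \<open>\<rho>\<close> is at most of the order of
  \<open>1/(1+|x|)\<close>, then \<open>E\<close> occupies a fraction of order \<open>\<epsilon>\<close> of every ball whose radius exceeds that
  order.  No lower bound on \<open>\<rho>\<close> is needed.
\<close>

lemma thin_cball:
  fixes \<rho> :: "'a::euclidean_space \<Rightarrow> real"
  assumes cont: "continuous_on UNIV \<rho>" and pos: "\<And>x. \<rho> x > 0" and C0: "\<And>x. \<rho> x \<le> C0 / (1 + norm x)"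
  shows "\<exists>A>0. \<forall>E \<epsilon> z t. E \<in> sets lebesgue \<longrightarrow> t \<ge> 0 \<longrightarrow>
     (\<forall>x. measure lebesgue (E \<inter> ball x (\<rho> x)) \<le> \<epsilon> * measure lebesgue (ball x (\<rho> x))) \<longrightarrow>
     measure lebesgue (E \<inter> cball z t) \<le> \<epsilon> * A * (t + 1 / (1 + norm z)) ^ DIM('a)"
proof -
  obtain N :: nat where N: "\<forall>(X::'a::euclidean_space set) \<rho> z. finite X \<longrightarrow>
    (\<forall>x\<in>X. \<forall>y\<in>X. x \<noteq> y \<longrightarrow> \<rho> x \<le> dist x y) \<longrightarrow> card {x \<in> X. z \<in> ball x (\<rho> x)} \<le> N"
    using separated_balls_overlap by (elim exE)
  have C0pos: "C0 > 0"
  proof -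
    have "0 < C0 / (1 + norm (0::'a))" using pos C0 by (rule less_le_trans)
    then show ?thesis by simp
  qed
  define A where "A = (real N + 1) * unit_ball_vol DIM('a) * (1 + 2 * C0) ^ DIM('a)"
  have Apos: "A > 0" using C0pos by (simp add: A_def)
  moreover have "measure lebesgue (E \<inter> cball z t) \<le> \<epsilon> * A * (t + 1 / (1 + norm z)) ^ DIM('a)"
    if E: "E \<in> sets lebesgue" and t: "t \<ge> 0"
      and thin: "\<And>x. measure lebesgue (E \<inter> ball x (\<rho> x)) \<le> \<epsilon> * measure lebesgue (ball x (\<rho> x))"
    for E \<epsilon> z t
  proof -
    have eps: "\<epsilon> \<ge> 0"
    proof -
      have "0 \<le> \<epsilon> * measure lebesgue (ball (0::'a) (\<rho> 0))" using order_trans[OF measure_nonneg thin[of 0]] by blast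
      moreover have "measure lebesgue (ball (0::'a) (\<rho> 0)) > 0" using pos[of 0]
        by (simp add: content_ball)
      ultimately show ?thesis by (metis mult_neg_pos not_le)
    qed
    obtain X where X: "finite X" "X \<subseteq> cball z t" "cball z t \<subseteq> (\<Union>x\<in>X. ball x (\<rho> x))"
       and sep: "\<forall>x\<in>X. \<forall>y\<in>X. x \<noteq> y \<longrightarrow> \<rho> x \<le> dist x y"
      using separated_ball_cover[OF cont pos compact_cball[of z t]] by (elim exE conjE)
    \<comment> \<open>A bound on the selected radii: either \<open>x\<close> is comparable to \<open>z\<close>, or \<open>t\<close> is at least \<open>1/2\<close>.\<close>
    define R where "R = 2 * C0 * (t + 1 / (1 + norm z))"
    have R: "\<rho> x \<le> R" if "x \<in> X" for x
    proof -
      have xt: "norm (z - x) \<le> t" using X(2) that by (auto simp: dist_norm)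
      have zx: "norm z \<le> norm x + t" using xt norm_triangle_ineq2[of z x] by simp
      have "C0 / (1 + norm x) \<le> R"
      proof -
        have nz: "1 + norm x > 0" "1 + norm z > 0" by (auto intro: add_pos_nonneg)
        have "1 / (1 + norm x) \<le> 2 * (t + 1 / (1 + norm z))"
        proof -
          have "1 \<le> 2 * (t + 1 / (1 + norm z)) * (1 + norm x)"
          proof (cases "1 + norm x \<ge> (1 + norm z) / 2")
            case True
            then have "1 \<le> 2 * (1 / (1 + norm z)) * (1 + norm x)" using nz by (simp add: field_simps)
            also have "\<dots> \<le> 2 * (t + 1 / (1 + norm z)) * (1 + norm x)"
              using t nz by (intro mult_right_mono) auto
            finally show ?thesis .
          next
            case False
            then have "t \<ge> 1/2" using zx norm_ge_zero[of x] by argo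
            then have "1 \<le> 2 * t * 1" by simp
            also have "\<dots> \<le> 2 * (t + 1 / (1 + norm z)) * (1 + norm x)"
              using t nz by (intro mult_mono) auto
            finally show ?thesis .
          qed
          then show ?thesis using nz by (simp add: pos_divide_le_eq)
        qed
        then have "C0 * (1 / (1 + norm x)) \<le> C0 * (2 * (t + 1 / (1 + norm z)))"
          using C0pos by (intro mult_left_mono) auto
        then show ?thesis by (simp add: R_def algebra_simps)
      qed
      then show ?thesis using C0[of x] by linarith
    qed
    have Rpos: "R \<ge> 0" using C0pos t by (simp add: R_def)
    have ballsub: "ball x (\<rho> x) \<subseteq> cball z (t + R)" if "x \<in> X" for x
    proof
      fix y assume "y \<in> ball x (\<rho> x)"
      moreover have "dist z x \<le> t" using X(2) that by auto
      moreover have "dist z y \<le> dist z x + dist x y" by (rule dist_triangle)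
      ultimately show "y \<in> cball z (t + R)" using R[OF that] by auto
    qed
    have meas: "E \<inter> ball x (\<rho> x) \<in> lmeasurable" for x
      using fmeasurable_Int_fmeasurable[OF lmeasurable_ball E, of x "\<rho> x"] by (simp add: Int_commute)
    have "measure lebesgue (E \<inter> cball z t) \<le> measure lebesgue (\<Union>x\<in>X. E \<inter> ball x (\<rho> x))"
      by (rule measure_mono_fmeasurable)
        (use X E meas fmeasurable.finite_UN[OF X(1), of "\<lambda>x. E \<inter> ball x (\<rho> x)"] in auto)
    also have "\<dots> \<le> (\<Sum>x\<in>X. measure lebesgue (E \<inter> ball x (\<rho> x)))"
      by (rule measure_UNION_le) (use X meas in auto)
    also have "\<dots> \<le> (\<Sum>x\<in>X. \<epsilon> * measure lebesgue (ball x (\<rho> x)))"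
      by (intro sum_mono thin)
    also have "\<dots> = \<epsilon> * (\<Sum>x\<in>X. LINT y|lebesgue. indicat_real (ball x (\<rho> x)) y)"
      by (simp add: sum_distrib_left)
    \<comment> \<open>The sum of the measures is the integral of the overlap number.\<close>
    also have "(\<Sum>x\<in>X. LINT y|lebesgue. indicat_real (ball x (\<rho> x)) y)
       = (LINT y|lebesgue. (\<Sum>x\<in>X. indicat_real (ball x (\<rho> x)) y))"
      by (subst Bochner_Integration.integral_sum) (auto simp: integrable_indicator_iff emeasure_lborel_ball_finite[simplified])
    also have "\<dots> \<le> (LINT y|lebesgue. real N * indicat_real (cball z (t + R)) y)"
    proof (intro integral_mono)
      show "integrable lebesgue (\<lambda>y. \<Sum>x\<in>X. indicat_real (ball x (\<rho> x)) y)"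
        by (intro Bochner_Integration.integrable_sum) (auto simp: integrable_indicator_iff emeasure_lborel_ball_finite[simplified])
      show "integrable lebesgue (\<lambda>y. real N * indicat_real (cball z (t + R)) y)"
        by (intro integrable_mult_right) (auto simp: integrable_indicator_iff emeasure_lborel_cball_finite[simplified])
      fix y :: 'a
      have "(\<Sum>x\<in>X. indicat_real (ball x (\<rho> x)) y) = card {x \<in> X. y \<in> ball x (\<rho> x)}"
        using X(1) by (simp add: indicator_def sum.If_cases Int_def)
      also have "\<dots> \<le> real N" using N X(1) sep by simp
      finally show "(\<Sum>x\<in>X. indicat_real (ball x (\<rho> x)) y) \<le> real N * indicat_real (cball z (t + R)) y"
      proof (cases "y \<in> cball z (t + R)")
        case False
        then have "\<And>x. x \<in> X \<Longrightarrow> y \<notin> ball x (\<rho> x)" using ballsub by blast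
        then show ?thesis by (simp add: sum_nonneg)
      qed simp
    qed
    also have "\<dots> = real N * (unit_ball_vol DIM('a) * (t + R) ^ DIM('a))"
      using t Rpos by (simp add: content_cball)
    finally have 1: "measure lebesgue (E \<inter> cball z t) \<le> \<epsilon> * (real N * (unit_ball_vol DIM('a) * (t + R) ^ DIM('a)))"
      using eps by (simp add: mult_left_mono)
    have "(t + R) \<le> (1 + 2 * C0) * (t + 1 / (1 + norm z))"
      by (simp add: R_def algebra_simps)
    then have "(t + R) ^ DIM('a) \<le> ((1 + 2 * C0) * (t + 1 / (1 + norm z))) ^ DIM('a)"
      using t Rpos by (intro power_mono) auto
    then have "real N * (unit_ball_vol DIM('a) * (t + R) ^ DIM('a))
      \<le> (real N + 1) * (unit_ball_vol DIM('a) * ((1 + 2 * C0) * (t + 1 / (1 + norm z))) ^ DIM('a))"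
      using t Rpos by (intro mult_mono mult_nonneg_nonneg zero_le_power) auto
    also have "\<dots> = A * (t + 1 / (1 + norm z)) ^ DIM('a)"
      by (simp only: A_def power_mult_distrib mult.assoc)
    finally have "\<epsilon> * (real N * (unit_ball_vol DIM('a) * (t + R) ^ DIM('a))) \<le> \<epsilon> * (A * (t + 1 / (1 + norm z)) ^ DIM('a))"
      using eps by (rule mult_left_mono)
    with 1 show ?thesis by (simp add: mult.assoc)
  qed
  ultimately show ?thesis by (intro exI[of _ A]) simp
qed

section \<open>The Schur test and the cutoff kernel\<close>

text \<open>
  The Schur test restricted to \<open>x \<in> E\<close>.  The weighted inequality between arithmetic and
  geometric mean replaces square roots by the free parameter \<open>l\<close>.
\<close>

lemma schur_test:
  fixes K :: "'a \<Rightarrow> 'b \<Rightarrow> ennreal" and F :: "'a \<Rightarrow> real" and G :: "'b \<Rightarrow> real"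
  assumes "sigma_finite_measure M" "sigma_finite_measure N"
  assumes K [measurable]: "(\<lambda>(x, y). K x y) \<in> borel_measurable (M \<Otimes>\<^sub>M N)"
    and [measurable]: "F \<in> borel_measurable M" "G \<in> borel_measurable N" "E \<in> sets M"
    and row: "\<And>x. x \<in> space M \<Longrightarrow> (\<integral>\<^sup>+y. K x y \<partial>N) \<le> 1"
    and col: "\<And>y. y \<in> space N \<Longrightarrow> (\<integral>\<^sup>+x. K x y * indicator E x \<partial>M) \<le> ennreal c"
    and l: "l > 0"
  shows "(\<integral>\<^sup>+x. (\<integral>\<^sup>+y. K x y * ennreal (F x * G y) \<partial>N) * indicator E x \<partial>M)
    \<le> ennreal (l / 2) * (\<integral>\<^sup>+x. ennreal ((F x)\<^sup>2) * indicator E x \<partial>M)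
      + ennreal (c / (2 * l)) * (\<integral>\<^sup>+y. ennreal ((G y)\<^sup>2) \<partial>N)"
proof -
  interpret M: sigma_finite_measure M by fact
  interpret N: sigma_finite_measure N by fact
  interpret P: pair_sigma_finite M N ..
  have am: "ennreal (F x * G y) \<le> ennreal (l / 2 * (F x)\<^sup>2) + ennreal ((G y)\<^sup>2 / (2 * l))" for x y
  proof -
    have "0 \<le> (l * F x - G y)\<^sup>2 / (2 * l)" using l by simp
    also have "\<dots> = l / 2 * (F x)\<^sup>2 + (G y)\<^sup>2 / (2 * l) - F x * G y"
      using l by (simp add: power2_eq_square field_simps)
    finally have "F x * G y \<le> l / 2 * (F x)\<^sup>2 + (G y)\<^sup>2 / (2 * l)" by simp
    then have "ennreal (F x * G y) \<le> ennreal (l / 2 * (F x)\<^sup>2 + (G y)\<^sup>2 / (2 * l))" by (rule ennreal_leI)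
    then show ?thesis using l by (subst (asm) ennreal_plus) auto
  qed
  have "(\<integral>\<^sup>+x. (\<integral>\<^sup>+y. K x y * ennreal (F x * G y) \<partial>N) * indicator E x \<partial>M)
    \<le> (\<integral>\<^sup>+x. (\<integral>\<^sup>+y. K x y * (ennreal (l / 2 * (F x)\<^sup>2) + ennreal ((G y)\<^sup>2 / (2 * l))) \<partial>N) * indicator E x \<partial>M)"
    by (intro nn_integral_mono mult_mono am order_refl) auto
  also have "\<dots> = (\<integral>\<^sup>+x. (\<integral>\<^sup>+y. K x y \<partial>N) * ennreal (l / 2 * (F x)\<^sup>2) * indicator E x
       + (\<integral>\<^sup>+y. K x y * ennreal ((G y)\<^sup>2 / (2 * l)) * indicator E x \<partial>N) \<partial>M)"
    by (intro nn_integral_cong)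
      (simp add: distrib_left distrib_right nn_integral_add nn_integral_multc)
  also have "\<dots> = (\<integral>\<^sup>+x. (\<integral>\<^sup>+y. K x y \<partial>N) * ennreal (l / 2 * (F x)\<^sup>2) * indicator E x \<partial>M)
       + (\<integral>\<^sup>+x. (\<integral>\<^sup>+y. K x y * ennreal ((G y)\<^sup>2 / (2 * l)) * indicator E x \<partial>N) \<partial>M)"
    by (rule nn_integral_add) measurable
  also have "(\<integral>\<^sup>+x. (\<integral>\<^sup>+y. K x y \<partial>N) * ennreal (l / 2 * (F x)\<^sup>2) * indicator E x \<partial>M)
     \<le> (\<integral>\<^sup>+x. 1 * ennreal (l / 2 * (F x)\<^sup>2) * indicator E x \<partial>M)"
    by (intro nn_integral_mono mult_mono row order_refl) auto
  also have "\<dots> = ennreal (l / 2) * (\<integral>\<^sup>+x. ennreal ((F x)\<^sup>2) * indicator E x \<partial>M)"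
    using l by (subst nn_integral_cmult[symmetric])
      (auto intro!: nn_integral_cong simp: ennreal_mult'[symmetric] mult.assoc[symmetric])
  also have "(\<integral>\<^sup>+x. (\<integral>\<^sup>+y. K x y * ennreal ((G y)\<^sup>2 / (2 * l)) * indicator E x \<partial>N) \<partial>M)
      = (\<integral>\<^sup>+y. (\<integral>\<^sup>+x. K x y * ennreal ((G y)\<^sup>2 / (2 * l)) * indicator E x \<partial>M) \<partial>N)"
    by (rule P.Fubini'[symmetric]) measurable
  also have "\<dots> = (\<integral>\<^sup>+y. (\<integral>\<^sup>+x. K x y * indicator E x \<partial>M) * ennreal ((G y)\<^sup>2 / (2 * l)) \<partial>N)"
    by (intro nn_integral_cong) (simp add: nn_integral_multc[symmetric] ac_simps)
  also have "\<dots> \<le> (\<integral>\<^sup>+y. ennreal c * ennreal ((G y)\<^sup>2 / (2 * l)) \<partial>N)"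
    by (intro nn_integral_mono mult_mono col order_refl) auto
  also have "\<dots> = ennreal (c / (2 * l)) * (\<integral>\<^sup>+y. ennreal ((G y)\<^sup>2) \<partial>N)"
  proof -
    have "ennreal c * ennreal ((G y)\<^sup>2 / (2 * l)) = ennreal (c / (2 * l)) * ennreal ((G y)\<^sup>2)" for y
      using l by (simp add: ennreal_mult''[symmetric])
    then show ?thesis by (simp add: nn_integral_cmult)
  qed
  finally show ?thesis by (simp add: add_mono)
qed

text \<open>
  \<open>E\<close> has density of order \<open>\<epsilon>\<close> in all balls of centre \<open>z\<close> and radius at least \<open>1/(1+|z|)\<close>; in smaller
  balls nothing better than the value at that radius is required.
\<close>

definition thin_above :: "real \<Rightarrow> 'a::euclidean_space set \<Rightarrow> bool" where
  "thin_above \<epsilon> E \<longleftrightarrow> E \<in> sets borel \<and>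
     (\<forall>z t. t \<ge> 0 \<longrightarrow> emeasure lborel (E \<inter> cball z t) \<le> ennreal (\<epsilon> * (t + 1 / (1 + norm z)) ^ DIM('a)))"

text \<open>
  The mass that a Gaussian of variance \<open>s\<close> gives to a thin set: outside the ball of radius
  \<open>M\<surd>s\<close> by decay, inside by thinness.
\<close>

lemma nn_integral_gauss_thin:
  fixes E :: "'a::euclidean_space set"
  assumes E: "thin_above \<epsilon> E" and "\<epsilon> \<ge> 0" and s: "s > 0" and M: "M \<ge> 0"
  shows "(\<integral>\<^sup>+x. ennreal (gauss s (x - z)) * indicator E x \<partial>lborel)
    \<le> ennreal (2 powr (DIM('a) / 2) * exp (- pi * M\<^sup>2 / 2) + \<epsilon> * (M + 1 / (sqrt s * (1 + norm z))) ^ DIM('a))"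
proof -
  have [measurable]: "E \<in> sets borel" using E by (simp add: thin_above_def)
  let ?d = "2 powr (real DIM('a) / 2)"
  have pw: "ennreal (gauss s (x - z)) * indicator E x \<le> ennreal (?d * exp (- pi * M\<^sup>2 / 2)) * ennreal (gauss (2 * s) (x - z))
      + ennreal (s powr (- (real DIM('a) / 2))) * indicator (E \<inter> cball z (M * sqrt s)) x" for x
  proof (cases "x \<in> E")
    case True
    show ?thesis
    proof (cases "x \<in> cball z (M * sqrt s)")
      case True
      have "gauss s (x - z) \<le> s powr (- (real DIM('a) / 2))"
        by (rule gauss_le[OF s])
      then show ?thesis using True \<open>x \<in> E\<close> by (simp add: add_increasing ennreal_leI)
    next
      case False
      then have "M * sqrt s < norm (x - z)" by (simp add: dist_norm norm_minus_commute)
      then have "(M * sqrt s)\<^sup>2 \<le> (norm (x - z))\<^sup>2" using M s by (intro power_mono) auto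
      then have "M\<^sup>2 * s \<le> (norm (x - z))\<^sup>2" using s by (simp add: power_mult_distrib)
      then have "pi * M\<^sup>2 / 2 \<le> pi * (norm (x - z))\<^sup>2 / (2 * s)" using s by (simp add: field_simps)
      then have "exp (pi * M\<^sup>2 / 2) \<le> exp (pi * (norm (x - z))\<^sup>2 / (2 * s))" by simp
      then have "gauss s (x - z) * exp (pi * M\<^sup>2 / 2) \<le> ?d * gauss (2 * s) (x - z)"
        unfolding gauss_double[OF s, symmetric] by (rule mult_left_mono) simp
      then have "gauss s (x - z) \<le> ?d * exp (- pi * M\<^sup>2 / 2) * gauss (2 * s) (x - z)"
        by (simp add: exp_minus field_simps)
      then have "ennreal (gauss s (x - z)) \<le> ennreal (?d * exp (- pi * M\<^sup>2 / 2) * gauss (2 * s) (x - z))"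
        by (rule ennreal_leI)
      also have "\<dots> = ennreal (?d * exp (- pi * M\<^sup>2 / 2)) * ennreal (gauss (2 * s) (x - z))"
        by (rule ennreal_mult) auto
      finally show ?thesis by (simp add: add_increasing2 indicator_def)
    qed
  qed simp
  have "(\<integral>\<^sup>+x. ennreal (gauss s (x - z)) * indicator E x \<partial>lborel)
    \<le> (\<integral>\<^sup>+x. ennreal (?d * exp (- pi * M\<^sup>2 / 2)) * ennreal (gauss (2 * s) (x - z))
      + ennreal (s powr (- (real DIM('a) / 2))) * indicator (E \<inter> cball z (M * sqrt s)) x \<partial>lborel)"
    by (intro nn_integral_mono pw)
  also have "\<dots> = ennreal (?d * exp (- pi * M\<^sup>2 / 2)) + ennreal (s powr (- (real DIM('a) / 2))) * emeasure lborel (E \<inter> cball z (M * sqrt s))"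
  proof -
    have 1: "(\<integral>\<^sup>+x. A * ennreal (gauss (2 * s) (x - z)) + B * indicator (E \<inter> cball z (M * sqrt s)) x \<partial>lborel)
      = A + B * emeasure lborel (E \<inter> cball z (M * sqrt s))" for A B
    proof -
      have [measurable]: "E \<inter> cball z (M * sqrt s) \<in> sets borel" by simp
      show ?thesis
        using s by (subst nn_integral_add) (auto simp: nn_integral_cmult nn_integral_cmult_indicator nn_integral_gauss_shift)
    qed
    show ?thesis by (rule 1)
  qed
  also have "\<dots> \<le> ennreal (?d * exp (- pi * M\<^sup>2 / 2)) + ennreal (s powr (- (real DIM('a) / 2)))
       * ennreal (\<epsilon> * (M * sqrt s + 1 / (1 + norm z)) ^ DIM('a))"
    using E M s by (intro add_left_mono mult_left_mono) (auto simp: thin_above_def)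
  also have "\<dots> = ennreal (?d * exp (- pi * M\<^sup>2 / 2) + s powr (- (real DIM('a) / 2)) * (\<epsilon> * (M * sqrt s + 1 / (1 + norm z)) ^ DIM('a)))"
    using \<open>\<epsilon> \<ge> 0\<close> M s by (simp add: ennreal_mult ennreal_plus)
  also have "s powr (- (real DIM('a) / 2)) = (1 / sqrt s) ^ DIM('a)" by (rule inverse_sqrt_power[OF s, symmetric])
  also have "(1 / sqrt s) ^ DIM('a) * (\<epsilon> * (M * sqrt s + 1 / (1 + norm z)) ^ DIM('a))
      = \<epsilon> * ((1 / sqrt s) * (M * sqrt s + 1 / (1 + norm z))) ^ DIM('a)"
    by (simp only: power_mult_distrib mult.left_commute mult.assoc)
  also have "(1 / sqrt s) * (M * sqrt s + 1 / (1 + norm z)) = M + 1 / (sqrt s * (1 + norm z))"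
  proof -
    have "(1 / sqrt s) * (M * sqrt s) = M" using s by simp
    then show ?thesis by (simp only: distrib_left times_divide_times_eq mult_1)
  qed
  finally show ?thesis .
qed

text \<open>
  The kernel obtained at the parameter \<open>r\<close>: minus the \<open>r\<close>-derivative of the cutoff \<open>bell r x\<close>,
  composed with the convolution by \<open>gauss r\<close>.
\<close>

definition slice_kernel :: "real \<Rightarrow> 'a::euclidean_space \<Rightarrow> 'a \<Rightarrow> real" where
  "slice_kernel r x y = pi * (norm x)\<^sup>2 * bell r x * gauss r (x - y)"

lemma slice_kernel_nonneg [simp]: "0 \<le> slice_kernel r x y"
  by (simp add: slice_kernel_def)

lemma borel_measurable_slice_kernel [measurable]:
  assumes [measurable]: "f \<in> borel_measurable M" "g \<in> borel_measurable M" "h \<in> borel_measurable M"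
  shows "(\<lambda>z. slice_kernel (f z) (g z) (h z)) \<in> borel_measurable M"
  unfolding slice_kernel_def gauss_def by measurable

text \<open>
  Completing the square in \<open>x\<close> moves the decay in \<open>x\<close> to \<open>y\<close>.
\<close>

lemma exp_mult_gauss:
  fixes x y :: "'a::euclidean_space"
  assumes r: "r > 0"
  shows "bell r x * gauss r (x - y) =
     (1 + r\<^sup>2) powr (- (real DIM('a) / 2)) * exp (- pi * (norm y)\<^sup>2 * r / (1 + r\<^sup>2))
      * gauss (r / (1 + r\<^sup>2)) (x - y /\<^sub>R (1 + r\<^sup>2))"
proof -
  let ?d = "- (real DIM('a) / 2)"
  have r1: "1 / r > 0" "1 + r\<^sup>2 > 0" using r by (auto intro: add_pos_nonneg)
  have e: "gauss (1 / r) (x - 0) = (1 / r) powr ?d * bell r x"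
    using r by (simp add: gauss_def mult.assoc mult.commute mult.left_commute)
  have rr: "r powr ?d * (1 / r) powr ?d = 1"
    using r by (subst powr_mult[symmetric]) auto
  have s: "r + 1 / r = (1 + r\<^sup>2) / r" using r by (simp add: field_simps power2_eq_square)
  have c: "(1 / (r + 1 / r)) *\<^sub>R ((1 / r) *\<^sub>R y + r *\<^sub>R 0) = y /\<^sub>R (1 + r\<^sup>2)"
    unfolding s using r by (simp add: inverse_eq_divide)
  have p: "r * (1 / r) / (r + 1 / r) = r / (1 + r\<^sup>2)" unfolding s using r by simp
  have g: "r powr ?d * gauss (r + 1 / r) (y - 0) = (1 + r\<^sup>2) powr ?d * exp (- pi * (norm y)\<^sup>2 * r / (1 + r\<^sup>2))"
  proof -
    have "r powr ?d * ((1 + r\<^sup>2) / r) powr ?d = (1 + r\<^sup>2) powr ?d"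
      using r r1 by (subst powr_mult[symmetric]) auto
    then show ?thesis unfolding gauss_def s using r by (simp add: mult.assoc[symmetric])
  qed
  have "bell r x * gauss r (x - y) = r powr ?d * ((1 / r) powr ?d * bell r x) * gauss r (x - y)"
    using rr by (simp add: mult.assoc[symmetric])
  also have "\<dots> = r powr ?d * (gauss r (x - y) * gauss (1 / r) (x - 0))"
    unfolding e by simp
  also have "\<dots> = (r powr ?d * gauss (r + 1 / r) (y - 0)) * gauss (r / (1 + r\<^sup>2)) (x - y /\<^sub>R (1 + r\<^sup>2))"
    unfolding gauss_mult[OF r r1(1)] p c by simp
  also note g
  finally show ?thesis .
qed

text \<open>
  For \<open>r \<le> 1\<close> the slice kernel is, as a function of \<open>x\<close>, dominated by a multiple of one
  Gaussian of variance about \<open>r\<close>, centred at a point comparable to \<open>y\<close>.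
\<close>

lemma slice_kernel_le:
  fixes x y :: "'a::euclidean_space"
  assumes r: "0 < r" "r \<le> 1"
  shows "slice_kernel r x y \<le> 2 * pi * 2 powr (DIM('a) / 2) * ((norm y)\<^sup>2 + 1) * exp (- pi * r * (norm y)\<^sup>2 / 2)
      * gauss (2 * (r / (1 + r\<^sup>2))) (x - y /\<^sub>R (1 + r\<^sup>2))"
proof -
  let ?d = "- (real DIM('a) / 2)"
  define q where "q = r / (1 + r\<^sup>2)"
  define z where "z = y /\<^sub>R (1 + r\<^sup>2)"
  define v where "v = x - z"
  have r2: "1 + r\<^sup>2 \<ge> 1" "1 + r\<^sup>2 \<le> 2" "1 + r\<^sup>2 > 0" using r by (auto simp: power_le_one add_pos_nonneg)
  have q: "0 < q" "q \<le> 1" "r / 2 \<le> q"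
  proof -
    show "0 < q" using r r2 by (simp add: q_def)
    have "r \<le> 1 * (1 + r\<^sup>2)" using r by (simp add: add_increasing2)
    then show "q \<le> 1" unfolding q_def using r2(3) by (simp only: pos_divide_le_eq)
    show "r / 2 \<le> q" unfolding q_def using r r2 by (intro divide_left_mono mult_pos_pos) auto
  qed
  have nz: "norm z \<le> norm y"
  proof -
    have "inverse (1 + r\<^sup>2) \<le> 1" using r2 by (simp add: inverse_le_1_iff)
    then have "inverse (1 + r\<^sup>2) * norm y \<le> 1 * norm y" by (intro mult_right_mono) auto
    then show ?thesis using r2(3) by (simp add: z_def)
  qed
  have pre: "(1 + r\<^sup>2) powr ?d * exp (- pi * (norm y)\<^sup>2 * r / (1 + r\<^sup>2)) \<le> exp (- pi * r * (norm y)\<^sup>2 / 2)"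
  proof -
    have "(1 + r\<^sup>2) powr ?d \<le> 1" using r2(3) powr_mono[of ?d 0 "1 + r\<^sup>2"] r2(1) by (simp split: if_splits)
    moreover have "pi * r * (norm y)\<^sup>2 / 2 \<le> pi * (norm y)\<^sup>2 * r / (1 + r\<^sup>2)"
    proof -
      have "(pi * (norm y)\<^sup>2) * (r / 2) \<le> (pi * (norm y)\<^sup>2) * q" using q by (intro mult_left_mono) auto
      then show ?thesis by (simp add: q_def mult.assoc mult.commute mult.left_commute)
    qed
    ultimately have "(1 + r\<^sup>2) powr ?d * exp (- pi * (norm y)\<^sup>2 * r / (1 + r\<^sup>2)) \<le> 1 * exp (- pi * r * (norm y)\<^sup>2 / 2)"
      by (intro mult_mono) auto
    then show ?thesis by simp
  qed
  have xx: "(norm x)\<^sup>2 \<le> 2 * (norm y)\<^sup>2 + 2 * (norm v)\<^sup>2"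
  proof -
    have "norm x \<le> norm z + norm v" using norm_triangle_ineq[of z v] by (simp add: v_def)
    then have "norm x \<le> norm y + norm v" using nz by simp
    then have "(norm x)\<^sup>2 \<le> (norm y + norm v)\<^sup>2" by (rule power_mono) simp
    also have "\<dots> \<le> 2 * (norm y)\<^sup>2 + 2 * (norm v)\<^sup>2"
      using zero_le_power2[of "norm y - norm v"] by (simp add: power2_eq_square algebra_simps)
    finally show ?thesis .
  qed
  have main: "(norm x)\<^sup>2 * gauss q v \<le> 2 * ((norm y)\<^sup>2 + 1) * (2 powr (DIM('a) / 2) * gauss (2 * q) v)"
  proof -
    let ?e = "exp (pi * (norm v)\<^sup>2 / (2 * q))"
    have "1 + pi * (norm v)\<^sup>2 / (2 * q) \<le> ?e" by (rule exp_ge_add_one_self)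
    moreover have "(norm v)\<^sup>2 \<le> pi * (norm v)\<^sup>2 / (2 * q)"
    proof -
      have "2 * q \<le> pi" using q pi_ge_two by simp
      then have "2 * q * (norm v)\<^sup>2 \<le> pi * (norm v)\<^sup>2" by (intro mult_right_mono) auto
      then show ?thesis using q by (simp add: field_simps)
    qed
    moreover have "0 \<le> pi * (norm v)\<^sup>2 / (2 * q)" using q by simp
    ultimately have ve: "(norm v)\<^sup>2 \<le> ?e" "1 \<le> ?e" by linarith+
    have "(norm x)\<^sup>2 \<le> 2 * (norm y)\<^sup>2 * 1 + 2 * (norm v)\<^sup>2" using xx by simp
    also have "\<dots> \<le> 2 * (norm y)\<^sup>2 * ?e + 2 * ?e"
      using ve by (intro add_mono mult_left_mono) auto
    also have "\<dots> = 2 * ((norm y)\<^sup>2 + 1) * ?e" by (simp add: algebra_simps)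
    finally have "(norm x)\<^sup>2 * gauss q v \<le> (2 * ((norm y)\<^sup>2 + 1) * ?e) * gauss q v"
      by (rule mult_right_mono) simp
    also have "\<dots> = 2 * ((norm y)\<^sup>2 + 1) * (gauss q v * ?e)" by (simp only: mult.assoc mult.commute mult.left_commute)
    finally show ?thesis by (simp only: gauss_double[OF q(1)])
  qed
  have "slice_kernel r x y = pi * (norm x)\<^sup>2 * (bell r x * gauss r (x - y))"
    by (simp add: slice_kernel_def)
  also have "\<dots> = (1 + r\<^sup>2) powr ?d * exp (- pi * (norm y)\<^sup>2 * r / (1 + r\<^sup>2)) * (pi * ((norm x)\<^sup>2 * gauss q v))"
    unfolding exp_mult_gauss[OF r(1)] by (simp add: q_def v_def z_def)
  also have "\<dots> \<le> exp (- pi * r * (norm y)\<^sup>2 / 2) * (pi * (2 * ((norm y)\<^sup>2 + 1) * (2 powr (DIM('a) / 2) * gauss (2 * q) v)))"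
    by (intro mult_mono pre main order_refl) auto
  finally show ?thesis
    unfolding q_def v_def z_def by (simp only: mult.assoc mult.commute mult.left_commute)
qed

text \<open>
  The integral of the slice kernels over \<open>0 < r < 1\<close>, with values in \<open>[0,\<infinity>]\<close>.  The weight
  \<open>\<pi>|x|\<^sup>2 e\<^bsup>-\<pi>r|x|\<^sup>2\<^esup>\<close> concentrates at \<open>r \<approx> 1/|x|\<^sup>2\<close>, so the kernel lives at the scale \<open>1/|x|\<close>.
\<close>

definition cutoff_kernel :: "'a::euclidean_space \<Rightarrow> 'a \<Rightarrow> ennreal" where
  "cutoff_kernel x y = (\<integral>\<^sup>+r. ennreal (slice_kernel r x y) * indicator {0<..<1} r \<partial>lborel)"

lemma borel_measurable_cutoff_kernel [measurable]:
  "(\<lambda>(x, y). cutoff_kernel x y) \<in> borel_measurable (lborel \<Otimes>\<^sub>M lborel)"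
  unfolding cutoff_kernel_def by measurable

lemma nn_integral_exp:
  assumes "l > 0"
  shows "(\<integral>\<^sup>+r. ennreal (l * exp (- r * l)) * indicator {0<..<1} r \<partial>lborel) \<le> 1"
proof -
  have "(\<integral>\<^sup>+r. ennreal (l * exp (- r * l)) * indicator {0<..<1} r \<partial>lborel)
     \<le> (\<integral>\<^sup>+r. ennreal (exponential_density l r) \<partial>lborel)"
    by (intro nn_integral_mono) (auto simp: exponential_density_def indicator_def)
  also have "\<dots> = 1"
    using prob_space.emeasure_space_1[OF prob_space_exponential_density[OF assms]]
    by (simp add: emeasure_density)
  finally show ?thesis .
qed

lemma cutoff_kernel_row: "(\<integral>\<^sup>+y. cutoff_kernel x y \<partial>lborel) \<le> 1"
proof -
  have "(\<integral>\<^sup>+y. cutoff_kernel x y \<partial>lborel) = (\<integral>\<^sup>+r. (\<integral>\<^sup>+y. ennreal (slice_kernel r x y) * indicator {0<..<1} r \<partial>lborel) \<partial>lborel)"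
    unfolding cutoff_kernel_def by (rule lborel_pair.Fubini') measurable
  also have "\<dots> = (\<integral>\<^sup>+r. ennreal (pi * (norm x)\<^sup>2 * bell r x) * indicator {0<..<1} r \<partial>lborel)"
  proof (intro nn_integral_cong)
    fix r :: real
    show "(\<integral>\<^sup>+y. ennreal (slice_kernel r x y) * indicator {0<..<1} r \<partial>lborel)
       = ennreal (pi * (norm x)\<^sup>2 * bell r x) * indicator {0<..<1} r"
    proof (cases "r \<in> {0<..<1}")
      case True
      then show ?thesis
        by (simp add: slice_kernel_def ennreal_mult nn_integral_cmult nn_integral_gauss_shift)
    qed simp
  qed
  also have "\<dots> \<le> 1"
  proof (cases "x = 0")
    case False
    then have "pi * (norm x)\<^sup>2 > 0" by simp
    from nn_integral_exp[OF this] show ?thesis by (simp add: mult.assoc mult.commute mult.left_commute)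
  qed simp
  finally show ?thesis .
qed

text \<open>
  The mass over \<open>x \<in> E\<close>.  Parameters \<open>r < \<delta>/(1+|y|\<^sup>2)\<close> belong to scales at which \<open>E\<close> need not be
  thin, but they contribute only \<open>O(\<delta>)\<close>; for the others the Gaussians of \<open>slice_kernel_le\<close>
  give mass at most \<open>\<beta>\<close> to \<open>E\<close>.
\<close>

lemma cutoff_kernel_col:
  fixes y :: "'a::euclidean_space"
  assumes [measurable]: "E \<in> sets borel" and "\<delta> \<ge> 0" "\<beta> \<ge> 0"
    and \<Gamma>: "\<And>r. 0 < r \<Longrightarrow> r \<le> 1 \<Longrightarrow> \<delta> / (1 + (norm y)\<^sup>2) \<le> r \<Longrightarrow>
      (\<integral>\<^sup>+x. ennreal (gauss (2 * (r / (1 + r\<^sup>2))) (x - y /\<^sub>R (1 + r\<^sup>2))) * indicator E x \<partial>lborel) \<le> ennreal \<beta>"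
  shows "(\<integral>\<^sup>+x. cutoff_kernel x y * indicator E x \<partial>lborel) \<le> ennreal (2 * pi * 2 powr (DIM('a) / 2) * (\<delta> + exp 1 * \<beta>))"
proof -
  let ?c = "2 * pi * 2 powr (DIM('a) / 2)"
  let ?s = "1 + (norm y)\<^sup>2"
  have s1: "?s > 0" by (auto intro: add_pos_nonneg)
  let ?G = "\<lambda>r x. gauss (2 * (r / (1 + r\<^sup>2))) (x - y /\<^sub>R (1 + r\<^sup>2))"
  have "(\<integral>\<^sup>+x. cutoff_kernel x y * indicator E x \<partial>lborel)
     = (\<integral>\<^sup>+x. (\<integral>\<^sup>+r. ennreal (slice_kernel r x y) * indicator {0<..<1} r * indicator E x \<partial>lborel) \<partial>lborel)"
    unfolding cutoff_kernel_def by (intro nn_integral_cong nn_integral_multc[symmetric]) measurable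
  also have "\<dots> = (\<integral>\<^sup>+r. (\<integral>\<^sup>+x. ennreal (slice_kernel r x y) * indicator {0<..<1} r * indicator E x \<partial>lborel) \<partial>lborel)"
    by (rule lborel_pair.Fubini') measurable
  also have "\<dots> \<le> (\<integral>\<^sup>+r. ennreal ?c * (ennreal ?s * indicator {0..\<delta> / ?s} r
         + ennreal (exp 1 * \<beta>) * (ennreal (?s * exp (- r * ?s)) * indicator {0<..<1} r)) \<partial>lborel)"
  proof (rule nn_integral_mono)
    fix r :: real
    show "(\<integral>\<^sup>+x. ennreal (slice_kernel r x y) * indicator {0<..<1} r * indicator E x \<partial>lborel)
       \<le> ennreal ?c * (ennreal ?s * indicator {0..\<delta> / ?s} r
         + ennreal (exp 1 * \<beta>) * (ennreal (?s * exp (- r * ?s)) * indicator {0<..<1} r))" (is "?L \<le> _")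
    proof (cases "r \<in> {0<..<1}")
      case False then show ?thesis by simp
    next
      case True
      then have r: "0 < r" "r \<le> 1" "r < 1" by auto
      have q: "0 < r / (1 + r\<^sup>2)" using r by (simp add: add_pos_nonneg)
      have "?L \<le> (\<integral>\<^sup>+x. ennreal (?c * ?s * exp (- pi * r * (norm y)\<^sup>2 / 2)) * (ennreal (?G r x) * indicator E x) \<partial>lborel)"
      proof (rule nn_integral_mono)
        fix x
        have "ennreal (slice_kernel r x y) \<le> ennreal (?c * ?s * exp (- pi * r * (norm y)\<^sup>2 / 2) * ?G r x)"
          using slice_kernel_le[OF r(1,2), of x y] by (intro ennreal_leI) (simp add: add.commute)
        also have "\<dots> = ennreal (?c * ?s * exp (- pi * r * (norm y)\<^sup>2 / 2)) * ennreal (?G r x)"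
          by (rule ennreal_mult) auto
        finally show "ennreal (slice_kernel r x y) * indicator {0<..<1} r * indicator E x
          \<le> ennreal (?c * ?s * exp (- pi * r * (norm y)\<^sup>2 / 2)) * (ennreal (?G r x) * indicator E x)"
          using True by (simp add: mult.assoc[symmetric] mult_right_mono)
      qed
      also have "\<dots> = ennreal (?c * ?s * exp (- pi * r * (norm y)\<^sup>2 / 2)) * (\<integral>\<^sup>+x. ennreal (?G r x) * indicator E x \<partial>lborel)"
        by (rule nn_integral_cmult) measurable
      finally have L: "?L \<le> ennreal (?c * ?s * exp (- pi * r * (norm y)\<^sup>2 / 2)) * (\<integral>\<^sup>+x. ennreal (?G r x) * indicator E x \<partial>lborel)" .
      \<comment> \<open>Below the threshold the mass one of the Gaussian suffices, above it its mass on \<open>E\<close> is used.\<close>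
      show ?thesis
      proof (cases "r \<le> \<delta> / ?s")
        case True
        have "(\<integral>\<^sup>+x. ennreal (?G r x) * indicator E x \<partial>lborel) \<le> (\<integral>\<^sup>+x. ennreal (?G r x) \<partial>lborel)"
          by (intro nn_integral_mono) (auto simp: indicator_def)
        also have "\<dots> = 1" using q by (intro nn_integral_gauss_shift) auto
        finally have "(\<integral>\<^sup>+x. ennreal (?G r x) * indicator E x \<partial>lborel) \<le> 1" .
        moreover have "ennreal (?c * ?s * exp (- pi * r * (norm y)\<^sup>2 / 2)) \<le> ennreal (?c * ?s)"
          using r s1 by (intro ennreal_leI) (auto simp: mult_left_le)
        ultimately have "?L \<le> ennreal (?c * ?s) * 1"
          by (intro order_trans[OF L] mult_mono) auto
        also have "\<dots> = ennreal ?c * ennreal ?s" using s1 by (simp add: ennreal_mult)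
        also have "\<dots> \<le> ennreal ?c * (ennreal ?s * indicator {0..\<delta> / ?s} r
         + ennreal (exp 1 * \<beta>) * (ennreal (?s * exp (- r * ?s)) * indicator {0<..<1} r))"
          using True r by (intro mult_left_mono) auto
        finally show ?thesis .
      next
        case False
        have "exp (- pi * r * (norm y)\<^sup>2 / 2) \<le> exp 1 * exp (- r * ?s)"
        proof -
          have "r * (norm y)\<^sup>2 * 2 \<le> r * (norm y)\<^sup>2 * pi" using r pi_ge_two by (intro mult_left_mono) auto
          moreover have "- pi * r * (norm y)\<^sup>2 / 2 = - (r * (norm y)\<^sup>2 * pi) / 2" by simp
          moreover have "1 + - r * ?s = 1 - r - r * (norm y)\<^sup>2" by (simp add: algebra_simps)
          ultimately have "- pi * r * (norm y)\<^sup>2 / 2 \<le> 1 + - r * ?s" using r by linarith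
          then show ?thesis by (simp only: exp_add[symmetric] exp_le_cancel_iff)
        qed
        then have 1: "ennreal (?c * ?s * exp (- pi * r * (norm y)\<^sup>2 / 2)) \<le> ennreal (?c * ?s * (exp 1 * exp (- r * ?s)))"
          using s1 by (intro ennreal_leI mult_left_mono) auto
        have 2: "(\<integral>\<^sup>+x. ennreal (?G r x) * indicator E x \<partial>lborel) \<le> ennreal \<beta>"
          using False r by (intro \<Gamma>) auto
        have "?L \<le> ennreal (?c * ?s * (exp 1 * exp (- r * ?s))) * ennreal \<beta>"
          by (intro order_trans[OF L] mult_mono 1 2) auto
        also have "\<dots> = ennreal (?c * ?s * (exp 1 * exp (- r * ?s)) * \<beta>)"
          using s1 \<open>\<beta> \<ge> 0\<close> by (subst ennreal_mult) auto
        also have "?c * ?s * (exp 1 * exp (- r * ?s)) * \<beta> = ?c * ((exp 1 * \<beta>) * (?s * exp (- r * ?s)))"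
          by (simp only: mult.assoc mult.commute mult.left_commute)
        also have "ennreal \<dots> = ennreal ?c * (ennreal (exp 1 * \<beta>) * ennreal (?s * exp (- r * ?s)))"
          using s1 \<open>\<beta> \<ge> 0\<close> by (subst ennreal_mult, simp, simp, subst ennreal_mult) auto
        also have "\<dots> = ennreal ?c * (ennreal ?s * indicator {0..\<delta> / ?s} r
         + ennreal (exp 1 * \<beta>) * (ennreal (?s * exp (- r * ?s)) * indicator {0<..<1} r))"
          using False True by simp
        finally show ?thesis .
      qed
    qed
  qed
  also have "\<dots> = ennreal ?c * (ennreal ?s * emeasure lborel {0..\<delta> / ?s}
         + ennreal (exp 1 * \<beta>) * (\<integral>\<^sup>+r. ennreal (?s * exp (- r * ?s)) * indicator {0<..<1} r \<partial>lborel))"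
    by (simp add: nn_integral_cmult nn_integral_add)
  also have "\<dots> \<le> ennreal ?c * (ennreal \<delta> + ennreal (exp 1 * \<beta>) * 1)"
  proof (intro mult_left_mono add_mono nn_integral_exp s1)
    show "ennreal ?s * emeasure lborel {0..\<delta> / ?s} \<le> ennreal \<delta>"
    proof -
      have "ennreal ?s * emeasure lborel {0..\<delta> / ?s} = ennreal ?s * ennreal (\<delta> / ?s)" using s1 \<open>\<delta> \<ge> 0\<close> by simp
      also have "\<dots> = ennreal (?s * (\<delta> / ?s))" using s1 \<open>\<delta> \<ge> 0\<close> by (subst ennreal_mult) auto
      also have "?s * (\<delta> / ?s) = \<delta>" using s1 by simp
      finally show ?thesis by simp
    qed
  qed auto
  also have "\<dots> = ennreal (?c * (\<delta> + exp 1 * \<beta>))"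
    using \<open>\<delta> \<ge> 0\<close> \<open>\<beta> \<ge> 0\<close> by (simp add: ennreal_mult ennreal_plus)
  finally show ?thesis .
qed

lemma cutoff_kernel_col_total:
  fixes y :: "'a::euclidean_space"
  assumes [measurable]: "E \<in> sets borel"
  shows "(\<integral>\<^sup>+x. cutoff_kernel x y * indicator E x \<partial>lborel) \<le> ennreal (2 * pi * 2 powr (DIM('a) / 2) * exp 1)"
proof -
  have "(\<integral>\<^sup>+x. cutoff_kernel x y * indicator E x \<partial>lborel) \<le> ennreal (2 * pi * 2 powr (DIM('a) / 2) * (0 + exp 1 * 1))"
  proof (rule cutoff_kernel_col)
    fix r :: real assume r: "0 < r" "r \<le> 1"
    have q: "0 < r / (1 + r\<^sup>2)" using r by (simp add: add_pos_nonneg)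
    have "(\<integral>\<^sup>+x. ennreal (gauss (2 * (r / (1 + r\<^sup>2))) (x - y /\<^sub>R (1 + r\<^sup>2))) * indicator E x \<partial>lborel)
      \<le> (\<integral>\<^sup>+x. ennreal (gauss (2 * (r / (1 + r\<^sup>2))) (x - y /\<^sub>R (1 + r\<^sup>2))) \<partial>lborel)"
      by (intro nn_integral_mono) (auto simp: indicator_def)
    also have "\<dots> = 1" using q by (intro nn_integral_gauss_shift) auto
    finally show "(\<integral>\<^sup>+x. ennreal (gauss (2 * (r / (1 + r\<^sup>2))) (x - y /\<^sub>R (1 + r\<^sup>2))) * indicator E x \<partial>lborel) \<le> ennreal 1"
      by simp
  qed auto
  then show ?thesis by simp
qed

text \<open>
  The column masses over a thin set are arbitrarily small; the second estimate treats the kernel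
  left over at \<open>r = 1\<close>.
\<close>

lemma thin_columns:
  assumes "\<eta> > 0"
  shows "\<exists>\<epsilon>>0. \<forall>E::'a::euclidean_space set. thin_above \<epsilon> E \<longrightarrow>
     (\<forall>y. (\<integral>\<^sup>+x. cutoff_kernel x y * indicator E x \<partial>lborel) \<le> ennreal \<eta>) \<and>
     (\<integral>\<^sup>+x. ennreal (gauss 1 (x::'a)) * indicator E x \<partial>lborel) \<le> ennreal \<eta>"
proof -
  let ?c = "2 * pi * 2 powr (DIM('a) / 2)"
  have c: "?c \<ge> 1" "?c > 0"
  proof -
    have "2 powr (real DIM('a) / 2) \<ge> 1" by (simp add: ge_one_powr_ge_zero)
    then have "1 * 1 \<le> ?c" using pi_ge_two by (intro mult_mono) auto
    then show "?c \<ge> 1" "?c > 0" by auto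
  qed
  \<comment> \<open>First \<open>\<beta>\<close> and \<open>\<delta>\<close> are fixed, then the truncation radius \<open>M\<close>, and the thinness \<open>\<epsilon>\<close> last.\<close>
  define \<beta> where "\<beta> = min 1 \<eta> / (4 * ?c * exp 1)"
  define \<delta> where "\<delta> = min 1 (\<eta> / (4 * ?c))"
  have b: "\<beta> > 0" using assms c by (simp add: \<beta>_def)
  have dl: "\<delta> > 0" "\<delta> \<le> 1" "\<delta> \<le> \<eta> / (4 * ?c)" using assms c by (auto simp: \<delta>_def)
  have tot: "?c * (\<delta> + exp 1 * \<beta>) \<le> \<eta>"
  proof -
    have "exp 1 * \<beta> = min 1 \<eta> / (4 * ?c)" by (simp add: \<beta>_def)
    also have "\<dots> \<le> \<eta> / (4 * ?c)" using c by (intro divide_right_mono) auto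
    finally have "\<delta> + exp 1 * \<beta> \<le> \<eta> / (2 * ?c)" using dl by simp
    then have "?c * (\<delta> + exp 1 * \<beta>) \<le> ?c * (\<eta> / (2 * ?c))" using c by (intro mult_left_mono) auto
    also have "\<dots> \<le> \<eta>" using c assms by simp
    finally show ?thesis .
  qed
  have beta_eta: "\<beta> \<le> \<eta>"
  proof -
    have "1 * 1 \<le> 4 * ?c * exp 1" using c by (intro mult_mono) auto
    then have g: "1 \<le> 4 * ?c * exp 1" by simp
    have "\<beta> \<le> min 1 \<eta> / 1" unfolding \<beta>_def by (rule divide_left_mono[OF g]) (use g assms in auto)
    then show ?thesis by simp
  qed
  have lim: "((\<lambda>M. 2 powr (real DIM('a) / 2) * exp (- pi * M\<^sup>2 / 2)) \<longlongrightarrow> 0) at_top"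
  proof -
    have "filterlim (\<lambda>M::real. (pi / 2) * M\<^sup>2) at_top at_top"
      by (intro filterlim_tendsto_pos_mult_at_top[OF tendsto_const] filterlim_pow_at_top filterlim_ident) auto
    then have "filterlim (\<lambda>M::real. pi * M\<^sup>2 / 2) at_top at_top" by simp
    then have "((\<lambda>M. exp (- (pi * M\<^sup>2 / 2))) \<longlongrightarrow> 0) at_top"
      by (intro filterlim_compose[OF exp_at_bot]) (simp add: filterlim_uminus_at_bot)
    from tendsto_mult_right_zero[OF this, of "2 powr (real DIM('a) / 2)"] show ?thesis by simp
  qed
  have "\<forall>\<^sub>F M in at_top. 2 powr (real DIM('a) / 2) * exp (- pi * M\<^sup>2 / 2) < \<beta> / 2 \<and> M \<ge> 0"
    using order_tendstoD(2)[OF lim, of "\<beta> / 2"] b eventually_ge_at_top[of 0] by (auto intro: eventually_conj)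
  then obtain M where M: "2 powr (real DIM('a) / 2) * exp (- pi * M\<^sup>2 / 2) < \<beta> / 2" "M \<ge> 0"
    using eventually_happens'[OF trivial_limit_at_top_linorder] by blast
  define Q where "Q = (M + 2 / sqrt \<delta>) ^ DIM('a)"
  have Q: "Q > 0" using M dl by (simp add: Q_def add_nonneg_pos)
  define \<epsilon> where "\<epsilon> = \<beta> / (2 * Q)"
  have eps: "\<epsilon> > 0" using b Q by (simp add: \<epsilon>_def)
  have \<Gamma>: "(\<integral>\<^sup>+x. ennreal (gauss s (x - z)) * indicator E x \<partial>lborel) \<le> ennreal \<beta>"
    if E: "thin_above \<epsilon> E" and s: "s > 0" and sz: "1 / (sqrt s * (1 + norm z)) \<le> 2 / sqrt \<delta>" for E s and z :: 'a
  proof -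
    have "(M + 1 / (sqrt s * (1 + norm z))) ^ DIM('a) \<le> Q"
      unfolding Q_def using sz s M by (intro power_mono) auto
    then have "\<epsilon> * (M + 1 / (sqrt s * (1 + norm z))) ^ DIM('a) \<le> \<epsilon> * Q" using eps by simp
    also have "\<dots> = \<beta> / 2" using Q by (simp add: \<epsilon>_def)
    finally have "2 powr (real DIM('a) / 2) * exp (- pi * M\<^sup>2 / 2) + \<epsilon> * (M + 1 / (sqrt s * (1 + norm z))) ^ DIM('a) \<le> \<beta>"
      using M by simp
    then show ?thesis
      using nn_integral_gauss_thin[OF E _ s M(2), of z] eps by (auto intro: order_trans ennreal_leI)
  qed
  have "(\<integral>\<^sup>+x. cutoff_kernel x y * indicator E x \<partial>lborel) \<le> ennreal \<eta>" if E: "thin_above \<epsilon> E" for E and y :: 'a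
  proof -
    have "(\<integral>\<^sup>+x. cutoff_kernel x y * indicator E x \<partial>lborel) \<le> ennreal (?c * (\<delta> + exp 1 * \<beta>))"
    proof (rule cutoff_kernel_col)
      show "E \<in> sets borel" using E by (simp add: thin_above_def)
      fix r :: real assume r: "0 < r" "r \<le> 1" "\<delta> / (1 + (norm y)\<^sup>2) \<le> r"
      have r2: "1 + r\<^sup>2 \<ge> 1" "1 + r\<^sup>2 \<le> 2" "1 + r\<^sup>2 > 0" using r by (auto simp: power_le_one add_pos_nonneg)
      let ?s = "2 * (r / (1 + r\<^sup>2))"
      let ?z = "y /\<^sub>R (1 + r\<^sup>2)"
      have s: "?s > 0" "r \<le> ?s" 
      proof -
        show "?s > 0" using r r2 by simp
        have "r / 2 \<le> r / (1 + r\<^sup>2)" using r r2 by (intro divide_left_mono mult_pos_pos) auto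
        then show "r \<le> ?s" by (simp add: mult.commute)
      qed
      have nz: "norm y / 2 \<le> norm ?z"
      proof -
        have "inverse 2 \<le> inverse (1 + r\<^sup>2)" using r2 by (intro le_imp_inverse_le) auto
        then have "inverse 2 * norm y \<le> inverse (1 + r\<^sup>2) * norm y" by (rule mult_right_mono) simp
        then show ?thesis using r2(3) by simp
      qed
      have "sqrt \<delta> \<le> 2 * (sqrt ?s * (1 + norm ?z))"
      proof -
        have "sqrt \<delta> \<le> sqrt (r * (1 + (norm y)\<^sup>2))"
          using r by (simp add: pos_divide_le_eq add_pos_nonneg)
        also have "\<dots> \<le> sqrt (?s * (1 + norm y)\<^sup>2)"
          using s r by (intro real_sqrt_le_mono mult_mono) (auto simp: power2_eq_square algebra_simps)
        also have "\<dots> = sqrt ?s * (1 + norm y)" by (simp only: real_sqrt_mult) simp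
        also have "\<dots> \<le> sqrt ?s * (2 * (1 + norm ?z))" using nz s by (intro mult_left_mono) auto
        finally show ?thesis by (simp only: mult.left_commute)
      qed
      then have sz: "1 / (sqrt ?s * (1 + norm ?z)) \<le> 2 / sqrt \<delta>"
        using dl s by (intro iffD2[OF frac_le_eq] divide_nonpos_pos)
          (auto intro!: divide_nonpos_pos mult_pos_pos add_pos_nonneg simp: mult.commute)
      show "(\<integral>\<^sup>+x. ennreal (gauss ?s (x - ?z)) * indicator E x \<partial>lborel) \<le> ennreal \<beta>"
        by (rule \<Gamma>[OF E s(1) sz])
    qed (use b dl in auto)
    then show ?thesis using tot by (auto intro: order_trans ennreal_leI)
  qed
  moreover have "(\<integral>\<^sup>+x. ennreal (gauss 1 x) * indicator E x \<partial>lborel) \<le> ennreal \<eta>" if E: "thin_above \<epsilon> E" for E :: "'a set"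
  proof -
    have "sqrt \<delta> \<le> 1" using dl(1,2) by simp
    then have "sqrt \<delta> \<le> 2" by linarith
    then have "1 / (sqrt 1 * (1 + norm (0::'a))) \<le> 2 / sqrt \<delta>" using dl(1) by (simp add: pos_le_divide_eq)
    from \<Gamma>[OF E _ this] have "(\<integral>\<^sup>+x. ennreal (gauss 1 x) * indicator E x \<partial>lborel) \<le> ennreal \<beta>" by simp
    then show ?thesis using beta_eta by (auto intro: order_trans ennreal_leI)
  qed
  ultimately show ?thesis using eps by (intro exI[of _ \<epsilon>]) blast
qed

section \<open>Gaussian regularisation of the pairing of a function with its Fourier transform\<close>

text \<open>
  Borel functions that are square-integrable for the Lebesgue measure on the Borel sets.  Working
  with Borel representatives makes product measurability and Fubini unproblematic.
\<close>

definition sq_integrable :: "('a::euclidean_space \<Rightarrow> complex) \<Rightarrow> bool" where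
  "sq_integrable f \<longleftrightarrow> f \<in> borel_measurable borel \<and> integrable lborel (\<lambda>x. (cmod (f x))\<^sup>2)"

lemma integrable_mult_of_squares:
  fixes p f :: "'b \<Rightarrow> complex"
  assumes [measurable]: "p \<in> borel_measurable M" "f \<in> borel_measurable M"
    and sq: "integrable M (\<lambda>x. (cmod (p x))\<^sup>2)" "integrable M (\<lambda>x. (cmod (f x))\<^sup>2)"
  shows "integrable M (\<lambda>x. p x * f x)"
proof (rule Bochner_Integration.integrable_bound)
  show "integrable M (\<lambda>x. (cmod (p x))\<^sup>2 + (cmod (f x))\<^sup>2)"
    using sq by (rule Bochner_Integration.integrable_add)
  show "AE x in M. norm (p x * f x) \<le> norm ((cmod (p x))\<^sup>2 + (cmod (f x))\<^sup>2)"
  proof (intro AE_I2)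
    fix x
    have "0 \<le> (cmod (p x) - cmod (f x))\<^sup>2" by simp
    then have "2 * (cmod (p x) * cmod (f x)) \<le> (cmod (p x))\<^sup>2 + (cmod (f x))\<^sup>2"
      by (simp add: power2_eq_square algebra_simps)
    moreover have "0 \<le> cmod (p x) * cmod (f x)" by simp
    ultimately have "cmod (p x) * cmod (f x) \<le> (cmod (p x))\<^sup>2 + (cmod (f x))\<^sup>2" by linarith
    then show "norm (p x * f x) \<le> norm ((cmod (p x))\<^sup>2 + (cmod (f x))\<^sup>2)"
      by (simp add: norm_mult)
  qed
qed measurable

lemma integrable_square_of_add:
  fixes f g :: "'b \<Rightarrow> complex"
  assumes [measurable]: "f \<in> borel_measurable M" "g \<in> borel_measurable M"
    and sq: "integrable M (\<lambda>x. (cmod (f x))\<^sup>2)" "integrable M (\<lambda>x. (cmod (g x))\<^sup>2)"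
  shows "integrable M (\<lambda>x. (cmod (f x + g x))\<^sup>2)"
proof (rule Bochner_Integration.integrable_bound)
  show "integrable M (\<lambda>x. 2 * (cmod (f x))\<^sup>2 + 2 * (cmod (g x))\<^sup>2)"
    using sq by (intro Bochner_Integration.integrable_add integrable_mult_right)
  show "AE x in M. norm ((cmod (f x + g x))\<^sup>2) \<le> norm (2 * (cmod (f x))\<^sup>2 + 2 * (cmod (g x))\<^sup>2)"
  proof (intro AE_I2)
    fix x
    have "(cmod (f x + g x))\<^sup>2 \<le> (cmod (f x) + cmod (g x))\<^sup>2" by (intro power_mono norm_triangle_ineq) simp
    also have "\<dots> \<le> 2 * (cmod (f x))\<^sup>2 + 2 * (cmod (g x))\<^sup>2"
      using zero_le_power2[of "cmod (f x) - cmod (g x)"] by (simp add: power2_eq_square algebra_simps)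
    finally show "norm ((cmod (f x + g x))\<^sup>2) \<le> norm (2 * (cmod (f x))\<^sup>2 + 2 * (cmod (g x))\<^sup>2)" by simp
  qed
qed measurable

lemma integrable_mult_sq_integrable: "sq_integrable p \<Longrightarrow> sq_integrable f \<Longrightarrow> integrable lborel (\<lambda>x. p x * f x)"
  unfolding sq_integrable_def by (intro integrable_mult_of_squares) auto

lemma sq_integrable_bound:
  assumes "sq_integrable f" "g \<in> borel_measurable borel" "\<And>x. cmod (g x) \<le> cmod (f x)"
  shows "sq_integrable g"
  unfolding sq_integrable_def
proof
  have [measurable]: "g \<in> borel_measurable borel" by fact
  show "integrable lborel (\<lambda>x. (cmod (g x))\<^sup>2)"
    by (rule Bochner_Integration.integrable_bound[of _ "\<lambda>x. (cmod (f x))\<^sup>2"])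
      (use assms in \<open>auto simp: sq_integrable_def power_mono\<close>)
qed fact

lemma integrable_gauss [simp]:
  assumes "r > 0"
  shows "integrable lborel (\<lambda>x. gauss r (x - y :: 'a::euclidean_space))" "integrable lborel (\<lambda>x. gauss r (y - x))"
    "integrable lborel (gauss r :: 'a \<Rightarrow> real)"
  using assms nn_integral_gauss_shift[of r y] nn_integral_gauss[of r, where 'a='a]
  by (auto intro!: integrableI_nonneg)

lemma integrable_exp_norm:
  assumes "c > 0"
  shows "integrable lborel (\<lambda>x::'a::euclidean_space. exp (- c * (norm x)\<^sup>2))"
proof -
  have "integrable lborel (\<lambda>x::'a. (pi / c) powr (real DIM('a) / 2) * gauss (pi / c) x)"
    using assms by (intro integrable_mult_right integrable_gauss) auto
  moreover have "(pi / c) powr (real DIM('a) / 2) * gauss (pi / c) x = exp (- c * (norm x)\<^sup>2)" for x :: 'a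
  proof -
    have "(pi / c) powr (real DIM('a) / 2) * (pi / c) powr (- (real DIM('a) / 2)) = 1"
      using assms by (simp only: powr_add[symmetric]) simp
    moreover have "- pi * (norm x)\<^sup>2 / (pi / c) = - c * (norm x)\<^sup>2" using assms by simp
    ultimately show ?thesis unfolding gauss_def by (simp only: mult.assoc[symmetric] mult_1)
  qed
  ultimately show ?thesis by simp
qed

lemma sq_integrable_exp_norm:
  assumes "c > 0" "p \<in> borel_measurable borel" "\<And>x. cmod (p x) \<le> C * exp (- c * (norm x)\<^sup>2)"
  shows "sq_integrable (p :: 'a::euclidean_space \<Rightarrow> complex)"
  unfolding sq_integrable_def
proof
  have [measurable]: "p \<in> borel_measurable borel" by fact
  show "integrable lborel (\<lambda>x. (cmod (p x))\<^sup>2)"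
  proof (rule Bochner_Integration.integrable_bound)
    show "integrable lborel (\<lambda>x::'a. C\<^sup>2 * exp (- (2 * c) * (norm x)\<^sup>2))"
      using assms by (intro integrable_mult_right integrable_exp_norm) auto
    show "AE x in lborel. norm ((cmod (p x))\<^sup>2) \<le> norm (C\<^sup>2 * exp (- (2 * c) * (norm x)\<^sup>2))"
    proof (intro AE_I2)
      fix x
      have "(cmod (p x))\<^sup>2 \<le> (C * exp (- c * (norm x)\<^sup>2))\<^sup>2" by (intro power_mono assms(3)) simp
      also have "\<dots> = C\<^sup>2 * exp (- (2 * c) * (norm x)\<^sup>2)"
        by (simp add: power_mult_distrib exp_of_nat_mult[symmetric] mult.assoc)
      finally show "norm ((cmod (p x))\<^sup>2) \<le> norm (C\<^sup>2 * exp (- (2 * c) * (norm x)\<^sup>2))" by simp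
    qed
  qed measurable
qed fact

lemma sq_integrable_gauss:
  assumes "r > 0"
  shows "sq_integrable (\<lambda>y. of_real (gauss r (x - y)))"
  unfolding sq_integrable_def
proof
  show "integrable lborel (\<lambda>y. (cmod (of_real (gauss r (x - y))))\<^sup>2)"
  proof (rule Bochner_Integration.integrable_bound)
    show "integrable lborel (\<lambda>y. r powr (- (real DIM('a) / 2)) * gauss r (x - y))"
      using assms by (intro integrable_mult_right integrable_gauss)
    show "AE y in lborel. norm ((cmod (of_real (gauss r (x - y))))\<^sup>2) \<le> norm (r powr (- (real DIM('a) / 2)) * gauss r (x - y))"
    proof (intro AE_I2)
      fix y
      have "gauss r (x - y) \<le> r powr (- (real DIM('a) / 2))"
        by (rule gauss_le[OF assms])
      then have "gauss r (x - y) * gauss r (x - y) \<le> r powr (- (real DIM('a) / 2)) * gauss r (x - y)"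
        by (rule mult_right_mono) simp
      then show "norm ((cmod (of_real (gauss r (x - y))))\<^sup>2) \<le> norm (r powr (- (real DIM('a) / 2)) * gauss r (x - y))"
        by (simp add: power2_eq_square abs_mult)
    qed
  qed measurable
qed measurable

lemma integrable_pair_mult:
  fixes u v :: "_ \<Rightarrow> real"
  assumes "sigma_finite_measure M" "sigma_finite_measure N" and u: "integrable M u" and v: "integrable N v"
  shows "integrable (M \<Otimes>\<^sub>M N) (\<lambda>(x, y). u x * v y)"
proof -
  interpret M: sigma_finite_measure M by fact
  interpret N: sigma_finite_measure N by fact
  interpret P: pair_sigma_finite M N ..
  have [measurable]: "u \<in> borel_measurable M" "v \<in> borel_measurable N" using u v by auto
  show ?thesis
  proof (rule P.Fubini_integrable)
    show "integrable M (\<lambda>x. LINT y|N. norm (case (x, y) of (x, y) \<Rightarrow> u x * v y))"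
      using u by (simp add: abs_mult)
    show "AE x in M. integrable N (\<lambda>y. case (x, y) of (x, y) \<Rightarrow> u x * v y)"
      using v by simp
  qed measurable
qed

text \<open>
  The character \<open>e\<^bsup>2\<pi>ix\<xi>\<^esup>\<close>.
\<close>

abbreviation wave :: "'a::euclidean_space \<Rightarrow> 'a \<Rightarrow> complex" where
  "wave x \<xi> \<equiv> cis (2 * pi * (x \<bullet> \<xi>))"

text \<open>
  The Parseval identities, against Gaussians centred at \<open>x\<close>, that hold when \<open>g\<close> is the Fourier
  transform of \<open>f\<close>.  The statement for the complex conjugates, with \<open>f\<close> and \<open>g\<close> exchanged,
  expresses the same fact with the Gaussians on the other side.
\<close>

definition fourier_link :: "('a::euclidean_space \<Rightarrow> complex) \<Rightarrow> ('a \<Rightarrow> complex) \<Rightarrow> bool" where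
  "fourier_link f g \<longleftrightarrow> (\<forall>r>0. \<forall>x.
     (LINT \<xi>|lborel. of_real (bell r \<xi>) * g \<xi> * wave x \<xi>)
       = (LINT y|lborel. of_real (gauss r (x - y)) * f y))"

text \<open>
  The Gaussian regularisation of the Rihaczek distribution \<open>f(x) cnj(g(\<xi>)) e\<^bsup>-2\<pi>ix\<xi>\<^esup>\<close> on phase space.
  Unlike the distribution itself it is integrable.
\<close>

definition rihaczek :: "('a::euclidean_space \<Rightarrow> complex) \<Rightarrow> ('a \<Rightarrow> complex) \<Rightarrow> real \<Rightarrow> 'a \<times> 'a \<Rightarrow> complex" where
  "rihaczek f g r z = of_real (exp (- pi * r * ((norm (fst z))\<^sup>2 + (norm (snd z))\<^sup>2))) * (f (fst z) * cnj (g (snd z) * wave (fst z) (snd z)))"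

lemma borel_measurable_cis [measurable (raw)]:
  "f \<in> borel_measurable M \<Longrightarrow> (\<lambda>x. cis (f x)) \<in> borel_measurable M"
  by (rule measurable_compose[of f M borel]) (auto intro!: borel_measurable_continuous_onI continuous_intros)

lemma borel_measurable_cnj' [measurable (raw)]:
  "f \<in> borel_measurable M \<Longrightarrow> (\<lambda>x. cnj (f x)) \<in> borel_measurable M"
  by (rule measurable_compose[of f M borel]) (auto intro!: borel_measurable_continuous_onI continuous_intros)

lemma borel_measurable_rihaczek [measurable (raw)]:
  assumes [measurable]: "f \<in> borel_measurable borel" "g \<in> borel_measurable borel"
     "r \<in> borel_measurable M"
    and z: "(\<lambda>x. fst (z x)) \<in> borel_measurable M" "(\<lambda>x. snd (z x)) \<in> borel_measurable M"
  shows "(\<lambda>x. rihaczek f g (r x) (z x)) \<in> borel_measurable M"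
proof -
  define u where "u x = fst (z x)" for x
  define v where "v x = snd (z x)" for x
  have [measurable]: "u \<in> borel_measurable M" "v \<in> borel_measurable M"
    using z by (simp_all add: u_def[abs_def] v_def[abs_def])
  show ?thesis unfolding rihaczek_def u_def[symmetric] v_def[symmetric] by measurable
qed

lemma exp_norm_sq_add:
  "exp (- pi * r * ((norm x)\<^sup>2 + (norm \<xi>)\<^sup>2)) = bell r x * bell r \<xi>"
  by (simp only: distrib_left exp_add)

lemma cmod_rihaczek: "cmod (rihaczek f g r (x, \<xi>)) = (bell r x * cmod (f x)) * (bell r \<xi> * cmod (g \<xi>))"
proof -
  have "cmod (rihaczek f g r (x, \<xi>)) = exp (- pi * r * ((norm x)\<^sup>2 + (norm \<xi>)\<^sup>2)) * (cmod (f x) * cmod (g \<xi>))"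
    unfolding rihaczek_def by (simp add: norm_mult)
  then show ?thesis unfolding exp_norm_sq_add by simp
qed

lemma sq_norm_mult_exp_le:
  assumes "c > 0"
  shows "(norm x)\<^sup>2 * exp (- c * (norm x)\<^sup>2) \<le> (2 / c) * exp (- (c / 2) * (norm x)\<^sup>2)"
proof -
  have "c / 2 * (norm x)\<^sup>2 \<le> exp (c / 2 * (norm x)\<^sup>2)"
    using exp_ge_add_one_self[of "c / 2 * (norm x)\<^sup>2"] by linarith
  then have "(norm x)\<^sup>2 \<le> (2 / c) * exp (c / 2 * (norm x)\<^sup>2)"
    using assms by (simp add: field_simps)
  then have "(norm x)\<^sup>2 * exp (- c * (norm x)\<^sup>2) \<le> (2 / c) * exp (c / 2 * (norm x)\<^sup>2) * exp (- c * (norm x)\<^sup>2)"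
    by (rule mult_right_mono) simp
  also have "\<dots> = (2 / c) * exp (- (c / 2) * (norm x)\<^sup>2)"
    by (simp only: mult.assoc exp_add[symmetric]) (simp add: algebra_simps)
  finally show ?thesis .
qed

lemma gaussian_weights_integrable:
  assumes f: "sq_integrable f" and r: "r > 0"
  shows "integrable lborel (\<lambda>x. bell r x * cmod (f x))"
    and "integrable lborel (\<lambda>x. pi * (norm x)\<^sup>2 * (bell r x * cmod (f x)))"
proof -
  have [measurable]: "f \<in> borel_measurable borel" using f by (simp add: sq_integrable_def)
  have f': "sq_integrable (\<lambda>x. of_real (cmod (f x)))" using f by (simp add: sq_integrable_def)
  have c: "pi * r > 0" "pi * r / 2 > 0" using r by auto
  have 1: "sq_integrable (\<lambda>x::'a. of_real (bell r x))"
    by (rule sq_integrable_exp_norm[OF c(1), of _ 1]) auto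
  have 2: "sq_integrable (\<lambda>x::'a. of_real (pi * (norm x)\<^sup>2 * bell r x))"
  proof (rule sq_integrable_exp_norm[OF c(2), of _ "pi * (2 / (pi * r))"])
    fix x :: 'a
    show "cmod (of_real (pi * (norm x)\<^sup>2 * bell r x))
        \<le> pi * (2 / (pi * r)) * exp (- (pi * r / 2) * (norm x)\<^sup>2)"
      using mult_left_mono[OF sq_norm_mult_exp_le[OF c(1), of x], of pi] by (simp add: norm_mult norm_power mult.assoc)
  qed measurable
  show "integrable lborel (\<lambda>x. bell r x * cmod (f x))"
    using integrable_norm[OF integrable_mult_sq_integrable[OF 1 f']] by (simp add: norm_mult)
  show "integrable lborel (\<lambda>x. pi * (norm x)\<^sup>2 * (bell r x * cmod (f x)))"
    using integrable_norm[OF integrable_mult_sq_integrable[OF 2 f']] by (simp add: norm_mult norm_power mult.assoc)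
qed

lemma integrable_rihaczek:
  assumes f: "sq_integrable f" and g: "sq_integrable g" and r: "r > 0"
  shows "integrable (lborel \<Otimes>\<^sub>M lborel) (rihaczek f g r)"
    and "integrable (lborel \<Otimes>\<^sub>M lborel) (\<lambda>z. of_real (pi * (norm (fst z))\<^sup>2) * rihaczek f g r z)"
    and "integrable (lborel \<Otimes>\<^sub>M lborel) (\<lambda>z. of_real (pi * (norm (snd z))\<^sup>2) * rihaczek f g r z)"
proof -
  have [measurable]: "f \<in> borel_measurable borel" "g \<in> borel_measurable borel"
    using f g by (auto simp: sq_integrable_def)
  note i = integrable_pair_mult[OF sigma_finite_lborel sigma_finite_lborel]
  note w = gaussian_weights_integrable
  show "integrable (lborel \<Otimes>\<^sub>M lborel) (rihaczek f g r)"
    by (rule Bochner_Integration.integrable_bound[OF i[OF w(1)[OF f r] w(1)[OF g r]]])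
      (auto simp: cmod_rihaczek abs_mult)
  show "integrable (lborel \<Otimes>\<^sub>M lborel) (\<lambda>z. of_real (pi * (norm (fst z))\<^sup>2) * rihaczek f g r z)"
    by (rule Bochner_Integration.integrable_bound[OF i[OF w(2)[OF f r] w(1)[OF g r]]])
      (auto simp: cmod_rihaczek abs_mult norm_mult norm_power mult.assoc mult.left_commute)
  show "integrable (lborel \<Otimes>\<^sub>M lborel) (\<lambda>z. of_real (pi * (norm (snd z))\<^sup>2) * rihaczek f g r z)"
    by (rule Bochner_Integration.integrable_bound[OF i[OF w(1)[OF f r] w(2)[OF g r]]])
      (auto simp: cmod_rihaczek abs_mult norm_mult norm_power mult.assoc mult.left_commute)
qed

text \<open>
  The form with kernel \<open>slice_kernel r\<close>, evaluated at \<open>|f|\<close>.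
\<close>

definition slice_form :: "('a::euclidean_space \<Rightarrow> complex) \<Rightarrow> real \<Rightarrow> ennreal" where
  "slice_form f r = (\<integral>\<^sup>+x. (\<integral>\<^sup>+y. ennreal (slice_kernel r x y) * ennreal (cmod (f x) * cmod (f y)) \<partial>lborel) \<partial>lborel)"

lemma nn_norm_gauss_conv:
  assumes f: "sq_integrable f" and r: "r > 0"
  shows "ennreal (pi * (norm x)\<^sup>2 * bell r x * cmod (f x) * cmod (LINT y|lborel. of_real (gauss r (x - y)) * f y))
     \<le> (\<integral>\<^sup>+y. ennreal (slice_kernel r x y) * ennreal (cmod (f x) * cmod (f y)) \<partial>lborel)"
proof -
  have [measurable]: "f \<in> borel_measurable borel" using f by (auto simp: sq_integrable_def)
  let ?a = "pi * (norm x)\<^sup>2 * bell r x * cmod (f x)"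
  have "ennreal (?a * cmod (LINT y|lborel. of_real (gauss r (x - y)) * f y))
     = ennreal ?a * ennreal (cmod (LINT y|lborel. of_real (gauss r (x - y)) * f y))"
    by (rule ennreal_mult) auto
  also have "\<dots> \<le> ennreal ?a * (\<integral>\<^sup>+y. ennreal (cmod (of_real (gauss r (x - y)) * f y)) \<partial>lborel)"
    by (intro mult_left_mono integral_norm_bound_ennreal integrable_mult_sq_integrable sq_integrable_gauss r f) auto
  also have "\<dots> = (\<integral>\<^sup>+y. ennreal ?a * ennreal (cmod (of_real (gauss r (x - y)) * f y)) \<partial>lborel)"
    by (rule nn_integral_cmult[symmetric]) measurable
  also have "\<dots> = (\<integral>\<^sup>+y. ennreal (slice_kernel r x y) * ennreal (cmod (f x) * cmod (f y)) \<partial>lborel)"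
  proof (intro nn_integral_cong)
    fix y
    have "?a * cmod (of_real (gauss r (x - y)) * f y) = slice_kernel r x y * (cmod (f x) * cmod (f y))"
      by (simp add: slice_kernel_def norm_mult)
    then show "ennreal ?a * ennreal (cmod (of_real (gauss r (x - y)) * f y)) = ennreal (slice_kernel r x y) * ennreal (cmod (f x) * cmod (f y))"
      by (subst (1 2) ennreal_mult[symmetric]) auto
  qed
  finally show ?thesis .
qed

text \<open>
  The part of \<open>-N'(r)\<close> with weight \<open>\<pi>|x|\<^sup>2\<close>: the integral over \<open>\<xi>\<close> turns into a Gaussian average of
  \<open>f\<close>.
\<close>

lemma rihaczek_fst_bound:
  assumes f: "sq_integrable f" and g: "sq_integrable g" and r: "r > 0" and l: "fourier_link f g"
  shows "ennreal (cmod (LINT z|(lborel \<Otimes>\<^sub>M lborel). of_real (pi * (norm (fst z))\<^sup>2) * rihaczek f g r z)) \<le> slice_form f r"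
proof -
  have [measurable]: "f \<in> borel_measurable borel" "g \<in> borel_measurable borel"
    using f g by (auto simp: sq_integrable_def)
  let ?A = "\<lambda>x. LINT y|lborel. of_real (gauss r (x - y)) * f y"
  have eq: "(LINT \<xi>|lborel. of_real (pi * (norm x)\<^sup>2) * rihaczek f g r (x, \<xi>))
      = of_real (pi * (norm x)\<^sup>2 * bell r x) * f x * cnj (?A x)" for x
  proof -
    have "of_real (pi * (norm x)\<^sup>2) * rihaczek f g r (x, \<xi>) = (of_real (pi * (norm x)\<^sup>2 * bell r x) * f x)
       * cnj (of_real (bell r \<xi>) * g \<xi> * wave x \<xi>)" for \<xi>
      unfolding rihaczek_def fst_conv snd_conv exp_norm_sq_add
      by (simp only: of_real_mult complex_cnj_mult complex_cnj_complex_of_real mult.assoc mult.left_commute)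
    then have "(LINT \<xi>|lborel. of_real (pi * (norm x)\<^sup>2) * rihaczek f g r (x, \<xi>))
       = (of_real (pi * (norm x)\<^sup>2 * bell r x) * f x)
         * cnj (LINT \<xi>|lborel. of_real (bell r \<xi>) * g \<xi> * wave x \<xi>)"
      by (simp only: integral_mult_right_zero Bochner_Integration.integral_cnj)
    then show ?thesis using l r by (simp add: fourier_link_def)
  qed
  have int: "integrable (lborel \<Otimes>\<^sub>M lborel) (\<lambda>z. of_real (pi * (norm (fst z))\<^sup>2) * rihaczek f g r z)"
    by (rule integrable_rihaczek[OF f g r])
  have "(LINT z|(lborel \<Otimes>\<^sub>M lborel). of_real (pi * (norm (fst z))\<^sup>2) * rihaczek f g r z)
     = (LINT x|lborel. LINT \<xi>|lborel. of_real (pi * (norm x)\<^sup>2) * rihaczek f g r (x, \<xi>))"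
    using lborel_pair.integral_fst'[OF int] by simp
  also have "\<dots> = (LINT x|lborel. of_real (pi * (norm x)\<^sup>2 * bell r x) * f x * cnj (?A x))"
    by (simp only: eq)
  finally have e: "(LINT z|(lborel \<Otimes>\<^sub>M lborel). of_real (pi * (norm (fst z))\<^sup>2) * rihaczek f g r z)
    = (LINT x|lborel. of_real (pi * (norm x)\<^sup>2 * bell r x) * f x * cnj (?A x))" .
  have i: "integrable lborel (\<lambda>x. of_real (pi * (norm x)\<^sup>2 * bell r x) * f x * cnj (?A x))"
    using lborel_pair.integrable_fst'[OF int] by (simp only: fst_conv eq)
  have "ennreal (cmod (LINT z|(lborel \<Otimes>\<^sub>M lborel). of_real (pi * (norm (fst z))\<^sup>2) * rihaczek f g r z))
     \<le> (\<integral>\<^sup>+x. ennreal (cmod (of_real (pi * (norm x)\<^sup>2 * bell r x) * f x * cnj (?A x))) \<partial>lborel)"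
    unfolding e by (rule integral_norm_bound_ennreal[OF i])
  also have "\<dots> \<le> slice_form f r"
    unfolding slice_form_def
  proof (rule nn_integral_mono)
    fix x
    have "cmod (of_real (pi * (norm x)\<^sup>2 * bell r x) * f x * cnj (?A x))
      = pi * (norm x)\<^sup>2 * bell r x * cmod (f x) * cmod (?A x)"
      by (simp add: norm_mult norm_power)
    then show "ennreal (cmod (of_real (pi * (norm x)\<^sup>2 * bell r x) * f x * cnj (?A x)))
      \<le> (\<integral>\<^sup>+y. ennreal (slice_kernel r x y) * ennreal (cmod (f x) * cmod (f y)) \<partial>lborel)"
      using nn_norm_gauss_conv[OF f r, of x] by simp
  qed
  finally show ?thesis .
qed

lemma rihaczek_swap: "rihaczek f g r (x, \<xi>) = rihaczek (\<lambda>x. cnj (g x)) (\<lambda>x. cnj (f x)) r (\<xi>, x)"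
  by (simp add: rihaczek_def inner_commute add.commute mult.commute mult.left_commute)

section \<open>An uncertainty principle for thin sets\<close>

lemma sq_integrable_cnj: "sq_integrable f \<Longrightarrow> sq_integrable (\<lambda>x. cnj (f x))"
  unfolding sq_integrable_def by auto

lemma rihaczek_snd_bound:
  assumes f: "sq_integrable f" and g: "sq_integrable g" and r: "r > 0"
    and l: "fourier_link (\<lambda>x. cnj (g x)) (\<lambda>x. cnj (f x))"
  shows "ennreal (cmod (LINT z|(lborel \<Otimes>\<^sub>M lborel). of_real (pi * (norm (snd z))\<^sup>2) * rihaczek f g r z)) \<le> slice_form g r"
proof -
  have [measurable]: "f \<in> borel_measurable borel" "g \<in> borel_measurable borel"
    using f g by (auto simp: sq_integrable_def)
  let ?F = "\<lambda>z. of_real (pi * (norm (snd z))\<^sup>2) * rihaczek f g r z"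
  have "(LINT z|(lborel \<Otimes>\<^sub>M lborel). ?F z) = (LINT z|(lborel \<Otimes>\<^sub>M lborel). (case z of (x, y) \<Rightarrow> ?F (y, x)))"
    by (rule lborel_pair.integral_product_swap[symmetric]) measurable
  also have "\<dots> = (LINT z|(lborel \<Otimes>\<^sub>M lborel). of_real (pi * (norm (fst z))\<^sup>2) * rihaczek (\<lambda>x. cnj (g x)) (\<lambda>x. cnj (f x)) r z)"
    by (intro Bochner_Integration.integral_cong refl) (auto simp: rihaczek_swap[of f])
  finally have e: "(LINT z|(lborel \<Otimes>\<^sub>M lborel). ?F z) = (LINT z|(lborel \<Otimes>\<^sub>M lborel). of_real (pi * (norm (fst z))\<^sup>2) * rihaczek (\<lambda>x. cnj (g x)) (\<lambda>x. cnj (f x)) r z)" .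
  have "slice_form (\<lambda>x. cnj (g x)) r = slice_form g r" by (simp add: slice_form_def)
  then show ?thesis
    unfolding e using rihaczek_fst_bound[OF sq_integrable_cnj[OF g] sq_integrable_cnj[OF f] r l] by simp
qed

text \<open>
  The form with kernel \<open>cutoff_kernel\<close>, evaluated at \<open>|f|\<close>.
\<close>

definition cutoff_form :: "('a::euclidean_space \<Rightarrow> complex) \<Rightarrow> ennreal" where
  "cutoff_form f = (\<integral>\<^sup>+x. (\<integral>\<^sup>+y. cutoff_kernel x y * ennreal (cmod (f x) * cmod (f y)) \<partial>lborel) \<partial>lborel)"

lemma borel_measurable_slice_form [measurable]:
  assumes [measurable]: "f \<in> borel_measurable borel"
  shows "slice_form (f :: 'a::euclidean_space \<Rightarrow> complex) \<in> borel_measurable borel"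
  unfolding slice_form_def[abs_def] by measurable

lemma nn_integral_slice_form:
  assumes [measurable]: "f \<in> borel_measurable borel"
  shows "(\<integral>\<^sup>+r. slice_form (f :: 'a::euclidean_space \<Rightarrow> complex) r * indicator {0<..<1} r \<partial>lborel) = cutoff_form f"
proof -
  have "(\<integral>\<^sup>+r. slice_form f r * indicator {0<..<1} r \<partial>lborel)
     = (\<integral>\<^sup>+r. (\<integral>\<^sup>+x. (\<integral>\<^sup>+y. ennreal (slice_kernel r x y) * ennreal (cmod (f x) * cmod (f y)) * indicator {0<..<1} r \<partial>lborel) \<partial>lborel) \<partial>lborel)"
    unfolding slice_form_def
    by (intro nn_integral_cong) (simp add: nn_integral_multc)
  also have "\<dots> = (\<integral>\<^sup>+x. (\<integral>\<^sup>+r. (\<integral>\<^sup>+y. ennreal (slice_kernel r x y) * ennreal (cmod (f x) * cmod (f y)) * indicator {0<..<1} r \<partial>lborel) \<partial>lborel) \<partial>lborel)"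
    by (rule lborel_pair.Fubini') measurable
  also have "\<dots> = (\<integral>\<^sup>+x. (\<integral>\<^sup>+y. (\<integral>\<^sup>+r. ennreal (slice_kernel r x y) * ennreal (cmod (f x) * cmod (f y)) * indicator {0<..<1} r \<partial>lborel) \<partial>lborel) \<partial>lborel)"
    by (intro nn_integral_cong lborel_pair.Fubini') measurable
  also have "\<dots> = cutoff_form f"
    unfolding cutoff_form_def cutoff_kernel_def
  proof (intro nn_integral_cong)
    fix x y :: 'a
    show "(\<integral>\<^sup>+r. ennreal (slice_kernel r x y) * ennreal (cmod (f x) * cmod (f y)) * indicator {0<..<1} r \<partial>lborel)
      = (\<integral>\<^sup>+r. ennreal (slice_kernel r x y) * indicator {0<..<1} r \<partial>lborel) * ennreal (cmod (f x) * cmod (f y))"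
      by (subst nn_integral_multc[symmetric]) (auto intro!: nn_integral_cong simp: indicator_def)
  qed
  finally show ?thesis .
qed

text \<open>
  The fundamental theorem of calculus for \<open>N(r)\<close>, integrated over phase space.
\<close>

lemma rihaczek_increment:
  fixes f g :: "'a::euclidean_space \<Rightarrow> complex"
  assumes f: "sq_integrable f" and g: "sq_integrable g" and l: "fourier_link f g"
    and l': "fourier_link (\<lambda>x. cnj (g x)) (\<lambda>x. cnj (f x))" and r: "0 < r" "r < 1"
  shows "ennreal (cmod ((LINT z|(lborel \<Otimes>\<^sub>M lborel). rihaczek f g r z) - (LINT z|(lborel \<Otimes>\<^sub>M lborel). rihaczek f g 1 z)))
     \<le> cutoff_form f + cutoff_form g"
proof -
  have [measurable]: "f \<in> borel_measurable borel" "g \<in> borel_measurable borel"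
    using f g by (auto simp: sq_integrable_def)
  let ?P = "lborel \<Otimes>\<^sub>M lborel :: ('a \<times> 'a) measure"
  let ?D = "\<lambda>t z. of_real (pi * (norm (fst z))\<^sup>2) * rihaczek f g t z + of_real (pi * (norm (snd z))\<^sup>2) * rihaczek f g t z"
  interpret PP: pair_sigma_finite ?P "lborel :: real measure"
    unfolding lborel_prod by (intro pair_sigma_finite.intro sigma_finite_lborel)
  have sP: "sigma_finite_measure ?P" unfolding lborel_prod by (rule sigma_finite_lborel)
  have deriv: "((\<lambda>t. - rihaczek f g t z) has_vector_derivative ?D t z) (at t within S)" for t z S
  proof -
    have "((\<lambda>t. - of_real (exp (- pi * t * ((norm (fst z))\<^sup>2 + (norm (snd z))\<^sup>2))) :: complex) has_vector_derivative
       of_real (pi * ((norm (fst z))\<^sup>2 + (norm (snd z))\<^sup>2) * exp (- pi * t * ((norm (fst z))\<^sup>2 + (norm (snd z))\<^sup>2)))) (at t within S)"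
      by (auto intro!: derivative_eq_intros has_vector_derivative_of_real simp: has_real_derivative_iff_has_vector_derivative[symmetric])
    from has_vector_derivative_mult_left[OF this, of "f (fst z) * cnj (g (snd z) * wave (fst z) (snd z))"]
    show ?thesis unfolding rihaczek_def by (simp add: algebra_simps)
  qed
  have cont: "continuous_on S (\<lambda>t. ?D t z)" for S z
    unfolding rihaczek_def by (intro continuous_intros)
  \<comment> \<open>For fixed \<open>z\<close> the function \<open>- rihaczek f g t z\<close> is a primitive of \<open>?D\<close> in \<open>t\<close>.\<close>
  have ftc: "(LINT t|lborel. indicator {r..1} t *\<^sub>R ?D t z) = rihaczek f g r z - rihaczek f g 1 z" for z
    using integral_FTC_Icc[of r 1 "\<lambda>t. - rihaczek f g t z" "\<lambda>t. ?D t z", OF _ deriv cont] r by simp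
  have int: "integrable (?P \<Otimes>\<^sub>M lborel) (\<lambda>(z, t). indicator {r..1} t *\<^sub>R ?D t z)"
  proof (rule Bochner_Integration.integrable_bound)
    have "integrable ?P (\<lambda>z. cmod (?D r z))"
      using integrable_rihaczek(2,3)[OF f g r(1)] by (intro integrable_norm Bochner_Integration.integrable_add)
    then show "integrable (?P \<Otimes>\<^sub>M lborel) (\<lambda>(z, t). cmod (?D r z) * indicator {r..1} t)"
      by (intro integrable_pair_mult sP sigma_finite_lborel integrable_real_indicator) (auto simp: emeasure_lborel_Icc_eq)
    show "AE x in ?P \<Otimes>\<^sub>M lborel. norm (case x of (z, t) \<Rightarrow> indicator {r..1} t *\<^sub>R ?D t z)
        \<le> norm (case x of (z, t) \<Rightarrow> cmod (?D r z) * indicator {r..1} t)"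
    proof (intro AE_I2, clarify)
      fix a b t
      have "cmod (?D t (a, b)) \<le> cmod (?D r (a, b))" if "r \<le> t"
      proof -
        have e: "cmod (?D s (a, b)) = pi * ((norm a)\<^sup>2 + (norm b)\<^sup>2) * (exp (- pi * s * ((norm a)\<^sup>2 + (norm b)\<^sup>2)) * (cmod (f a) * cmod (g b)))" for s
        proof -
          have "?D s (a, b) = of_real (pi * ((norm a)\<^sup>2 + (norm b)\<^sup>2)) * rihaczek f g s (a, b)"
            by (simp add: algebra_simps)
          then show ?thesis by (simp add: norm_mult rihaczek_def del: of_real_add of_real_mult of_real_power)
        qed
        have "pi * ((norm a)\<^sup>2 + (norm b)\<^sup>2) * r \<le> pi * ((norm a)\<^sup>2 + (norm b)\<^sup>2) * t"
          using that by (intro mult_left_mono) auto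
        then have "exp (- pi * t * ((norm a)\<^sup>2 + (norm b)\<^sup>2)) \<le> exp (- pi * r * ((norm a)\<^sup>2 + (norm b)\<^sup>2))"
          by (simp add: algebra_simps)
        then show ?thesis unfolding e by (intro mult_left_mono mult_right_mono) auto
      qed
      then show "norm (indicator {r..1} t *\<^sub>R ?D t (a, b)) \<le> norm (cmod (?D r (a, b)) * indicator {r..1} t)"
        by (simp add: indicator_def)
    qed
  qed measurable
  have "(LINT z|?P. rihaczek f g r z) - (LINT z|?P. rihaczek f g 1 z) = (LINT z|?P. rihaczek f g r z - rihaczek f g 1 z)"
    using integrable_rihaczek(1)[OF f g] r by (subst Bochner_Integration.integral_diff) auto
  also have "\<dots> = (LINT z|?P. LINT t|lborel. indicator {r..1} t *\<^sub>R ?D t z)" by (simp only: ftc)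
  also have "\<dots> = (LINT t|lborel. LINT z|?P. indicator {r..1} t *\<^sub>R ?D t z)"
    by (rule PP.Fubini_integral[OF int, symmetric])
  finally have eq: "(LINT z|?P. rihaczek f g r z) - (LINT z|?P. rihaczek f g 1 z) = (LINT t|lborel. LINT z|?P. indicator {r..1} t *\<^sub>R ?D t z)" .
  have i: "integrable lborel (\<lambda>t. LINT z|?P. indicator {r..1} t *\<^sub>R ?D t z)"
    using PP.integrable_snd[OF int] by simp
  have "ennreal (cmod (LINT t|lborel. LINT z|?P. indicator {r..1} t *\<^sub>R ?D t z))
     \<le> (\<integral>\<^sup>+t. ennreal (cmod (LINT z|?P. indicator {r..1} t *\<^sub>R ?D t z)) \<partial>lborel)"
    by (rule integral_norm_bound_ennreal[OF i])
  also have "\<dots> \<le> (\<integral>\<^sup>+t. (slice_form f t * indicator {0<..<1} t + slice_form g t * indicator {0<..<1} t) \<partial>lborel)"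
  proof (rule nn_integral_mono_AE)
    have "AE t in lborel. t \<noteq> (1::real)" by (rule AE_lborel_singleton)
    then show "AE t in lborel. ennreal (cmod (LINT z|?P. indicator {r..1} t *\<^sub>R ?D t z))
       \<le> slice_form f t * indicator {0<..<1} t + slice_form g t * indicator {0<..<1} t"
    proof eventually_elim
      fix t :: real assume t: "t \<noteq> 1"
      show "ennreal (cmod (LINT z|?P. indicator {r..1} t *\<^sub>R ?D t z)) \<le> slice_form f t * indicator {0<..<1} t + slice_form g t * indicator {0<..<1} t"
      proof (cases "t \<in> {r..1}")
        case False
        then have "indicator {r..1} t = (0::real)" by simp
        then show ?thesis by simp
      next
        case True
        then have t': "0 < t" "t < 1" using t r by auto
        have "(LINT z|?P. indicator {r..1} t *\<^sub>R ?D t z) = (LINT z|?P. ?D t z)" using True by simp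
        also have "\<dots> = (LINT z|?P. of_real (pi * (norm (fst z))\<^sup>2) * rihaczek f g t z) + (LINT z|?P. of_real (pi * (norm (snd z))\<^sup>2) * rihaczek f g t z)"
          by (rule Bochner_Integration.integral_add) (rule integrable_rihaczek[OF f g t'(1)])+
        finally have e: "(LINT z|?P. indicator {r..1} t *\<^sub>R ?D t z)
          = (LINT z|?P. of_real (pi * (norm (fst z))\<^sup>2) * rihaczek f g t z) + (LINT z|?P. of_real (pi * (norm (snd z))\<^sup>2) * rihaczek f g t z)" .
        have "ennreal (cmod (LINT z|?P. indicator {r..1} t *\<^sub>R ?D t z))
          \<le> ennreal (cmod (LINT z|?P. of_real (pi * (norm (fst z))\<^sup>2) * rihaczek f g t z) + cmod (LINT z|?P. of_real (pi * (norm (snd z))\<^sup>2) * rihaczek f g t z))"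
          unfolding e by (intro ennreal_leI norm_triangle_ineq)
        also have "\<dots> = ennreal (cmod (LINT z|?P. of_real (pi * (norm (fst z))\<^sup>2) * rihaczek f g t z)) + ennreal (cmod (LINT z|?P. of_real (pi * (norm (snd z))\<^sup>2) * rihaczek f g t z))"
          by (rule ennreal_plus) (rule norm_ge_zero)+
        also have "\<dots> \<le> slice_form f t + slice_form g t"
          by (intro add_mono rihaczek_fst_bound rihaczek_snd_bound f g l l' t'(1))
        finally show ?thesis using t' by simp
      qed
    qed
  qed
  also have "\<dots> = cutoff_form f + cutoff_form g"
    by (subst nn_integral_add) (simp_all add: nn_integral_slice_form)
  finally show ?thesis unfolding eq .
qed

text \<open>
  The Schur test applied separately to \<open>x \<in> E\<close>, where the columns are small, and to \<open>x \<notin> E\<close>, where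
  they are only bounded.
\<close>

lemma kernel_form_bound:
  fixes f g :: "'a::euclidean_space \<Rightarrow> complex" and K :: "'a \<Rightarrow> 'a \<Rightarrow> ennreal"
  assumes f: "sq_integrable f" and g: "sq_integrable g"
    and S: "(LINT x|lborel. (cmod (f x))\<^sup>2) = S" "(LINT x|lborel. (cmod (g x))\<^sup>2) = S"
    and [measurable]: "(\<lambda>(x, y). K x y) \<in> borel_measurable (lborel \<Otimes>\<^sub>M lborel)" "E \<in> sets borel"
    and row: "\<And>x. (\<integral>\<^sup>+y. K x y \<partial>lborel) \<le> 1"
    and col: "\<And>y. (\<integral>\<^sup>+x. K x y * indicator (- E) x \<partial>lborel) \<le> ennreal c"
    and colE: "\<And>y. (\<integral>\<^sup>+x. K x y * indicator E x \<partial>lborel) \<le> ennreal (\<theta>\<^sup>2)"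
    and \<theta>: "\<theta> > 0" and c: "c > 0"
  shows "(\<integral>\<^sup>+x. (\<integral>\<^sup>+y. K x y * ennreal (cmod (f x) * cmod (g y)) \<partial>lborel) \<partial>lborel)
    \<le> ennreal (2 * \<theta> * S + c / (4 * \<theta>) * (LINT x|lborel. (cmod (f x))\<^sup>2 * indicator (- E) x))"
proof -
  have [measurable]: "f \<in> borel_measurable borel" "g \<in> borel_measurable borel"
    using f g by (auto simp: sq_integrable_def)
  have S0: "S \<ge> 0" unfolding S(1)[symmetric] by simp
  let ?O = "LINT x|lborel. (cmod (f x))\<^sup>2 * indicator (- E) x"
  have O0: "?O \<ge> 0" by simp
  have nf: "(\<integral>\<^sup>+x. ennreal ((cmod (f x))\<^sup>2) \<partial>lborel) = ennreal S"
    unfolding S(1)[symmetric] using f by (intro nn_integral_eq_integral) (auto simp: sq_integrable_def)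
  have ng: "(\<integral>\<^sup>+x. ennreal ((cmod (g x))\<^sup>2) \<partial>lborel) = ennreal S"
    unfolding S(2)[symmetric] using g by (intro nn_integral_eq_integral) (auto simp: sq_integrable_def)
  have nO: "(\<integral>\<^sup>+x. ennreal ((cmod (f x))\<^sup>2) * indicator (- E) x \<partial>lborel) = ennreal ?O"
  proof -
    have "integrable lborel (\<lambda>x. (cmod (f x))\<^sup>2 * indicator (- E) x)"
      using f by (intro integrable_real_mult_indicator) (auto simp: sq_integrable_def)
    then have "(\<integral>\<^sup>+x. ennreal ((cmod (f x))\<^sup>2 * indicator (- E) x) \<partial>lborel) = ennreal ?O"
      by (rule nn_integral_eq_integral) auto
    then show ?thesis by (simp add: ennreal_mult' ennreal_indicator)
  qed
  have nE: "(\<integral>\<^sup>+x. ennreal ((cmod (f x))\<^sup>2) * indicator E x \<partial>lborel) \<le> ennreal S"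
    unfolding nf[symmetric] by (intro nn_integral_mono) (auto simp: indicator_def)
  let ?I = "\<lambda>x. (\<integral>\<^sup>+y. K x y * ennreal (cmod (f x) * cmod (g y)) \<partial>lborel)"
  have l2: "c / (2 * \<theta>) > 0" using c \<theta> by simp
  have "(\<integral>\<^sup>+x. ?I x \<partial>lborel) = (\<integral>\<^sup>+x. ?I x * indicator E x + ?I x * indicator (- E) x \<partial>lborel)"
    by (intro nn_integral_cong) (auto simp: indicator_def)
  also have "\<dots> = (\<integral>\<^sup>+x. ?I x * indicator E x \<partial>lborel) + (\<integral>\<^sup>+x. ?I x * indicator (- E) x \<partial>lborel)"
    by (rule nn_integral_add) measurable
  also have "\<dots> \<le> (ennreal (\<theta> / 2) * (\<integral>\<^sup>+x. ennreal ((cmod (f x))\<^sup>2) * indicator E x \<partial>lborel)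
        + ennreal (\<theta>\<^sup>2 / (2 * \<theta>)) * (\<integral>\<^sup>+x. ennreal ((cmod (g x))\<^sup>2) \<partial>lborel))
     + (ennreal (c / (2 * \<theta>) / 2) * (\<integral>\<^sup>+x. ennreal ((cmod (f x))\<^sup>2) * indicator (- E) x \<partial>lborel)
        + ennreal (c / (2 * (c / (2 * \<theta>)))) * (\<integral>\<^sup>+x. ennreal ((cmod (g x))\<^sup>2) \<partial>lborel))"
    by (intro add_mono schur_test sigma_finite_lborel row col colE \<theta> l2) (auto simp: space_pair_measure)
  also have "\<dots> \<le> (ennreal (\<theta> / 2) * ennreal S + ennreal (\<theta>\<^sup>2 / (2 * \<theta>)) * ennreal S)
     + (ennreal (c / (2 * \<theta>) / 2) * ennreal ?O + ennreal (c / (2 * (c / (2 * \<theta>)))) * ennreal S)"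
    unfolding ng nO by (intro add_mono mult_left_mono nE order_refl) auto
  also have "\<dots> = ennreal ((\<theta> / 2 * S + \<theta>\<^sup>2 / (2 * \<theta>) * S) + (c / (2 * \<theta>) / 2 * ?O + c / (2 * (c / (2 * \<theta>))) * S))"
  proof -
    have nn: "\<theta> / 2 \<ge> 0" "\<theta>\<^sup>2 / (2 * \<theta>) \<ge> 0" "c / (2 * \<theta>) / 2 \<ge> 0" "c / (2 * (c / (2 * \<theta>))) \<ge> 0" using \<theta> c by auto
    show ?thesis
      by (simp only: ennreal_mult[OF nn(1) S0, symmetric] ennreal_mult[OF nn(2) S0, symmetric]
        ennreal_mult[OF nn(3) O0, symmetric] ennreal_mult[OF nn(4) S0, symmetric]
        ennreal_plus[symmetric] mult_nonneg_nonneg nn S0 O0 add_nonneg_nonneg)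
  qed
  also have "(\<theta> / 2 * S + \<theta>\<^sup>2 / (2 * \<theta>) * S) + (c / (2 * \<theta>) / 2 * ?O + c / (2 * (c / (2 * \<theta>))) * S)
     = 2 * \<theta> * S + c / (4 * \<theta>) * ?O"
    using \<theta> c by (simp add: field_simps power2_eq_square)
  finally show ?thesis .
qed

text \<open>
  The uncertainty principle.  The hypotheses on \<open>f\<close> and \<open>g\<close> hold whenever \<open>g\<close> is the Fourier
  transform of \<open>f\<close>.
\<close>

theorem uncertainty_thin:
  "\<exists>\<epsilon>>0. \<exists>C>0. \<forall>(E::'a::euclidean_space set) f g S. thin_above \<epsilon> E \<longrightarrow> sq_integrable f \<longrightarrow> sq_integrable g \<longrightarrow>
     fourier_link f g \<longrightarrow> fourier_link (\<lambda>x. cnj (g x)) (\<lambda>x. cnj (f x)) \<longrightarrow>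
     (LINT x|lborel. (cmod (f x))\<^sup>2) = S \<longrightarrow> (LINT x|lborel. (cmod (g x))\<^sup>2) = S \<longrightarrow>
     ((\<lambda>r. LINT z|(lborel \<Otimes>\<^sub>M lborel). rihaczek f g r z) \<longlongrightarrow> of_real S) (at_right 0) \<longrightarrow>
     S \<le> C * ((LINT x|lborel. (cmod (f x))\<^sup>2 * indicator (- E) x) + (LINT x|lborel. (cmod (g x))\<^sup>2 * indicator (- E) x))"
proof -
  \<comment> \<open>Three forms, each bounded by \<open>2 \<theta> S\<close> plus the energy off \<open>E\<close>: together half of \<open>S\<close> is absorbed.\<close>
  define \<theta> :: real where "\<theta> = 1 / 12"
  define c where "c = 2 * pi * 2 powr (DIM('a) / 2) * exp 1"
  have \<theta>: "\<theta> > 0" by (simp add: \<theta>_def)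
  have c: "c \<ge> 1" "c > 0"
  proof -
    have "2 powr (real DIM('a) / 2) \<ge> 1" by (simp add: ge_one_powr_ge_zero)
    then have "1 * 1 * 1 \<le> c" unfolding c_def using pi_ge_two by (intro mult_mono) auto
    then show "c \<ge> 1" "c > 0" by auto
  qed
  obtain \<epsilon> where eps: "\<epsilon> > 0" and col: "\<And>E::'a set. thin_above \<epsilon> E \<Longrightarrow>
     (\<forall>y. (\<integral>\<^sup>+x. cutoff_kernel x y * indicator E x \<partial>lborel) \<le> ennreal (\<theta>\<^sup>2)) \<and>
     (\<integral>\<^sup>+x. ennreal (gauss 1 (x::'a)) * indicator E x \<partial>lborel) \<le> ennreal (\<theta>\<^sup>2)"
    using thin_columns[where 'a='a, of "\<theta>\<^sup>2"] \<theta> by auto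
  define C where "C = 4 * (c / (4 * \<theta>))"
  have "C > 0" using c \<theta> by (simp add: C_def)
  moreover have "S \<le> C * ((LINT x|lborel. (cmod (f x))\<^sup>2 * indicator (- E) x) + (LINT x|lborel. (cmod (g x))\<^sup>2 * indicator (- E) x))"
    if E: "thin_above \<epsilon> E" and f: "sq_integrable f" and g: "sq_integrable g"
      and l: "fourier_link f g" "fourier_link (\<lambda>x. cnj (g x)) (\<lambda>x. cnj (f x))"
      and S: "(LINT x|lborel. (cmod (f x))\<^sup>2) = S" "(LINT x|lborel. (cmod (g x))\<^sup>2) = S"
      and lim: "((\<lambda>r. LINT z|(lborel \<Otimes>\<^sub>M lborel). rihaczek f g r z) \<longlongrightarrow> of_real S) (at_right 0)"
    for E :: "'a set" and f g S
  proof -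
    have [measurable]: "f \<in> borel_measurable borel" "g \<in> borel_measurable borel" "E \<in> sets borel"
      using f g E by (auto simp: sq_integrable_def thin_above_def)
    let ?N = "\<lambda>r. LINT z|(lborel \<Otimes>\<^sub>M lborel). rihaczek f g r z"
    define Of where "Of = (LINT x|lborel. (cmod (f x))\<^sup>2 * indicator (- E) x)"
    define Og where "Og = (LINT x|lborel. (cmod (g x))\<^sup>2 * indicator (- E) x)"
    define k where "k = c / (4 * \<theta>)"
    have S0: "S \<ge> 0" unfolding S(1)[symmetric] by simp
    have k0: "k \<ge> 0" using c \<theta> by (simp add: k_def)
    have O0: "Of \<ge> 0" "Og \<ge> 0" by (auto simp: Of_def Og_def)
    have b: "0 \<le> 2 * \<theta> * S + k * Of" "0 \<le> 2 * \<theta> * S + k * Og"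
      using S0 k0 O0 \<theta> by (auto intro!: add_nonneg_nonneg mult_nonneg_nonneg)
    have colc: "(\<integral>\<^sup>+x. cutoff_kernel x y * indicator (- E) x \<partial>lborel) \<le> ennreal c" for y :: 'a
      unfolding c_def by (rule cutoff_kernel_col_total) simp
    have colE: "(\<integral>\<^sup>+x. cutoff_kernel x y * indicator E x \<partial>lborel) \<le> ennreal (\<theta>\<^sup>2)" for y :: 'a
      using col[OF E] by blast
    have j: "cutoff_form f \<le> ennreal (2 * \<theta> * S + k * Of)"
      unfolding cutoff_form_def Of_def k_def
      by (rule kernel_form_bound[OF f f S(1) S(1) borel_measurable_cutoff_kernel _ cutoff_kernel_row colc colE \<theta> c(2)]) measurable
    have j': "cutoff_form g \<le> ennreal (2 * \<theta> * S + k * Og)"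
      unfolding cutoff_form_def Og_def k_def
      by (rule kernel_form_bound[OF g g S(2) S(2) borel_measurable_cutoff_kernel _ cutoff_kernel_row colc colE \<theta> c(2)]) measurable
    have n1: "ennreal (cmod (?N 1)) \<le> ennreal (2 * \<theta> * S + k * Of)"
    proof -
      have "ennreal (cmod (?N 1)) \<le> (\<integral>\<^sup>+z. ennreal (cmod (rihaczek f g 1 z)) \<partial>(lborel \<Otimes>\<^sub>M lborel))"
        by (intro integral_norm_bound_ennreal integrable_rihaczek f g) auto
      also have "\<dots> = (\<integral>\<^sup>+x. (\<integral>\<^sup>+y. ennreal (cmod (rihaczek f g 1 (x, y))) \<partial>lborel) \<partial>lborel)"
        by (subst lborel.nn_integral_fst[symmetric]) auto
      also have "\<dots> = (\<integral>\<^sup>+x. (\<integral>\<^sup>+y. ennreal (gauss 1 x * gauss 1 y) * ennreal (cmod (f x) * cmod (g y)) \<partial>lborel) \<partial>lborel)"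
      proof (intro nn_integral_cong)
        fix x y :: 'a
        have "cmod (rihaczek f g 1 (x, y)) = gauss 1 x * gauss 1 y * (cmod (f x) * cmod (g y))"
          by (simp add: cmod_rihaczek gauss_def)
        then show "ennreal (cmod (rihaczek f g 1 (x, y))) = ennreal (gauss 1 x * gauss 1 y) * ennreal (cmod (f x) * cmod (g y))"
          by (subst ennreal_mult[symmetric]) auto
      qed
      also have "\<dots> \<le> ennreal (2 * \<theta> * S + k * Of)"
        unfolding Of_def k_def
      proof (rule kernel_form_bound[OF f g S])
        have g1: "gauss 1 (x::'a) \<le> 1" for x by (simp add: gauss_def)
        have nn1: "(\<integral>\<^sup>+x. ennreal (gauss 1 (x::'a)) \<partial>lborel) = 1" by (rule nn_integral_gauss) simp
        fix x y :: 'a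
        have "(\<integral>\<^sup>+y. ennreal (gauss 1 x * gauss 1 (y::'a)) \<partial>lborel) \<le> (\<integral>\<^sup>+y. ennreal (gauss 1 (y::'a)) \<partial>lborel)"
          by (intro nn_integral_mono ennreal_leI) (simp add: mult_left_le_one_le g1)
        then show "(\<integral>\<^sup>+y. ennreal (gauss 1 x * gauss 1 (y::'a)) \<partial>lborel) \<le> 1" using nn1 by simp
        have A: "(\<integral>\<^sup>+x. ennreal (gauss 1 x * gauss 1 y) * indicator A x \<partial>lborel) \<le> (\<integral>\<^sup>+x. ennreal (gauss 1 (x::'a)) * indicator A x \<partial>lborel)" for A
          by (intro nn_integral_mono mult_right_mono ennreal_leI) (auto simp: mult_left_le g1)
        show "(\<integral>\<^sup>+x. ennreal (gauss 1 x * gauss 1 y) * indicator E x \<partial>lborel) \<le> ennreal (\<theta>\<^sup>2)"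
          using order_trans[OF A] col[OF E] by blast
        have "(\<integral>\<^sup>+x. ennreal (gauss 1 (x::'a)) * indicator (- E) x \<partial>lborel) \<le> (\<integral>\<^sup>+x. ennreal (gauss 1 (x::'a)) \<partial>lborel)"
          by (intro nn_integral_mono) (auto simp: indicator_def)
        also have "\<dots> \<le> ennreal c" using nn1 c by (simp add: ennreal_leI flip: ennreal_1)
        finally show "(\<integral>\<^sup>+x. ennreal (gauss 1 x * gauss 1 y) * indicator (- E) x \<partial>lborel) \<le> ennreal c"
          using order_trans[OF A] by blast
      qed (use \<theta> c in auto)
      finally show ?thesis .
    qed
    let ?B = "(2 * \<theta> * S + k * Of) + ((2 * \<theta> * S + k * Of) + (2 * \<theta> * S + k * Og))"
    have bound: "cmod (?N r) \<le> ?B" if r: "0 < r" "r < 1" for r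
    proof -
      have "ennreal (cmod (?N r - ?N 1)) \<le> ennreal ((2 * \<theta> * S + k * Of) + (2 * \<theta> * S + k * Og))"
        unfolding ennreal_plus[OF b] by (rule order_trans[OF rihaczek_increment[OF f g l r] add_mono[OF j j']])
      then have 1: "cmod (?N r - ?N 1) \<le> (2 * \<theta> * S + k * Of) + (2 * \<theta> * S + k * Og)"
        by (subst (asm) ennreal_le_iff[OF add_nonneg_nonneg[OF b]])
      have 2: "cmod (?N 1) \<le> 2 * \<theta> * S + k * Of"
        using n1 by (subst (asm) ennreal_le_iff[OF b(1)])
      have "cmod (?N r) \<le> cmod (?N 1) + cmod (?N r - ?N 1)" by (rule norm_triangle_sub)
      then show ?thesis using 1 2 by linarith
    qed
    have "cmod (of_real S) \<le> ?B"
    proof (rule tendsto_upperbound[OF tendsto_norm[OF lim]])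
      show "\<forall>\<^sub>F r in at_right 0. cmod (?N r) \<le> ?B"
        using eventually_at_right_real[OF zero_less_one] by (rule eventually_mono) (use bound in auto)
    qed simp
    then have "S \<le> S / 2 + 2 * (k * Of) + k * Og" using S0 by (simp add: \<theta>_def mult.commute)
    moreover have "0 \<le> k * Og" using k0 O0 by simp
    ultimately have "S \<le> 4 * (k * Of) + 4 * (k * Og)" by linarith
    then show ?thesis unfolding C_def Of_def[symmetric] Og_def[symmetric] k_def[symmetric]
      by (simp add: distrib_left)
  qed
  ultimately have ex: "\<exists>C>0. \<forall>(E::'a set) f g S. thin_above \<epsilon> E \<longrightarrow> sq_integrable f \<longrightarrow> sq_integrable g \<longrightarrow>
     fourier_link f g \<longrightarrow> fourier_link (\<lambda>x. cnj (g x)) (\<lambda>x. cnj (f x)) \<longrightarrow>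
     (LINT x|lborel. (cmod (f x))\<^sup>2) = S \<longrightarrow> (LINT x|lborel. (cmod (g x))\<^sup>2) = S \<longrightarrow>
     ((\<lambda>r. LINT z|(lborel \<Otimes>\<^sub>M lborel). rihaczek f g r z) \<longlongrightarrow> of_real S) (at_right 0) \<longrightarrow>
     S \<le> C * ((LINT x|lborel. (cmod (f x))\<^sup>2 * indicator (- E) x) + (LINT x|lborel. (cmod (g x))\<^sup>2 * indicator (- E) x))"
    by (intro exI[of _ C] conjI allI impI)
  show ?thesis by (rule exI[where x = \<epsilon>]) (rule conjI[OF eps ex])
qed

section \<open>Functions orthogonal to all Gaussians\<close>

lemma gauss_le_scaled:
  assumes s: "0 < s" and r: "r \<ge> 0" "r \<le> norm v"
  shows "gauss s (v::'a::euclidean_space) \<le> 2 powr (DIM('a) / 2) * exp (- pi * r\<^sup>2 / (2 * s)) * gauss (2 * s) v"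
proof -
  have "r\<^sup>2 \<le> (norm v)\<^sup>2" using r by (intro power_mono) auto
  then have "pi * r\<^sup>2 / (2 * s) \<le> pi * (norm v)\<^sup>2 / (2 * s)" using s by (intro divide_right_mono mult_left_mono) auto
  then have "gauss s v * exp (pi * r\<^sup>2 / (2 * s)) \<le> 2 powr (DIM('a) / 2) * gauss (2 * s) v"
    unfolding gauss_double[OF s, symmetric] by (intro mult_left_mono) auto
  then have "gauss s v * exp (pi * r\<^sup>2 / (2 * s)) * exp (- pi * r\<^sup>2 / (2 * s)) \<le> 2 powr (DIM('a) / 2) * gauss (2 * s) v * exp (- pi * r\<^sup>2 / (2 * s))"
    by (rule mult_right_mono) simp
  moreover have "exp (pi * r\<^sup>2 / (2 * s)) * exp (- pi * r\<^sup>2 / (2 * s)) = 1"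
    by (simp only: exp_add[symmetric]) simp
  ultimately show ?thesis by (simp only: mult.assoc mult_1_right) (simp only: mult.commute mult.left_commute)
qed

text \<open>
  A bound on Gaussians centred in a bounded set, uniform in the variance \<open>s \<le> 1\<close>; it provides the
  majorant for dominated convergence as \<open>s \<longrightarrow> 0\<close>.
\<close>

lemma gauss_translate_bound:
  assumes s: "0 < s" "s \<le> 1" and y: "norm y \<le> R"
  shows "gauss s (x - y :: 'a::euclidean_space)
    \<le> 2 powr (DIM('a) / 2) * exp (pi * R\<^sup>2 / 2) * exp (- (pi / 4) * (norm x)\<^sup>2) * gauss (2 * s) (x - y)"
proof -
  have "gauss s (x - y) \<le> 2 powr (DIM('a) / 2) * exp (- pi * (norm (x - y))\<^sup>2 / (2 * s)) * gauss (2 * s) (x - y)"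
    by (rule gauss_le_scaled[OF s(1)]) auto
  also have "\<dots> \<le> 2 powr (DIM('a) / 2) * (exp (pi * R\<^sup>2 / 2) * exp (- (pi / 4) * (norm x)\<^sup>2)) * gauss (2 * s) (x - y)"
  proof (intro mult_right_mono mult_left_mono)
    have "norm x \<le> norm (x - y) + norm y" using norm_triangle_sub[of x y] by simp
    then have "norm x \<le> norm (x - y) + R" using y by simp
    then have "(norm x)\<^sup>2 \<le> (norm (x - y) + R)\<^sup>2" by (rule power_mono) simp
    also have "\<dots> \<le> 2 * (norm (x - y))\<^sup>2 + 2 * R\<^sup>2"
      using zero_le_power2[of "norm (x - y) - R"] by (simp add: power2_eq_square algebra_simps)
    finally have "(norm x)\<^sup>2 / 2 - R\<^sup>2 \<le> (norm (x - y))\<^sup>2" by simp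
    then have "pi / 2 * ((norm x)\<^sup>2 / 2 - R\<^sup>2) \<le> pi / 2 * (norm (x - y))\<^sup>2" by (rule mult_left_mono) simp
    also have "\<dots> \<le> pi * (norm (x - y))\<^sup>2 / (2 * s)"
    proof -
      have "pi * (norm (x - y))\<^sup>2 / (2 * 1) \<le> pi * (norm (x - y))\<^sup>2 / (2 * s)"
        using s by (intro divide_left_mono) auto
      then show ?thesis by simp
    qed
    finally have "- pi * (norm (x - y))\<^sup>2 / (2 * s) \<le> pi * R\<^sup>2 / 2 + - (pi / 4) * (norm x)\<^sup>2"
      by (simp add: algebra_simps)
    then show "exp (- pi * (norm (x - y))\<^sup>2 / (2 * s)) \<le> exp (pi * R\<^sup>2 / 2) * exp (- (pi / 4) * (norm x)\<^sup>2)"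
      by (simp only: exp_add[symmetric] exp_le_cancel_iff)
  qed auto
  finally show ?thesis by (simp only: mult.assoc)
qed

text \<open>
  The convolution of the indicator function of \<open>B\<close> with a Gaussian.
\<close>

definition gauss_avg :: "real \<Rightarrow> 'a::euclidean_space set \<Rightarrow> 'a \<Rightarrow> real" where
  "gauss_avg s B x = (LINT y|lborel. gauss s (x - y) * indicator B y)"

lemma integrable_gauss_indicator:
  assumes "s > 0" "B \<in> sets borel"
  shows "integrable lborel (\<lambda>y. gauss s (x - y) * indicator B y)"
  using assms by (intro integrable_real_mult_indicator integrable_gauss) auto

lemma gauss_avg_nonneg: "gauss_avg s B x \<ge> 0"
  by (simp add: gauss_avg_def)

lemma integral_gauss:
  assumes "s > 0"
  shows "(LINT y|lborel. gauss s (x - y :: 'a::euclidean_space)) = 1"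
  using nn_integral_gauss_shift(2)[OF assms, of x] by (simp add: integral_eq_nn_integral)

lemma gauss_avg_far:
  assumes s: "s > 0" and [measurable]: "B \<in> sets borel" and r: "r \<ge> 0" "\<And>y. y \<in> B \<Longrightarrow> r \<le> norm (x - y)"
  shows "gauss_avg s B (x::'a::euclidean_space) \<le> 2 powr (DIM('a) / 2) * exp (- pi * r\<^sup>2 / (2 * s))"
proof -
  let ?c = "2 powr (DIM('a) / 2) * exp (- pi * r\<^sup>2 / (2 * s))"
  have "gauss_avg s B x \<le> (LINT y|lborel. ?c * gauss (2 * s) (x - y))"
    unfolding gauss_avg_def
  proof (rule integral_mono)
    show "integrable lborel (\<lambda>y. gauss s (x - y) * indicator B y)" using s by (rule integrable_gauss_indicator) simp
    show "integrable lborel (\<lambda>y. ?c * gauss (2 * s) (x - y))" using s by (intro integrable_mult_right integrable_gauss) auto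
    show "gauss s (x - y) * indicator B y \<le> ?c * gauss (2 * s) (x - y)" for y
      using gauss_le_scaled[OF s r(1) r(2), of y] by (cases "y \<in> B") auto
  qed
  also have "\<dots> = ?c" using s by (simp only: integral_mult_right_zero) (simp add: integral_gauss)
  finally show ?thesis .
qed

lemma gauss_avg_complement:
  assumes s: "s > 0" and B: "B \<in> sets borel"
  shows "gauss_avg s B x + gauss_avg s (- B) x = 1"
proof -
  have "gauss_avg s B x + gauss_avg s (- B) x = (LINT y|lborel. gauss s (x - y) * indicator B y + gauss s (x - y) * indicator (- B) y)"
    unfolding gauss_avg_def using s B by (intro Bochner_Integration.integral_add[symmetric] integrable_gauss_indicator) auto
  also have "\<dots> = (LINT y|lborel. gauss s (x - y))"
    by (intro Bochner_Integration.integral_cong) (auto simp: indicator_def)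
  finally show ?thesis using s by (simp add: integral_gauss)
qed

lemma exp_neg_seq_tendsto_0:
  assumes "c > 0"
  shows "(\<lambda>n. A * exp (- pi * c / (2 * inverse (real (Suc n))))) \<longlonglongrightarrow> 0"
proof -
  have "filterlim (\<lambda>n. (pi * c / 2) * real (Suc n)) at_top sequentially"
    using assms by (intro filterlim_tendsto_pos_mult_at_top[OF tendsto_const])
      (simp, rule filterlim_compose[OF filterlim_real_sequentially filterlim_Suc])
  then have "filterlim (\<lambda>n. - ((pi * c / 2) * real (Suc n))) at_bot sequentially"
    by (simp add: filterlim_uminus_at_bot)
  then have "(\<lambda>n. exp (- ((pi * c / 2) * real (Suc n)))) \<longlonglongrightarrow> 0"
    by (rule filterlim_compose[OF exp_at_bot])
  then have "(\<lambda>n. A * exp (- ((pi * c / 2) * real (Suc n)))) \<longlonglongrightarrow> 0"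
    by (rule tendsto_mult_right_zero)
  moreover have "(\<lambda>n. A * exp (- pi * c / (2 * inverse (real (Suc n))))) = (\<lambda>n. A * exp (- ((pi * c / 2) * real (Suc n))))"
  proof
    fix n
    have "x / (2 * inverse N) = x / 2 * N" for x N :: real
      by (simp only: divide_inverse inverse_mult_distrib inverse_inverse_eq mult.assoc)
    then show "A * exp (- pi * c / (2 * inverse (real (Suc n)))) = A * exp (- ((pi * c / 2) * real (Suc n)))"
      by (simp only:) simp
  qed
  ultimately show ?thesis by (rule ssubst[rotated])
qed

lemma gauss_avg_tendsto:
  assumes [measurable]: "B \<in> sets borel" and x: "x \<in> interior B \<or> (x::'a::euclidean_space) \<notin> closure B"
  shows "(\<lambda>n. gauss_avg (inverse (real (Suc n))) B x) \<longlonglongrightarrow> indicator B x"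
  using x
proof
  assume "x \<notin> closure B"
  then obtain e where e: "e > 0" "ball x e \<subseteq> - closure B"
    using open_contains_ball[of "- closure B"] by auto
  have far: "e \<le> norm (x - y)" if "y \<in> B" for y
  proof (rule ccontr)
    assume "\<not> e \<le> norm (x - y)"
    then have "y \<in> ball x e" by (simp add: dist_norm)
    then show False using e(2) that closure_subset by blast
  qed
  have b: "gauss_avg (inverse (real (Suc n))) B x \<le> 2 powr (DIM('a) / 2) * exp (- pi * e\<^sup>2 / (2 * inverse (real (Suc n))))" for n
    by (rule gauss_avg_far) (use e(1) far in auto)
  have "(\<lambda>n. gauss_avg (inverse (real (Suc n))) B x) \<longlonglongrightarrow> 0"
    by (rule tendsto_sandwich[OF _ _ tendsto_const exp_neg_seq_tendsto_0[of "e\<^sup>2" "2 powr (DIM('a) / 2)"]];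
        (intro always_eventually allI gauss_avg_nonneg b)?) (use e(1) in simp)
  moreover have "x \<notin> B" using \<open>x \<notin> closure B\<close> closure_subset by blast
  ultimately show ?thesis by simp
next
  assume "x \<in> interior B"
  then obtain e where e: "e > 0" "ball x e \<subseteq> B" using mem_interior by blast
  have far: "e \<le> norm (x - y)" if "y \<in> - B" for y
  proof (rule ccontr)
    assume "\<not> e \<le> norm (x - y)"
    then have "y \<in> ball x e" by (simp add: dist_norm)
    then show False using e(2) that by blast
  qed
  have b: "gauss_avg (inverse (real (Suc n))) (- B) x \<le> 2 powr (DIM('a) / 2) * exp (- pi * e\<^sup>2 / (2 * inverse (real (Suc n))))" for n
    by (rule gauss_avg_far) (use e(1) far in auto)
  have l: "(\<lambda>n. gauss_avg (inverse (real (Suc n))) (- B) x) \<longlonglongrightarrow> 0"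
    by (rule tendsto_sandwich[OF _ _ tendsto_const exp_neg_seq_tendsto_0[of "e\<^sup>2" "2 powr (DIM('a) / 2)"]];
        (intro always_eventually allI gauss_avg_nonneg b)?) (use e(1) in simp)
  have "(\<lambda>n. 1 - gauss_avg (inverse (real (Suc n))) (- B) x) \<longlonglongrightarrow> 1 - 0"
    by (intro tendsto_intros l)
  moreover have "1 - gauss_avg (inverse (real (Suc n))) (- B) x = gauss_avg (inverse (real (Suc n))) B x" for n
    using gauss_avg_complement[of "inverse (real (Suc n))" B x] by simp
  moreover have "x \<in> B" using \<open>x \<in> interior B\<close> interior_subset by blast
  ultimately show ?thesis by simp
qed

text \<open>
  By Fubini \<open>k\<close> is orthogonal to the Gaussian averages of the indicator of a box, which converge
  to the indicator off the boundary of the box.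
\<close>

lemma integral_box_zero:
  fixes k :: "'a::euclidean_space \<Rightarrow> complex"
  assumes [measurable]: "k \<in> borel_measurable borel"
    and int: "\<And>c. c > 0 \<Longrightarrow> integrable lborel (\<lambda>x. exp (- c * (norm x)\<^sup>2) * cmod (k x))"
    and zero: "\<And>s b. s > 0 \<Longrightarrow> (LINT x|lborel. of_real (gauss s (b - x)) * k x) = 0"
  shows "(LINT x|lborel. indicator (box l u) x *\<^sub>R k x) = 0"
proof -
  let ?B = "box l u"
  let ?s = "\<lambda>n. inverse (real (Suc n))"
  obtain R where R: "\<And>y. y \<in> ?B \<Longrightarrow> norm y \<le> R" using bounded_box[of l u] by (auto simp: bounded_iff)
  have [measurable]: "?B \<in> sets borel" by simp
  have mg: "(\<lambda>x. gauss_avg s ?B x) \<in> borel_measurable borel" for s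
    unfolding gauss_avg_def by measurable
  note [measurable] = mg
  let ?e = "\<lambda>x. exp (- (pi / 4) * (norm x)\<^sup>2)"
  let ?C = "2 powr (real DIM('a) / 2) * exp (pi * R\<^sup>2 / 2)"
  have dom: "gauss_avg s ?B x \<le> ?C * ?e x" if s: "0 < s" "s \<le> 1" for s x
  proof -
    have "gauss_avg s ?B x \<le> (LINT y|lborel. ?C * ?e x * gauss (2 * s) (x - y))"
      unfolding gauss_avg_def
    proof (rule integral_mono)
      show "integrable lborel (\<lambda>y. gauss s (x - y) * indicator ?B y)" using s by (intro integrable_gauss_indicator) auto
      show "integrable lborel (\<lambda>y. ?C * ?e x * gauss (2 * s) (x - y))" using s by (intro integrable_mult_right integrable_gauss) auto
      show "gauss s (x - y) * indicator ?B y \<le> ?C * ?e x * gauss (2 * s) (x - y)" for y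
        using gauss_translate_bound[OF s R, of y x] by (cases "y \<in> ?B") auto
    qed
    also have "\<dots> = ?C * ?e x" using s by (simp only: integral_mult_right_zero) (simp add: integral_gauss)
    finally show ?thesis .
  qed
  have z: "(LINT x|lborel. gauss_avg s ?B x *\<^sub>R k x) = 0" if s: "0 < s" "s \<le> 1" for s
  proof -
    let ?h = "\<lambda>x y. (gauss s (x - y) * indicator ?B y) *\<^sub>R k x"
    have hint: "integrable (lborel \<Otimes>\<^sub>M lborel) (\<lambda>(x, y). ?h x y)"
    proof (rule Bochner_Integration.integrable_bound)
      show "integrable (lborel \<Otimes>\<^sub>M lborel) (\<lambda>(x, y). (?C * (2 * s) powr (- (real DIM('a) / 2)) * (?e x * cmod (k x))) * indicator ?B y)"
        using int[of "pi / 4"]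
        by (intro integrable_pair_mult sigma_finite_lborel integrable_mult_right integrable_real_indicator)
          (auto simp: emeasure_lborel_box_finite[simplified])
      show "AE z in lborel \<Otimes>\<^sub>M lborel. norm (case z of (x, y) \<Rightarrow> ?h x y)
          \<le> norm (case z of (x, y) \<Rightarrow> (?C * (2 * s) powr (- (real DIM('a) / 2)) * (?e x * cmod (k x))) * indicator ?B y)"
      proof (intro AE_I2, clarify)
        fix x y
        show "norm (?h x y) \<le> norm ((?C * (2 * s) powr (- (real DIM('a) / 2)) * (?e x * cmod (k x))) * indicator ?B y)"
        proof (cases "y \<in> ?B")
          case True
          have "gauss (2 * s) (x - y) \<le> (2 * s) powr (- (real DIM('a) / 2))"
            using s by (intro gauss_le) simp
          then have "?C * ?e x * gauss (2 * s) (x - y) \<le> ?C * ?e x * (2 * s) powr (- (real DIM('a) / 2))"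
            by (rule mult_left_mono) auto
          then have "gauss s (x - y) \<le> ?C * ?e x * (2 * s) powr (- (real DIM('a) / 2))"
            using gauss_translate_bound[OF s R[OF True], of x] by linarith
          then have "gauss s (x - y) * cmod (k x) \<le> (?C * ?e x * (2 * s) powr (- (real DIM('a) / 2))) * cmod (k x)"
            by (rule mult_right_mono) simp
          also have "\<dots> = ?C * (2 * s) powr (- (real DIM('a) / 2)) * (?e x * cmod (k x))"
            by (simp only: mult.assoc mult.commute mult.left_commute)
          finally show ?thesis using True by simp
        qed simp
      qed
    qed measurable
    have "(LINT x|lborel. gauss_avg s ?B x *\<^sub>R k x) = (LINT x|lborel. LINT y|lborel. ?h x y)"
      unfolding gauss_avg_def using s
      by (intro Bochner_Integration.integral_cong refl integral_scaleR_left[symmetric] integrable_gauss_indicator) auto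
    also have "\<dots> = (LINT y|lborel. LINT x|lborel. ?h x y)"
      by (rule lborel_pair.Fubini_integral[OF hint, symmetric])
    also have "\<dots> = (LINT y::'a|lborel. 0)"
    proof (rule Bochner_Integration.integral_cong[OF refl])
      fix y
      have "(LINT x|lborel. ?h x y) = (LINT x|lborel. of_real (indicator ?B y) * (of_real (gauss s (y - x)) * k x))"
        by (intro Bochner_Integration.integral_cong refl) (simp add: scaleR_conv_of_real gauss_commute)
      also have "\<dots> = of_real (indicator ?B y) * (LINT x|lborel. of_real (gauss s (y - x)) * k x)" by simp
      finally show "(LINT x|lborel. ?h x y) = 0" using zero[OF s(1)] by simp
    qed
    finally show ?thesis by simp
  qed
  have "(\<lambda>n. LINT x|lborel. gauss_avg (?s n) ?B x *\<^sub>R k x) \<longlonglongrightarrow> (LINT x|lborel. indicator ?B x *\<^sub>R k x)"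
  proof (rule integral_dominated_convergence)
    show "integrable lborel (\<lambda>x. ?C * (?e x * cmod (k x)))" using int[of "pi / 4"] by (intro integrable_mult_right) auto
    have "AE x in lborel. x \<notin> cbox l u - box l u"
      using null_sets_cbox_Diff_box by (rule AE_not_in)
    then show "AE x in lborel. (\<lambda>n. gauss_avg (?s n) ?B x *\<^sub>R k x) \<longlonglongrightarrow> indicator ?B x *\<^sub>R k x"
    proof eventually_elim
      fix x assume x: "x \<notin> cbox l u - box l u"
      have "closure ?B \<subseteq> cbox l u" by (rule closure_minimal) (auto intro: box_subset_cbox[THEN subsetD])
      then have "x \<in> interior ?B \<or> x \<notin> closure ?B" using x by (auto simp: interior_open[OF open_box])
      then show "(\<lambda>n. gauss_avg (?s n) ?B x *\<^sub>R k x) \<longlonglongrightarrow> indicator ?B x *\<^sub>R k x"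
        by (intro tendsto_intros gauss_avg_tendsto) auto
    qed
    show "AE x in lborel. norm (gauss_avg (?s n) ?B x *\<^sub>R k x) \<le> ?C * (?e x * cmod (k x))" for n
    proof (intro AE_I2)
      fix x
      have "?s n \<le> 1" by (simp add: inverse_le_1_iff)
      then have "gauss_avg (?s n) ?B x * cmod (k x) \<le> ?C * ?e x * cmod (k x)" by (intro mult_right_mono dom) auto
      then show "norm (gauss_avg (?s n) ?B x *\<^sub>R k x) \<le> ?C * (?e x * cmod (k x))"
        by (simp add: gauss_avg_nonneg mult.assoc)
    qed
  qed measurable
  moreover have "(LINT x|lborel. gauss_avg (?s n) ?B x *\<^sub>R k x) = 0" for n
    by (rule z) (auto simp: inverse_le_1_iff)
  ultimately show ?thesis by (simp add: LIMSEQ_const_iff)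
qed

lemma integrable_on_box:
  fixes k :: "'a::euclidean_space \<Rightarrow> complex"
  assumes [measurable]: "k \<in> borel_measurable borel"
    and int: "integrable lborel (\<lambda>x. exp (- (norm x)\<^sup>2) * cmod (k x))"
  shows "integrable lborel (\<lambda>x. indicator (box l u) x *\<^sub>R k x)"
proof -
  obtain R where R: "\<And>y. y \<in> box l u \<Longrightarrow> norm y \<le> R" using bounded_box[of l u] by (auto simp: bounded_iff)
  show ?thesis
  proof (rule Bochner_Integration.integrable_bound)
    show "integrable lborel (\<lambda>x. exp (R\<^sup>2) * (exp (- (norm x)\<^sup>2) * cmod (k x)))"
      using int by (rule integrable_mult_right)
    show "AE x in lborel. norm (indicator (box l u) x *\<^sub>R k x) \<le> norm (exp (R\<^sup>2) * (exp (- (norm x)\<^sup>2) * cmod (k x)))"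
    proof (intro AE_I2)
      fix x
      show "norm (indicator (box l u) x *\<^sub>R k x) \<le> norm (exp (R\<^sup>2) * (exp (- (norm x)\<^sup>2) * cmod (k x)))"
      proof (cases "x \<in> box l u")
        case True
        have "(norm x)\<^sup>2 \<le> R\<^sup>2" using R[OF True] by (intro power_mono) auto
        then have "1 \<le> exp (R\<^sup>2) * exp (- (norm x)\<^sup>2)" by (simp flip: exp_add)
        then have "1 * cmod (k x) \<le> exp (R\<^sup>2) * exp (- (norm x)\<^sup>2) * cmod (k x)" by (rule mult_right_mono) simp
        then show ?thesis using True by (simp add: mult.assoc)
      qed simp
    qed
  qed measurable
qed

text \<open>
  A function orthogonal to all Gaussians vanishes almost everywhere.
\<close>

lemma gauss_separating:
  fixes k :: "'a::euclidean_space \<Rightarrow> complex"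
  assumes [measurable]: "k \<in> borel_measurable borel"
    and int: "\<And>c. c > 0 \<Longrightarrow> integrable lborel (\<lambda>x. exp (- c * (norm x)\<^sup>2) * cmod (k x))"
    and zero: "\<And>s b. s > 0 \<Longrightarrow> (LINT x|lborel. of_real (gauss s (b - x)) * k x) = 0"
  shows "AE x in lborel. k x = 0"
proof -
  let ?Q = "\<lambda>n::nat. box (- (real n *\<^sub>R One)) (real n *\<^sub>R One) :: 'a set"
  let ?E = "range (\<lambda>(a, b). box a b::'a set)"
  have bz: "(LINT x|lborel. indicator (box l u) x *\<^sub>R k x) = 0" for l u
    by (rule integral_box_zero[OF assms])
  have ib: "integrable lborel (\<lambda>x. indicator (box l u) x *\<^sub>R k x)" for l u
    by (rule integrable_on_box) (use int[of 1] in auto)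
  \<comment> \<open>The boxes generate the Borel sets and are stable under intersection.\<close>
  have "AE x in lborel. indicator (?Q n) x *\<^sub>R k x = 0" for n
  proof (rule sigma_finite_measure.density_zero[OF sigma_finite_lborel])
    let ?k = "\<lambda>x. indicator (?Q n) x *\<^sub>R k x"
    show ik: "integrable lborel ?k" by (rule ib)
    fix A :: "'a set" assume "A \<in> sets lborel"
    then have A: "A \<in> sigma_sets UNIV ?E" by (simp add: borel_eq_box)
    have iA: "set_integrable lborel A ?k" if "A \<in> sets borel" for A
      unfolding set_integrable_def by (rule integrable_mult_indicator[OF _ ik]) (use that in simp)
    have se: "sigma_sets UNIV ?E = sets borel" by (simp add: borel_eq_box)
    show "set_lebesgue_integral lborel A ?k = 0"
    proof (rule sigma_sets_induct_disjoint[OF _ _ A])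
      show "Int_stable ?E" by (auto simp: Int_stable_def box_Int_box)
      show "?E \<subseteq> Pow UNIV" by simp
      show "set_lebesgue_integral lborel B ?k = 0" if BE: "B \<in> ?E" for B
      proof -
        obtain a b where B: "B = box a b" using BE by auto
        obtain a' b' where B': "box a b \<inter> ?Q n = box a' b'" by (rule that[OF box_Int_box])
        have "set_lebesgue_integral lborel B ?k = (LINT x|lborel. indicator (box a' b') x *\<^sub>R k x)"
          unfolding set_lebesgue_integral_def B B'[symmetric]
          by (intro Bochner_Integration.integral_cong) (auto simp: indicator_def)
        then show ?thesis using bz by simp
      qed
      show "set_lebesgue_integral lborel {} ?k = 0" by (simp add: set_lebesgue_integral_def)
      show "set_lebesgue_integral lborel (UNIV - B) ?k = 0"
        if B: "B \<in> sigma_sets UNIV ?E" "set_lebesgue_integral lborel B ?k = 0" for B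
      proof -
        have Bb: "B \<in> sets borel" using B(1) se by simp
        have "set_lebesgue_integral lborel (B \<union> (UNIV - B)) ?k = set_lebesgue_integral lborel B ?k + set_lebesgue_integral lborel (UNIV - B) ?k"
          by (rule set_integral_Un) (use iA Bb in auto)
        moreover have "set_lebesgue_integral lborel (B \<union> (UNIV - B)) ?k = 0"
          using bz by (simp add: set_lebesgue_integral_def)
        ultimately show ?thesis using B(2) by simp
      qed
      show "set_lebesgue_integral lborel (\<Union>i. F i) ?k = 0"
        if F: "disjoint_family F" "range F \<subseteq> sigma_sets UNIV ?E" "\<And>i. set_lebesgue_integral lborel (F i) ?k = 0" for F :: "nat \<Rightarrow> _"
      proof -
        have Fb: "F i \<in> sets borel" for i using F(2) se by auto
        have "set_lebesgue_integral lborel (\<Union>i. F i) ?k = (\<Sum>i. set_lebesgue_integral lborel (F i) ?k)"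
          by (rule lebesgue_integral_countable_add) (use Fb F(1) iA in \<open>auto simp: disjoint_family_on_def\<close>)
        then show ?thesis using F(3) by simp
      qed
    qed
  qed
  then have "AE x in lborel. \<forall>n. indicator (?Q n) x *\<^sub>R k x = 0" unfolding AE_all_countable by blast
  then show ?thesis
  proof eventually_elim
    fix x assume h: "\<forall>n. indicator (?Q n) x *\<^sub>R k x = 0"
    have "x \<in> (\<Union>n. ?Q n)" using UN_box_eq_UNIV by blast
    then obtain n where "x \<in> ?Q n" by blast
    then show "k x = 0" using spec[OF h, of n] by simp
  qed
qed

section \<open>Removal of the regularisation\<close>

lemma cauchy_schwarz_integral:
  fixes p q :: "'a \<Rightarrow> complex"
  assumes [measurable]: "p \<in> borel_measurable M" "q \<in> borel_measurable M"
    and p: "integrable M (\<lambda>x. (cmod (p x))\<^sup>2)" and q: "integrable M (\<lambda>x. (cmod (q x))\<^sup>2)"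
  shows "cmod (LINT x|M. p x * q x) \<le> sqrt (LINT x|M. (cmod (p x))\<^sup>2) * sqrt (LINT x|M. (cmod (q x))\<^sup>2)"
proof -
  let ?A = "LINT x|M. (cmod (p x))\<^sup>2"
  let ?B = "LINT x|M. (cmod (q x))\<^sup>2"
  have AB: "?A \<ge> 0" "?B \<ge> 0" by auto
  show ?thesis
  proof (cases "integrable M (\<lambda>x. p x * q x)")
    case False
    then show ?thesis using AB by (simp add: not_integrable_integral_eq)
  next
    case True
    let ?I = "cmod (LINT x|M. p x * q x)"
    have "ennreal ?I \<le> (\<integral>\<^sup>+x. ennreal (cmod (p x * q x)) \<partial>M)" by (rule integral_norm_bound_ennreal[OF True])
    also have "\<dots> = (\<integral>\<^sup>+x. ennreal (cmod (p x)) * ennreal (cmod (q x)) \<partial>M)"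
      by (intro nn_integral_cong) (simp add: norm_mult ennreal_mult)
    finally have "(ennreal ?I)\<^sup>2 \<le> (\<integral>\<^sup>+x. ennreal (cmod (p x)) * ennreal (cmod (q x)) \<partial>M)\<^sup>2" by (rule power_mono) simp
    also have "\<dots> \<le> (\<integral>\<^sup>+x. (ennreal (cmod (p x)))\<^sup>2 \<partial>M) * (\<integral>\<^sup>+x. (ennreal (cmod (q x)))\<^sup>2 \<partial>M)"
      by (rule Cauchy_Schwarz_nn_integral) measurable
    also have "\<dots> = ennreal ?A * ennreal ?B"
      using nn_integral_eq_integral[OF p] nn_integral_eq_integral[OF q] by (simp add: ennreal_power)
    also have "\<dots> = ennreal (?A * ?B)" using AB by (simp add: ennreal_mult)
    finally have "ennreal (?I\<^sup>2) \<le> ennreal (?A * ?B)" by (simp add: ennreal_power)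
    then have "?I\<^sup>2 \<le> ?A * ?B" using AB by (simp add: ennreal_le_iff)
    then have "?I \<le> sqrt (?A * ?B)" by (rule real_le_rsqrt)
    then show ?thesis by (simp add: real_sqrt_mult)
  qed
qed

text \<open>
  The convolution of \<open>g\<close> with a Gaussian, defined pointwise.
\<close>

definition gconv :: "real \<Rightarrow> ('a::euclidean_space \<Rightarrow> complex) \<Rightarrow> 'a \<Rightarrow> complex" where
  "gconv r g x = (LINT y|lborel. of_real (gauss r (x - y)) * g y)"

lemma borel_measurable_gconv [measurable]:
  assumes [measurable]: "g \<in> borel_measurable borel"
  shows "gconv r (g :: 'a::euclidean_space \<Rightarrow> complex) \<in> borel_measurable borel"
  unfolding gconv_def[abs_def] by measurable

lemma gconv_bounded:
  assumes g: "sq_integrable (g :: 'a::euclidean_space \<Rightarrow> complex)" and r: "r > 0"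
  shows "\<exists>B. \<forall>x. cmod (gconv r g x) \<le> B"
proof -
  have bd: "(LINT y|lborel. (cmod (of_real (gauss r (x - y))))\<^sup>2) \<le> r powr (- (real DIM('a) / 2))" for x :: 'a
  proof -
    have "(LINT y|lborel. (cmod (of_real (gauss r (x - y))))\<^sup>2) \<le> (LINT y|lborel. r powr (- (real DIM('a) / 2)) * gauss r (x - y))"
    proof (rule integral_mono)
      show "integrable lborel (\<lambda>y. (cmod (of_real (gauss r (x - y))))\<^sup>2)"
        using sq_integrable_gauss[OF r, of x] by (simp add: sq_integrable_def)
      show "integrable lborel (\<lambda>y. r powr (- (real DIM('a) / 2)) * gauss r (x - y))"
        using r by (intro integrable_mult_right integrable_gauss)
      fix y
      have "gauss r (x - y) \<le> r powr (- (real DIM('a) / 2))"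
        by (rule gauss_le[OF r])
      then have "gauss r (x - y) * gauss r (x - y) \<le> r powr (- (real DIM('a) / 2)) * gauss r (x - y)"
        by (rule mult_right_mono) simp
      then show "(cmod (of_real (gauss r (x - y))))\<^sup>2 \<le> r powr (- (real DIM('a) / 2)) * gauss r (x - y)"
        by (simp add: power2_eq_square)
    qed
    also have "\<dots> = r powr (- (real DIM('a) / 2))" using r by (simp only: integral_mult_right_zero) (simp add: integral_gauss)
    finally show ?thesis .
  qed
  have [measurable]: "g \<in> borel_measurable borel" using g by (simp add: sq_integrable_def)
  have "cmod (gconv r g x) \<le> sqrt (r powr (- (real DIM('a) / 2))) * sqrt (LINT x|lborel. (cmod (g x))\<^sup>2)" for x
  proof -
    have "cmod (gconv r g x) \<le> sqrt (LINT y|lborel. (cmod (of_real (gauss r (x - y))))\<^sup>2) * sqrt (LINT x|lborel. (cmod (g x))\<^sup>2)"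
      unfolding gconv_def
      by (rule cauchy_schwarz_integral) (use g sq_integrable_gauss[OF r, of x] in \<open>auto simp: sq_integrable_def\<close>)
    also have "\<dots> \<le> sqrt (r powr (- (real DIM('a) / 2))) * sqrt (LINT x|lborel. (cmod (g x))\<^sup>2)"
      using bd[of x] by (intro mult_right_mono real_sqrt_le_mono) auto
    finally show ?thesis .
  qed
  then show ?thesis by blast
qed

lemma integral_gauss_gauss:
  assumes r: "r > 0" and s: "s > 0"
  shows "(LINT x|lborel. gauss r (x - y) * gauss s (x - b)) = gauss (r + s) (y - b)"
  using nn_integral_gauss_gauss[OF r s, of y b] by (simp add: integral_eq_nn_integral)

lemma integral_gauss_gconv:
  assumes g: "sq_integrable (g :: 'a::euclidean_space \<Rightarrow> complex)" and r: "r > 0" and s: "s > 0"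
  shows "(LINT x|lborel. of_real (gauss s (b - x)) * gconv r g x) = gconv (r + s) g b"
proof -
  have [measurable]: "g \<in> borel_measurable borel" using g by (simp add: sq_integrable_def)
  let ?h = "\<lambda>x y. of_real (gauss s (b - x)) * (of_real (gauss r (x - y)) * g y)"
  have int: "integrable (lborel \<Otimes>\<^sub>M lborel) (\<lambda>(x, y). ?h x y)"
  proof (rule integrableI_bounded)
    have "(\<integral>\<^sup>+z. ennreal (norm (case z of (x, y) \<Rightarrow> ?h x y)) \<partial>(lborel \<Otimes>\<^sub>M lborel))
       = (\<integral>\<^sup>+y. (\<integral>\<^sup>+x. ennreal (norm (?h x y)) \<partial>lborel) \<partial>lborel)"
      by (subst lborel_pair.nn_integral_snd[symmetric]) auto
    also have "\<dots> = (\<integral>\<^sup>+y. ennreal (gauss (r + s) (b - y) * cmod (g y)) \<partial>lborel)"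
    proof (rule nn_integral_cong)
      fix y
      have "(\<integral>\<^sup>+x. ennreal (norm (?h x y)) \<partial>lborel) = (\<integral>\<^sup>+x. ennreal (gauss r (x - y) * gauss s (x - b)) * ennreal (cmod (g y)) \<partial>lborel)"
        by (intro nn_integral_cong)
          (simp add: norm_mult ennreal_mult[symmetric] gauss_commute[of s b] mult.commute mult.left_commute)
      also have "\<dots> = ennreal (gauss (r + s) (y - b)) * ennreal (cmod (g y))"
        using r s by (simp add: nn_integral_multc nn_integral_gauss_gauss)
      also have "\<dots> = ennreal (gauss (r + s) (b - y) * cmod (g y))"
        by (simp add: ennreal_mult gauss_commute)
      finally show "(\<integral>\<^sup>+x. ennreal (norm (?h x y)) \<partial>lborel) = ennreal (gauss (r + s) (b - y) * cmod (g y))" .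
    qed
    also have "\<dots> < \<infinity>"
    proof -
      have "integrable lborel (\<lambda>y. of_real (gauss (r + s) (b - y)) * g y)"
        using r s g by (intro integrable_mult_sq_integrable sq_integrable_gauss) auto
      from integrable_norm[OF this] have "integrable lborel (\<lambda>y. gauss (r + s) (b - y) * cmod (g y))"
        by (simp add: norm_mult)
      then show ?thesis by (simp add: nn_integral_eq_integral)
    qed
    finally show "(\<integral>\<^sup>+z. ennreal (norm (case z of (x, y) \<Rightarrow> ?h x y)) \<partial>(lborel \<Otimes>\<^sub>M lborel)) < \<infinity>" .
  qed measurable
  have "(LINT x|lborel. of_real (gauss s (b - x)) * gconv r g x) = (LINT x|lborel. LINT y|lborel. ?h x y)"
    unfolding gconv_def by simp
  also have "\<dots> = (LINT y|lborel. LINT x|lborel. ?h x y)"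
    by (rule lborel_pair.Fubini_integral[OF int, symmetric])
  also have "\<dots> = (LINT y|lborel. of_real (gauss (r + s) (b - y)) * g y)"
  proof (rule Bochner_Integration.integral_cong[OF refl])
    fix y
    have "(LINT x|lborel. ?h x y) = (LINT x|lborel. of_real (gauss r (x - y) * gauss s (x - b)) * g y)"
      by (intro Bochner_Integration.integral_cong refl) (simp add: gauss_commute[of s b])
    also have "\<dots> = of_real (LINT x|lborel. gauss r (x - y) * gauss s (x - b)) * g y"
      by (simp only: integral_mult_left_zero integral_complex_of_real)
    finally show "(LINT x|lborel. ?h x y) = of_real (gauss (r + s) (b - y)) * g y"
      using integral_gauss_gauss[OF r s, of y b] by (simp add: gauss_commute[of "r + s" y b])
  qed
  finally show ?thesis by (simp add: gconv_def)
qed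

lemma fourier_link_cnj:
  assumes "fourier_link (\<lambda>x. cnj (g x)) (\<lambda>x. cnj (f x))" "r > 0"
  shows "(LINT x|lborel. of_real (bell r x) * f x * cnj (wave \<xi> x)) = gconv r g \<xi>"
proof -
  have "(LINT x|lborel. of_real (bell r x) * cnj (f x) * wave \<xi> x)
     = (LINT y|lborel. of_real (gauss r (\<xi> - y)) * cnj (g y))"
    using assms by (simp add: fourier_link_def)
  then have "cnj (LINT x|lborel. of_real (bell r x) * cnj (f x) * wave \<xi> x)
     = cnj (LINT y|lborel. of_real (gauss r (\<xi> - y)) * cnj (g y))" by simp
  then show ?thesis
    unfolding Bochner_Integration.integral_cnj[symmetric] gconv_def by simp
qed

lemma rihaczek_integral:
  assumes f: "sq_integrable f" and g: "sq_integrable g" and r: "r > 0"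
    and l: "fourier_link (\<lambda>x. cnj (g x)) (\<lambda>x. cnj (f x))"
  shows "(LINT z|(lborel \<Otimes>\<^sub>M lborel). rihaczek f g r z)
     = (LINT \<xi>|lborel. (of_real (bell r \<xi>) * cnj (g \<xi>)) * gconv r g \<xi>)"
proof -
  have [measurable]: "f \<in> borel_measurable borel" "g \<in> borel_measurable borel"
    using f g by (auto simp: sq_integrable_def)
  have i: "integrable (lborel \<Otimes>\<^sub>M lborel) (\<lambda>(x, \<xi>). rihaczek f g r (x, \<xi>))"
    using integrable_rihaczek(1)[OF f g r] by simp
  have "(LINT z|(lborel \<Otimes>\<^sub>M lborel). rihaczek f g r z) = (LINT \<xi>|lborel. LINT x|lborel. rihaczek f g r (x, \<xi>))"
    using lborel_pair.integral_snd[OF i] by simp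
  also have "\<dots> = (LINT \<xi>|lborel. (of_real (bell r \<xi>) * cnj (g \<xi>)) * gconv r g \<xi>)"
  proof (rule Bochner_Integration.integral_cong[OF refl])
    fix \<xi>
    have "rihaczek f g r (x, \<xi>) = (of_real (bell r \<xi>) * cnj (g \<xi>)) * (of_real (bell r x) * f x * cnj (wave \<xi> x))" for x
      unfolding rihaczek_def fst_conv snd_conv exp_norm_sq_add inner_commute[of x \<xi>]
        by (simp only: of_real_mult complex_cnj_mult mult.assoc mult.commute mult.left_commute)
    then show "(LINT x|lborel. rihaczek f g r (x, \<xi>)) = (of_real (bell r \<xi>) * cnj (g \<xi>)) * gconv r g \<xi>"
      using fourier_link_cnj[OF l r, of \<xi>] by (simp only: integral_mult_right_zero)
  qed
  finally show ?thesis .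
qed

text \<open>
  Multiplication of \<open>f\<close> by a Gaussian is convolution of its Fourier transform with one.  Both sides
  have the same integrals against all Gaussians.
\<close>

lemma link_eq_gconv:
  fixes f g h :: "'a::euclidean_space \<Rightarrow> complex"
  assumes f: "sq_integrable f" and g: "sq_integrable g" and h: "sq_integrable h" and r: "r > 0"
    and l: "fourier_link (\<lambda>x. cnj (g x)) (\<lambda>x. cnj (f x))"
    and lh: "fourier_link (\<lambda>x. cnj (h x)) (\<lambda>x. cnj (of_real (bell r x) * f x))"
  shows "AE x in lborel. h x = gconv r g x"
proof -
  have [measurable]: "g \<in> borel_measurable borel" "h \<in> borel_measurable borel"
    using g h by (auto simp: sq_integrable_def)
  obtain B where B: "\<And>x. cmod (gconv r g x) \<le> B" using gconv_bounded[OF g r] by blast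
  have eint: "integrable lborel (\<lambda>x. of_real (exp (- c * (norm x)\<^sup>2)) * h x)" if "c > 0" for c
    by (rule integrable_mult_sq_integrable[OF sq_integrable_exp_norm[OF that, of _ 1] h]) auto
  have Bint: "integrable lborel (\<lambda>x. p x * cmod (gconv r g x))" if "integrable lborel p" for p :: "_ \<Rightarrow> real"
    by (rule Bochner_Integration.integrable_bound[OF integrable_mult_right[OF integrable_norm[OF that], of B]])
      (use that B in \<open>auto simp: abs_mult mult.commute[of B] intro!: mult_left_mono AE_I2 order_trans[OF B abs_ge_self]\<close>)
  have "AE x in lborel. h x - gconv r g x = 0"
  proof (rule gauss_separating)
    fix c :: real assume c: "c > 0"
    have "integrable lborel (\<lambda>x. exp (- c * (norm x)\<^sup>2) * cmod (h x) + exp (- c * (norm x)\<^sup>2) * cmod (gconv r g x))"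
      using integrable_norm[OF eint[OF c]] Bint[OF integrable_exp_norm[OF c]] by (intro Bochner_Integration.integrable_add) (auto simp: norm_mult)
    then show "integrable lborel (\<lambda>x. exp (- c * (norm x)\<^sup>2) * cmod (h x - gconv r g x))"
    proof (rule Bochner_Integration.integrable_bound)
      show "AE x in lborel. norm (exp (- c * (norm x)\<^sup>2) * cmod (h x - gconv r g x))
        \<le> norm (exp (- c * (norm x)\<^sup>2) * cmod (h x) + exp (- c * (norm x)\<^sup>2) * cmod (gconv r g x))"
        by (intro AE_I2) (simp add: distrib_left[symmetric] abs_mult norm_triangle_ineq4 mult_left_mono)
    qed measurable
  next
    fix s :: real and b assume s: "s > 0"
    have 1: "(LINT x|lborel. of_real (gauss s (b - x)) * h x) = gconv (r + s) g b"
    proof -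
      have "gconv s h b = (LINT x|lborel. of_real (bell s x) * (of_real (bell r x) * f x) * cnj (wave b x))"
        by (rule fourier_link_cnj[OF lh s, symmetric])
      also have "\<dots> = (LINT x|lborel. of_real (bell (r + s) x) * f x * cnj (wave b x))"
      proof (rule Bochner_Integration.integral_cong[OF refl])
        fix x :: 'a
        have "bell (r + s) x = bell s x * bell r x"
          by (simp only: exp_add[symmetric]) (simp add: algebra_simps)
        then show "of_real (bell s x) * (of_real (bell r x) * f x) * cnj (wave b x)
          = of_real (bell (r + s) x) * f x * cnj (wave b x)" by (simp only: of_real_mult mult.assoc)
      qed
      also have "\<dots> = gconv (r + s) g b" using r s by (intro fourier_link_cnj[OF l]) auto
      finally show ?thesis by (simp add: gconv_def)
    qed
    have 2: "(LINT x|lborel. of_real (gauss s (b - x)) * gconv r g x) = gconv (r + s) g b"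
      by (rule integral_gauss_gconv[OF g r s])
    have i1: "integrable lborel (\<lambda>x. of_real (gauss s (b - x)) * h x)"
      by (rule integrable_mult_sq_integrable[OF sq_integrable_gauss[OF s] h])
    have i2: "integrable lborel (\<lambda>x. of_real (gauss s (b - x)) * gconv r g x)"
      by (rule Bochner_Integration.integrable_bound[OF Bint[OF integrable_gauss(2)[OF s, of b]]]) (auto simp: norm_mult)
    show "(LINT x|lborel. of_real (gauss s (b - x)) * (h x - gconv r g x)) = 0"
      using Bochner_Integration.integral_diff[OF i1 i2] 1 2 by (simp add: right_diff_distrib)
  qed measurable
  then show ?thesis by eventually_elim simp
qed

lemma gaussian_cutoff_tendsto:
  fixes f :: "'a::euclidean_space \<Rightarrow> complex"
  assumes f: "sq_integrable f" and X: "\<And>i. X i > 0" "X \<longlonglongrightarrow> 0"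
  shows "(\<lambda>i. LINT x|lborel. (cmod (of_real (bell (X i) x) * f x - f x))\<^sup>2) \<longlonglongrightarrow> 0"
    and "(\<lambda>i. LINT x|lborel. bell (X i) x * (cmod (f x))\<^sup>2) \<longlonglongrightarrow> (LINT x|lborel. (cmod (f x))\<^sup>2)"
proof -
  have [measurable]: "f \<in> borel_measurable borel" using f by (auto simp: sq_integrable_def)
  have fi: "integrable lborel (\<lambda>x. (cmod (f x))\<^sup>2)" using f by (auto simp: sq_integrable_def)
  have e1: "bell (X i) x \<le> 1" for i and x :: 'a using X(1)[of i] by simp
  have lim: "(\<lambda>i. bell (X i) x) \<longlonglongrightarrow> 1" for x :: 'a
  proof -
    have "(\<lambda>i. bell (X i) x) \<longlonglongrightarrow> bell 0 x"
      by (intro tendsto_intros X(2))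
    then show ?thesis by simp
  qed
  have "(\<lambda>i. LINT x|lborel. (cmod (of_real (bell (X i) x) * f x - f x))\<^sup>2) \<longlonglongrightarrow> (LINT x::'a|lborel. 0)"
  proof (rule integral_dominated_convergence[OF _ _ fi])
    show "AE x in lborel. (\<lambda>i. (cmod (of_real (bell (X i) x) * f x - f x))\<^sup>2) \<longlonglongrightarrow> 0"
    proof (intro AE_I2)
      fix x
      have "(\<lambda>i. (cmod (of_real (bell (X i) x) * f x - f x))\<^sup>2) \<longlonglongrightarrow> (cmod (of_real 1 * f x - f x))\<^sup>2"
        by (intro tendsto_intros lim)
      then show "(\<lambda>i. (cmod (of_real (bell (X i) x) * f x - f x))\<^sup>2) \<longlonglongrightarrow> 0" by simp
    qed
    show "AE x in lborel. norm ((cmod (of_real (bell (X i) x) * f x - f x))\<^sup>2) \<le> (cmod (f x))\<^sup>2" for i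
    proof (intro AE_I2)
      fix x
      have "of_real (bell (X i) x) * f x - f x = of_real (bell (X i) x - 1) * f x"
        by (simp add: algebra_simps)
      then have "cmod (of_real (bell (X i) x) * f x - f x) = \<bar>bell (X i) x - 1\<bar> * cmod (f x)"
        by (simp only: norm_mult norm_of_real)
      also have "\<dots> \<le> 1 * cmod (f x)" using e1[of i x] by (intro mult_right_mono) (auto simp: abs_le_iff)
      finally show "norm ((cmod (of_real (bell (X i) x) * f x - f x))\<^sup>2) \<le> (cmod (f x))\<^sup>2"
        by (simp add: power_mono)
    qed
  qed measurable
  then show "(\<lambda>i. LINT x|lborel. (cmod (of_real (bell (X i) x) * f x - f x))\<^sup>2) \<longlonglongrightarrow> 0" by simp
  show "(\<lambda>i. LINT x|lborel. bell (X i) x * (cmod (f x))\<^sup>2) \<longlonglongrightarrow> (LINT x|lborel. (cmod (f x))\<^sup>2)"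
  proof (rule integral_dominated_convergence[OF _ _ fi])
    show "AE x in lborel. (\<lambda>i. bell (X i) x * (cmod (f x))\<^sup>2) \<longlonglongrightarrow> (cmod (f x))\<^sup>2"
    proof (intro AE_I2)
      fix x
      show "(\<lambda>i. bell (X i) x * (cmod (f x))\<^sup>2) \<longlonglongrightarrow> (cmod (f x))\<^sup>2"
        using tendsto_mult_right[OF lim[of x], of "(cmod (f x))\<^sup>2"] by simp
    qed
    show "AE x in lborel. norm (bell (X i) x * (cmod (f x))\<^sup>2) \<le> (cmod (f x))\<^sup>2" for i
    proof (intro AE_I2)
      fix x :: 'a
      have "bell (X i) x * (cmod (f x))\<^sup>2 \<le> 1 * (cmod (f x))\<^sup>2" by (intro mult_right_mono e1) simp
      then show "norm (bell (X i) x * (cmod (f x))\<^sup>2) \<le> (cmod (f x))\<^sup>2" by (simp add: abs_mult)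
    qed
  qed measurable
qed

text \<open>
  The limit of \<open>N(r)\<close>.  Here \<open>h\<close> stands for the Fourier transform of \<open>bell r\<close> times \<open>f\<close>; the last
  condition on it is the Plancherel theorem for the difference of that function and \<open>f\<close>.
\<close>

lemma rihaczek_tendsto:
  fixes f g :: "'a::euclidean_space \<Rightarrow> complex"
  assumes f: "sq_integrable f" and g: "sq_integrable g"
    and l: "fourier_link (\<lambda>x. cnj (g x)) (\<lambda>x. cnj (f x))"
    and S: "(LINT x|lborel. (cmod (g x))\<^sup>2) = S"
    and H: "\<And>r. r > 0 \<Longrightarrow> \<exists>h. sq_integrable h \<and>
       fourier_link (\<lambda>x. cnj (h x)) (\<lambda>x. cnj (of_real (bell r x) * f x)) \<and>
       (LINT x|lborel. (cmod (h x - g x))\<^sup>2) = (LINT x|lborel. (cmod (of_real (bell r x) * f x - f x))\<^sup>2)"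
  shows "((\<lambda>r. LINT z|(lborel \<Otimes>\<^sub>M lborel). rihaczek f g r z) \<longlongrightarrow> of_real S) (at_right 0)"
  unfolding tendsto_at_iff_sequentially comp_def
proof (intro allI impI)
  fix X :: "nat \<Rightarrow> real" assume X0: "\<forall>i. X i \<in> {0<..} - {0}" and X2: "X \<longlonglongrightarrow> 0"
  have X1: "X i > 0" for i using X0 by auto
  have [measurable]: "f \<in> borel_measurable borel" "g \<in> borel_measurable borel"
    using f g by (auto simp: sq_integrable_def)
  have gi: "integrable lborel (\<lambda>x. (cmod (g x))\<^sup>2)" using g by (auto simp: sq_integrable_def)
  let ?N = "\<lambda>r. LINT z|(lborel \<Otimes>\<^sub>M lborel). rihaczek f g r z"
  let ?b = "\<lambda>r x. exp (- pi * r * (norm (x::'a))\<^sup>2)"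
  let ?D = "\<lambda>r. LINT x|lborel. (cmod (of_real (?b r x) * f x - f x))\<^sup>2"
  \<comment> \<open>Replacing the convolution by \<open>h\<close> and then \<open>h\<close> by \<open>g\<close> costs a Cauchy-Schwarz error.\<close>
  have est: "cmod (?N r - of_real (LINT x|lborel. ?b r x * (cmod (g x))\<^sup>2)) \<le> sqrt S * sqrt (?D r)" if r: "r > 0" for r
  proof -
    obtain h where h: "sq_integrable h" "fourier_link (\<lambda>x. cnj (h x)) (\<lambda>x. cnj (of_real (?b r x) * f x))"
       "(LINT x|lborel. (cmod (h x - g x))\<^sup>2) = ?D r" using H[OF r] by blast
    have [measurable]: "h \<in> borel_measurable borel" using h by (auto simp: sq_integrable_def)
    have bg: "sq_integrable (\<lambda>x. of_real (?b r x) * cnj (g x))"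
      by (rule sq_integrable_bound[OF g]) (use r in \<open>auto simp: norm_mult mult_left_le_one_le\<close>)
    have hg: "integrable lborel (\<lambda>x. (cmod (h x - g x))\<^sup>2)"
      using integrable_square_of_add[of h lborel "\<lambda>x. - g x"] h g by (simp add: sq_integrable_def)
    have hgsq: "sq_integrable (\<lambda>x. h x - g x)" unfolding sq_integrable_def using hg by simp
    have "?N r = (LINT \<xi>|lborel. (of_real (?b r \<xi>) * cnj (g \<xi>)) * gconv r g \<xi>)"
      by (rule rihaczek_integral[OF f g r l])
    also have "\<dots> = (LINT \<xi>|lborel. (of_real (?b r \<xi>) * cnj (g \<xi>)) * h \<xi>)"
      by (rule integral_cong_AE) (use link_eq_gconv[OF f g h(1) r l h(2)] in auto)
    finally have N: "?N r = (LINT \<xi>|lborel. (of_real (?b r \<xi>) * cnj (g \<xi>)) * h \<xi>)" .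
    have bgg: "of_real (LINT x|lborel. ?b r x * (cmod (g x))\<^sup>2) = (LINT \<xi>|lborel. (of_real (?b r \<xi>) * cnj (g \<xi>)) * g \<xi>)"
      unfolding integral_complex_of_real[symmetric]
      by (intro Bochner_Integration.integral_cong refl) (simp add: mult.assoc complex_norm_square[symmetric] mult.commute[of "cnj _"] del: of_real_power)
    have "?N r - of_real (LINT x|lborel. ?b r x * (cmod (g x))\<^sup>2) = (LINT \<xi>|lborel. (of_real (?b r \<xi>) * cnj (g \<xi>)) * (h \<xi> - g \<xi>))"
      unfolding N bgg right_diff_distrib
      by (rule Bochner_Integration.integral_diff[symmetric]) (intro integrable_mult_sq_integrable bg h(1) g)+
    then have "cmod (?N r - of_real (LINT x|lborel. ?b r x * (cmod (g x))\<^sup>2))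
       \<le> sqrt (LINT x|lborel. (cmod (of_real (?b r x) * cnj (g x)))\<^sup>2) * sqrt (LINT x|lborel. (cmod (h x - g x))\<^sup>2)"
      using cauchy_schwarz_integral[of "\<lambda>x. of_real (?b r x) * cnj (g x)" lborel "\<lambda>x. h x - g x"] bg hg by (simp add: sq_integrable_def)
    also have "\<dots> \<le> sqrt S * sqrt (?D r)"
      unfolding h(3) S[symmetric]
    proof (intro mult_right_mono real_sqrt_le_mono integral_mono gi)
      show "integrable lborel (\<lambda>x. (cmod (of_real (?b r x) * cnj (g x)))\<^sup>2)" using bg by (simp add: sq_integrable_def)
      show "(cmod (of_real (?b r x) * cnj (g x)))\<^sup>2 \<le> (cmod (g x))\<^sup>2" for x
        using r by (intro power_mono) (auto simp: norm_mult mult_left_le_one_le)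
    qed simp
    finally show ?thesis .
  qed
  have D0: "(\<lambda>i. sqrt S * sqrt (?D (X i))) \<longlonglongrightarrow> 0"
  proof -
    have "(\<lambda>i. sqrt S * sqrt (?D (X i))) \<longlonglongrightarrow> sqrt S * sqrt 0"
      by (intro tendsto_intros gaussian_cutoff_tendsto(1)[OF f X1 X2])
    then show ?thesis by simp
  qed
  have "(\<lambda>i. ?N (X i) - of_real (LINT x|lborel. ?b (X i) x * (cmod (g x))\<^sup>2)) \<longlonglongrightarrow> 0"
    by (rule Lim_null_comparison[OF _ D0]) (use est X1 in auto)
  moreover have "(\<lambda>i. of_real (LINT x|lborel. ?b (X i) x * (cmod (g x))\<^sup>2) :: complex) \<longlonglongrightarrow> of_real S"
    using tendsto_of_real[OF gaussian_cutoff_tendsto(2)[OF g X1 X2]] S by simp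
  ultimately have "(\<lambda>i. (?N (X i) - of_real (LINT x|lborel. ?b (X i) x * (cmod (g x))\<^sup>2)) + of_real (LINT x|lborel. ?b (X i) x * (cmod (g x))\<^sup>2)) \<longlonglongrightarrow> 0 + of_real S"
    by (rule tendsto_add)
  then show "(\<lambda>i. ?N (X i)) \<longlonglongrightarrow> of_real S" by simp
qed

section \<open>Square-integrable functions and unitary groups\<close>

lemma L2_measurable [measurable_dest]: "f \<in> L2 \<Longrightarrow> f \<in> borel_measurable lebesgue"
  by (simp add: L2_def)

lemma L2_integrable_sq: "f \<in> L2 \<Longrightarrow> integrable lebesgue (\<lambda>x. (cmod (f x))\<^sup>2)"
  by (simp add: L2_def)

lemma L2_I: "f \<in> borel_measurable lebesgue \<Longrightarrow> integrable lebesgue (\<lambda>x. (cmod (f x))\<^sup>2) \<Longrightarrow> f \<in> L2"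
  by (simp add: L2_def)

lemma L2_bound:
  assumes "f \<in> L2" and [measurable]: "g \<in> borel_measurable lebesgue" and "\<And>x. cmod (g x) \<le> C * cmod (f x)"
  shows "g \<in> L2"
proof (rule L2_I)
  show "integrable lebesgue (\<lambda>x. (cmod (g x))\<^sup>2)"
  proof (rule Bochner_Integration.integrable_bound)
    show "integrable lebesgue (\<lambda>x. C\<^sup>2 * (cmod (f x))\<^sup>2)"
      by (intro integrable_mult_right L2_integrable_sq assms(1))
    show "AE x in lebesgue. norm ((cmod (g x))\<^sup>2) \<le> norm (C\<^sup>2 * (cmod (f x))\<^sup>2)"
      using power_mono[OF assms(3), of _ 2] by (intro AE_I2) (simp add: power_mult_distrib)
  qed measurable
qed fact

lemma L2_scale: "f \<in> L2 \<Longrightarrow> (\<lambda>x. c * f x) \<in> L2"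
  by (rule L2_bound[of f _ "cmod c"]) (auto simp: norm_mult)

lemma L2_add: "f \<in> L2 \<Longrightarrow> g \<in> L2 \<Longrightarrow> (\<lambda>x. f x + g x) \<in> L2"
  unfolding L2_def by (auto intro!: integrable_square_of_add)

lemma L2_diff:
  assumes f: "f \<in> L2" and g: "g \<in> L2"
  shows "(\<lambda>x. f x - g x) \<in> L2"
  using L2_add[OF f L2_scale[OF g, of "-1"]] by simp

lemma L2_divide: "f \<in> L2 \<Longrightarrow> (\<lambda>x. f x / c) \<in> L2"
  using L2_scale[of f "inverse c"] by (simp add: divide_inverse mult.commute)

lemma L2_inner_integrable: "f \<in> L2 \<Longrightarrow> g \<in> L2 \<Longrightarrow> integrable lebesgue (\<lambda>x. f x * cnj (g x))"
  unfolding L2_def by (auto intro!: integrable_mult_of_squares borel_measurable_cnj')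

lemma L2_inner_cauchy_schwarz:
  assumes f: "f \<in> L2" and g: "g \<in> L2"
  shows "cmod (L2_inner f g) \<le> L2_norm f * L2_norm g"
  unfolding L2_inner_def L2_norm_def
  using cauchy_schwarz_integral[of f lebesgue "\<lambda>x. cnj (g x)"] f g L2_integrable_sq[OF f] L2_integrable_sq[OF g]
  by (simp add: L2_def borel_measurable_cnj')

lemma L2_inner_diff_left:
  assumes "f \<in> L2" "g \<in> L2" "k \<in> L2"
  shows "L2_inner (\<lambda>x. f x - g x) k = L2_inner f k - L2_inner g k"
  unfolding L2_inner_def left_diff_distrib
  by (intro Bochner_Integration.integral_diff L2_inner_integrable assms)

lemma L2_inner_diff_right:
  assumes "f \<in> L2" "g \<in> L2" "k \<in> L2"
  shows "L2_inner k (\<lambda>x. f x - g x) = L2_inner k f - L2_inner k g"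
  unfolding L2_inner_def complex_cnj_diff right_diff_distrib
  by (intro Bochner_Integration.integral_diff L2_inner_integrable assms)

lemma L2_inner_scale_left: "L2_inner (\<lambda>x. c * f x) k = c * L2_inner f k"
  unfolding L2_inner_def by (simp add: mult.assoc)

lemma L2_inner_divide_left: "L2_inner (\<lambda>x. f x / c) k = L2_inner f k / c"
  using L2_inner_scale_left[of "inverse c" f k] by (simp add: divide_inverse mult.commute)

lemma L2_inner_self: "L2_inner f f = of_real ((L2_norm f)\<^sup>2)"
proof -
  have "L2_inner f f = (LINT x|lebesgue. of_real ((cmod (f x))\<^sup>2))"
    unfolding L2_inner_def by (intro Bochner_Integration.integral_cong refl) (simp only: complex_norm_square)
  also have "\<dots> = of_real (LINT x|lebesgue. (cmod (f x))\<^sup>2)" by (rule integral_complex_of_real)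
  also have "(LINT x|lebesgue. (cmod (f x))\<^sup>2) = (L2_norm f)\<^sup>2" by (simp add: L2_norm_def)
  finally show ?thesis .
qed

lemma L2_norm_nonneg [simp]: "0 \<le> L2_norm f"
  by (simp add: L2_norm_def)

lemma L2_norm_sq: "(L2_norm f)\<^sup>2 = (LINT x|lebesgue. (cmod (f x))\<^sup>2)"
  by (simp add: L2_norm_def)

lemma L2_inner_cong:
  assumes "L2_eq f f'" "L2_eq g g'" "f \<in> L2" "f' \<in> L2" "g \<in> L2" "g' \<in> L2"
  shows "L2_inner f g = L2_inner f' g'"
  unfolding L2_inner_def
proof (rule integral_cong_AE)
  have [measurable]: "f \<in> borel_measurable lebesgue" "g \<in> borel_measurable lebesgue"
    "f' \<in> borel_measurable lebesgue" "g' \<in> borel_measurable lebesgue" using assms by (auto simp: L2_def)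
  show "(\<lambda>x. f x * cnj (g x)) \<in> borel_measurable lebesgue" "(\<lambda>x. f' x * cnj (g' x)) \<in> borel_measurable lebesgue"
    by measurable
  show "AE x in lebesgue. f x * cnj (g x) = f' x * cnj (g' x)"
    using assms(1,2) unfolding L2_eq_def by eventually_elim simp
qed

lemma L2_eq_refl [simp]: "L2_eq f f"
  by (simp add: L2_eq_def)

lemma L2_eq_sym: "L2_eq f g \<Longrightarrow> L2_eq g f"
  unfolding L2_eq_def by (auto elim: eventually_mono)

lemma L2_eq_trans: "L2_eq f g \<Longrightarrow> L2_eq g h \<Longrightarrow> L2_eq f h"
  unfolding L2_eq_def by (auto elim: eventually_elim2)

lemma L2_norm_cong:
  assumes "L2_eq f g" "f \<in> L2" "g \<in> L2"
  shows "L2_norm f = L2_norm g"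
proof -
  have "complex_of_real ((L2_norm f)\<^sup>2) = of_real ((L2_norm g)\<^sup>2)"
    unfolding L2_inner_self[symmetric] by (rule L2_inner_cong[OF assms(1) assms(1) assms(2,3) assms(2,3)])
  then have "(L2_norm f)\<^sup>2 = (L2_norm g)\<^sup>2" by (simp only: of_real_eq_iff)
  then show ?thesis by (simp add: power2_eq_iff_nonneg)
qed

lemma L2_norm_eq_0:
  assumes f: "f \<in> L2" and "L2_norm f = 0"
  shows "AE x in lebesgue. f x = 0"
proof -
  have "(LINT x|lebesgue. (cmod (f x))\<^sup>2) = 0" using assms(2) by (simp add: L2_norm_sq[symmetric])
  then have "AE x in lebesgue. (cmod (f x))\<^sup>2 = 0"
    using integral_nonneg_eq_0_iff_AE[OF L2_integrable_sq[OF f]] by simp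
  then show ?thesis by eventually_elim simp
qed

context
  fixes U :: "real \<Rightarrow> (real^'d::finite \<Rightarrow> complex) \<Rightarrow> (real^'d \<Rightarrow> complex)"
  assumes U: "L2_unitary_group U"
begin

lemma group_L2: "f \<in> L2 \<Longrightarrow> U t f \<in> L2"
  using U unfolding L2_unitary_group_def L2_unitary_def by blast

lemma group_linear: "f \<in> L2 \<Longrightarrow> g \<in> L2 \<Longrightarrow> L2_eq (U t (\<lambda>x. a * f x + b * g x)) (\<lambda>x. a * U t f x + b * U t g x)"
  using U unfolding L2_unitary_group_def L2_unitary_def by blast

lemma group_inner: "f \<in> L2 \<Longrightarrow> g \<in> L2 \<Longrightarrow> L2_inner (U t f) (U t g) = L2_inner f g"
  using U unfolding L2_unitary_group_def L2_unitary_def by blast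

lemma group_surj: "g \<in> L2 \<Longrightarrow> \<exists>f\<in>L2. L2_eq (U t f) g"
  using U unfolding L2_unitary_group_def L2_unitary_def by blast

lemma group_0: "f \<in> L2 \<Longrightarrow> L2_eq (U 0 f) f"
  using U unfolding L2_unitary_group_def by blast

lemma group_add: "f \<in> L2 \<Longrightarrow> L2_eq (U (s + t) f) (U s (U t f))"
  using U unfolding L2_unitary_group_def by blast

lemma group_continuous: "f \<in> L2 \<Longrightarrow> ((\<lambda>t. L2_norm (\<lambda>x. U t f x - f x)) \<longlongrightarrow> 0) (at 0)"
  using U unfolding L2_unitary_group_def by blast

lemma group_norm: "f \<in> L2 \<Longrightarrow> L2_norm (U t f) = L2_norm f"
proof -
  assume f: "f \<in> L2"
  have "complex_of_real ((L2_norm (U t f))\<^sup>2) = of_real ((L2_norm f)\<^sup>2)"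
    unfolding L2_inner_self[symmetric] by (rule group_inner[OF f f])
  then have "(L2_norm (U t f))\<^sup>2 = (L2_norm f)\<^sup>2" by (simp only: of_real_eq_iff)
  then show ?thesis by (simp add: power2_eq_iff_nonneg)
qed

lemma group_norm_diff:
  assumes f: "f \<in> L2" and g: "g \<in> L2"
  shows "L2_norm (\<lambda>x. U t f x - U t g x) = L2_norm (\<lambda>x. f x - g x)"
proof -
  have "L2_eq (U t (\<lambda>x. 1 * f x + (- 1) * g x)) (\<lambda>x. 1 * U t f x + (- 1) * U t g x)" by (rule group_linear[OF f g])
  then have e: "L2_eq (U t (\<lambda>x. f x - g x)) (\<lambda>x. U t f x - U t g x)" by simp
  have "L2_norm (\<lambda>x. U t f x - U t g x) = L2_norm (U t (\<lambda>x. f x - g x))"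
    by (rule L2_norm_cong[OF L2_eq_sym[OF e]]) (intro L2_diff group_L2 f g)+
  also have "\<dots> = L2_norm (\<lambda>x. f x - g x)" by (intro group_norm L2_diff f g)
  finally show ?thesis .
qed

lemma group_continuous_at:
  assumes f: "f \<in> L2"
  shows "((\<lambda>h. L2_norm (\<lambda>x. U (t + h) f x - U t f x)) \<longlongrightarrow> 0) (at 0)"
proof -
  have "L2_norm (\<lambda>x. U (t + h) f x - U t f x) = L2_norm (\<lambda>x. U h (U t f) x - U t f x)" for h
  proof (rule L2_norm_cong)
    have "L2_eq (U (h + t) f) (U h (U t f))" by (rule group_add[OF f])
    then show "L2_eq (\<lambda>x. U (t + h) f x - U t f x) (\<lambda>x. U h (U t f) x - U t f x)"
      unfolding L2_eq_def add.commute[of h t] by eventually_elim simp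
  qed (intro L2_diff group_L2 f)+
  then show ?thesis using group_continuous[OF group_L2[OF f, of t]] by simp
qed

lemma group_adjoint:
  assumes f: "f \<in> L2" and g: "g \<in> L2"
  shows "L2_inner g (U h f) = L2_inner (U (- h) g) f"
proof -
  have "L2_inner (U (- h) g) f = L2_inner (U h (U (- h) g)) (U h f)" by (intro group_inner[symmetric] group_L2 f g)
  also have "\<dots> = L2_inner g (U h f)"
  proof (rule L2_inner_cong)
    have "L2_eq (U (h + - h) g) (U h (U (- h) g))" by (rule group_add[OF g])
    then have "L2_eq (U 0 g) (U h (U (- h) g))" by simp
    then show "L2_eq (U h (U (- h) g)) g" using group_0[OF g] by (blast intro: L2_eq_sym L2_eq_trans)
  qed (auto intro: group_L2 f g)
  finally show ?thesis ..
qed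

text \<open>
  A curve that is differentiable in \<open>L\<^sup>2\<close> and solves the evolution equation is the orbit of its
  initial value: for every \<open>f\<close> the inner product of \<open>\<psi>(t)\<close> and \<open>U(t) f\<close> has derivative zero.
\<close>

lemma evolution_unique:
  fixes \<psi> v :: "real \<Rightarrow> real^'d \<Rightarrow> complex"
  assumes \<psi>: "\<And>t. \<psi> t \<in> L2" and gen: "\<And>t. L2_generator U (\<psi> t) (v t)"
    and deriv: "\<And>t. ((\<lambda>h. L2_norm (\<lambda>x. (\<psi> (t + h) x - \<psi> t x) / of_real h - v t x)) \<longlongrightarrow> 0) (at 0)"
  shows "L2_eq (U t (\<psi> 0)) (\<psi> t)"
proof -
  have v: "v t \<in> L2" for t using gen by (simp add: L2_generator_def)
  have const: "L2_inner (\<psi> t) (U t f) = L2_inner (\<psi> 0) (U 0 f)" if f: "f \<in> L2" for f t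
  proof -
    define D where "D t = L2_inner (\<psi> t) (U t f)" for t
    have "(D has_vector_derivative 0) (at t)" for t
    proof -
      \<comment> \<open>The three errors: the derivative of \<open>\<psi>\<close>, the generator applied to \<open>\<psi> t\<close>, and strong continuity.\<close>
      let ?r1 = "\<lambda>h. L2_norm (\<lambda>x. (\<psi> (t + h) x - \<psi> t x) / of_real h - v t x)"
      let ?r2 = "\<lambda>h. L2_norm (\<lambda>x. (U h (\<psi> t) x - \<psi> t x) / of_real h - v t x)"
      let ?r3 = "\<lambda>h. L2_norm (\<lambda>x. U (t + h) f x - U t f x)"
      have r1: "(?r1 \<longlongrightarrow> 0) (at 0)" by (rule deriv)
      have r2: "(?r2 \<longlongrightarrow> 0) (at 0)" using gen[of t] by (simp add: L2_generator_def)
      have r2': "((\<lambda>h. ?r2 (- h)) \<longlongrightarrow> 0) (at 0)"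
      proof (rule filterlim_compose[OF r2])
        have "(uminus \<longlongrightarrow> (0::real)) (at 0)" using tendsto_minus[OF tendsto_ident_at, of "0::real" UNIV] by simp
        then show "filterlim uminus (at (0::real)) (at 0)" by (simp add: filterlim_at eventually_at_filter)
      qed
      have r3: "(?r3 \<longlongrightarrow> 0) (at 0)" by (rule group_continuous_at[OF f])
      have bound: "cmod ((D (t + h) - D t) / of_real h) \<le> ?r1 h * L2_norm f + L2_norm (v t) * ?r3 h + ?r2 (- h) * L2_norm f"
        if h: "h \<noteq> 0" for h
      proof -
        let ?R1 = "\<lambda>x. (\<psi> (t + h) x - \<psi> t x) / of_real h - v t x"
        let ?R2 = "\<lambda>x. (U (- h) (\<psi> t) x - \<psi> t x) / of_real (- h) - v t x"
        note mem = \<psi> v f group_L2 L2_diff L2_divide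
        have R: "?R1 \<in> L2" "?R2 \<in> L2" by (intro mem)+
        have i1: "L2_inner ?R1 (U (t + h) f) = (L2_inner (\<psi> (t + h)) (U (t + h) f) - L2_inner (\<psi> t) (U (t + h) f)) / of_real h - L2_inner (v t) (U (t + h) f)"
          by (simp only: L2_inner_diff_left[OF L2_divide[OF L2_diff[OF \<psi> \<psi>]] v group_L2[OF f]] L2_inner_divide_left
            L2_inner_diff_left[OF \<psi> \<psi> group_L2[OF f]])
        have i2: "L2_inner ?R2 (U t f) = (L2_inner (U (- h) (\<psi> t)) (U t f) - L2_inner (\<psi> t) (U t f)) / of_real (- h) - L2_inner (v t) (U t f)"
          by (simp only: L2_inner_diff_left[OF L2_divide[OF L2_diff[OF group_L2[OF \<psi>] \<psi>]] v group_L2[OF f]] L2_inner_divide_left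
            L2_inner_diff_left[OF group_L2[OF \<psi>] \<psi> group_L2[OF f]])
        have i3: "L2_inner (v t) (\<lambda>x. U (t + h) f x - U t f x) = L2_inner (v t) (U (t + h) f) - L2_inner (v t) (U t f)"
          by (rule L2_inner_diff_right) (intro mem)+
        have adj: "L2_inner (U (- h) (\<psi> t)) (U t f) = L2_inner (\<psi> t) (U (t + h) f)"
        proof -
          have "L2_inner (U (- h) (\<psi> t)) (U t f) = L2_inner (\<psi> t) (U h (U t f))"
            by (rule group_adjoint[symmetric]) (intro mem)+
          also have "\<dots> = L2_inner (\<psi> t) (U (t + h) f)"
          proof (rule L2_inner_cong)
            show "L2_eq (U h (U t f)) (U (t + h) f)" using L2_eq_sym[OF group_add[OF f, of h t]] by (simp add: add.commute)
          qed (auto intro: mem)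
          finally show ?thesis .
        qed
        have "(D (t + h) - D t) / of_real h = L2_inner ?R1 (U (t + h) f) + L2_inner (v t) (\<lambda>x. U (t + h) f x - U t f x) - L2_inner ?R2 (U t f)"
          unfolding i1 i2 i3 adj D_def using h by (simp add: field_simps)
        moreover have "cmod (a + b - c) \<le> cmod a + cmod b + cmod c" for a b c :: complex
          using norm_triangle_ineq4[of "a + b" c] norm_triangle_ineq[of a b] by linarith
        ultimately have "cmod ((D (t + h) - D t) / of_real h) \<le> cmod (L2_inner ?R1 (U (t + h) f)) + cmod (L2_inner (v t) (\<lambda>x. U (t + h) f x - U t f x)) + cmod (L2_inner ?R2 (U t f))"
          by (simp only:)
        also have "\<dots> \<le> L2_norm ?R1 * L2_norm (U (t + h) f) + L2_norm (v t) * ?r3 h + L2_norm ?R2 * L2_norm (U t f)"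
          by (intro add_mono L2_inner_cauchy_schwarz R) (intro mem)+
        finally show ?thesis using f by (simp add: group_norm)
      qed
      have "((\<lambda>h. ?r1 h * L2_norm f + L2_norm (v t) * ?r3 h + ?r2 (- h) * L2_norm f) \<longlongrightarrow> 0 * L2_norm f + L2_norm (v t) * 0 + 0 * L2_norm f) (at 0)"
        by (intro tendsto_intros r1 r2' r3)
      then have lim: "((\<lambda>h. ?r1 h * L2_norm f + L2_norm (v t) * ?r3 h + ?r2 (- h) * L2_norm f) \<longlongrightarrow> 0) (at 0)" by simp
      have "((\<lambda>h. (D (t + h) - D t) / of_real h) \<longlongrightarrow> 0) (at 0)"
        by (rule Lim_null_comparison[OF _ lim]) (use bound in \<open>auto simp: eventually_at_filter\<close>)
      then have "((\<lambda>h. norm ((D (t + h) - D t) / of_real h)) \<longlongrightarrow> 0) (at 0)" by (rule tendsto_norm_zero)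
      then show ?thesis by (simp add: has_vector_derivative_def has_derivative_at norm_divide)
    qed
    then have "D t = D 0"
      using has_vector_derivative_zero_constant[of UNIV D] by (metis UNIV_I convex_UNIV)
    then show ?thesis by (simp add: D_def)
  qed
  \<comment> \<open>By surjectivity of \<open>U t\<close> the difference may itself be used as \<open>U t f\<close>.\<close>
  let ?k = "\<lambda>x. \<psi> t x - U t (\<psi> 0) x"
  have k: "?k \<in> L2" by (intro L2_diff \<psi> group_L2)
  obtain f where f: "f \<in> L2" "L2_eq (U t f) ?k" using group_surj[OF k] by blast
  have "L2_inner ?k ?k = L2_inner ?k (U t f)"
    by (rule L2_inner_cong[OF L2_eq_refl L2_eq_sym[OF f(2)] k k k group_L2[OF f(1)]])
  also have "\<dots> = L2_inner (\<psi> t) (U t f) - L2_inner (U t (\<psi> 0)) (U t f)"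
    by (intro L2_inner_diff_left \<psi> group_L2 f(1))
  also have "L2_inner (\<psi> t) (U t f) = L2_inner (\<psi> 0) f"
    using const[OF f(1), of t] L2_inner_cong[OF L2_eq_refl group_0[OF f(1)] \<psi> \<psi> group_L2[OF f(1)] f(1)] by simp
  also have "L2_inner (U t (\<psi> 0)) (U t f) = L2_inner (\<psi> 0) f" by (rule group_inner[OF \<psi> f(1)])
  finally have "L2_norm ?k = 0" unfolding L2_inner_self by simp
  from L2_norm_eq_0[OF k this] show ?thesis unfolding L2_eq_def by eventually_elim simp
qed

end

section \<open>Integration by parts against test functions\<close>

lemma test_function_continuous: "\<phi> \<in> test_functions \<Longrightarrow> continuous_on UNIV \<phi>"
  unfolding test_functions_def using Ck.simps(1) by blast

lemma test_function_derivative: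
  assumes "\<phi> \<in> test_functions"
  shows "((\<lambda>h. \<phi> (x + h *\<^sub>R axis i 1)) has_vector_derivative partial_derivative i \<phi> x) (at 0)"
proof -
  have "Ck (Suc 0) \<phi>" using assms unfolding test_functions_def by blast
  then have "(\<lambda>h. \<phi> (x + h *\<^sub>R axis i 1)) differentiable (at 0)" by simp
  then show ?thesis unfolding partial_derivative_def by (simp add: vector_derivative_works)
qed

lemma test_function_partial:
  assumes \<phi>: "\<phi> \<in> test_functions"
  shows "partial_derivative i \<phi> \<in> test_functions"
proof -
  let ?S = "closure {x. \<phi> x \<noteq> 0}"
  have c: "Ck k (partial_derivative i \<phi>)" for k
  proof -
    have "Ck (Suc k) \<phi>" using \<phi> unfolding test_functions_def by blast
    then show ?thesis by simp
  qed
  have "partial_derivative i \<phi> x = 0" if nx: "x \<notin> ?S" for x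
  proof -
    obtain e where e: "e > 0" "ball x e \<subseteq> - ?S"
      using open_contains_ball[of "- ?S"] nx by auto
    have z: "\<phi> y = 0" if "y \<in> ball x e" for y
    proof (rule ccontr)
      assume "\<phi> y \<noteq> 0"
      then have "y \<in> ?S" by (intro closure_subset[THEN subsetD]) simp
      then show False using e(2) that by blast
    qed
    have "((\<lambda>h::real. 0) has_vector_derivative partial_derivative i \<phi> x) (at 0)"
    proof (rule has_vector_derivative_transform_within[OF test_function_derivative[OF \<phi>] e(1)])
      fix h :: real assume "dist h 0 < e"
      then have "x + h *\<^sub>R axis i 1 \<in> ball x e" by (simp add: dist_norm)
      then show "\<phi> (x + h *\<^sub>R axis i 1) = 0" by (rule z)
    qed simp
    then show ?thesis using vector_derivative_unique_at[OF _ has_vector_derivative_const] by blast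
  qed
  then have "{x. partial_derivative i \<phi> x \<noteq> 0} \<subseteq> ?S" by blast
  then have "closure {x. partial_derivative i \<phi> x \<noteq> 0} \<subseteq> ?S" by (rule closure_minimal) simp
  moreover have "compact ?S" using \<phi> by (simp add: test_functions_def)
  ultimately have "compact (closure {x. partial_derivative i \<phi> x \<noteq> 0})"
    using closed_Int_compact[OF closed_closure] by (metis Int_absorb2)
  then show ?thesis using c by (simp add: test_functions_def)
qed

lemma integrable_continuous_compact_support:
  fixes W :: "'a::euclidean_space \<Rightarrow> complex"
  assumes c: "continuous_on UNIV W" and K: "compact K" "\<And>x. x \<notin> K \<Longrightarrow> W x = 0"
  shows "integrable lborel W"
proof -
  have "integrable lborel (\<lambda>x. indicator K x *\<^sub>R W x)"
    by (rule borel_integrable_compact[OF K(1)]) (rule continuous_on_subset[OF c subset_UNIV])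
  moreover have "(\<lambda>x. indicator K x *\<^sub>R W x) = W" using K(2) by (auto simp: indicator_def)
  ultimately show ?thesis by simp
qed

lemma integral_translate:
  fixes F :: "'a::euclidean_space \<Rightarrow> complex"
  assumes [measurable]: "F \<in> borel_measurable borel"
  shows "(LINT x|lborel. F (x + a)) = (LINT x|lborel. F x)"
proof -
  have "(LINT x|lborel. F x) = (LINT x|distr lborel borel ((+) a). F x)" by (simp add: lborel_distr_plus)
  also have "\<dots> = (LINT x|lborel. F (a + x))" by (rule integral_distr) auto
  finally show ?thesis by (simp add: add.commute)
qed

text \<open>
  The derivative of a compactly supported function in a direction \<open>e\<close> has integral zero.  Instead of
  iterating integrals along the coordinates, the proof differentiates the translation-invariant
  integral of \<open>F(x + h e)\<close> at \<open>h = 0\<close>.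
\<close>

lemma integral_directional_derivative_0:
  fixes F W :: "'a::euclidean_space \<Rightarrow> complex"
  assumes F: "continuous_on UNIV F" and W: "continuous_on UNIV W"
    and d: "\<And>x. ((\<lambda>h. F (x + h *\<^sub>R e)) has_vector_derivative W x) (at 0)"
    and K: "compact K" "\<And>x. x \<notin> K \<Longrightarrow> F x = 0" "\<And>x. x \<notin> K \<Longrightarrow> W x = 0"
  shows "(LINT x|lborel. W x) = 0"
proof -
  have [measurable]: "F \<in> borel_measurable borel" "W \<in> borel_measurable borel"
    using F W by (auto intro: borel_measurable_continuous_onI)
  have d': "((\<lambda>h. F (x + h *\<^sub>R e)) has_vector_derivative W (x + s *\<^sub>R e)) (at s within S)" for x s S
  proof -
    have "((\<lambda>h. F ((x + s *\<^sub>R e) + h *\<^sub>R e)) \<circ> (\<lambda>u. u - s) has_vector_derivative 1 *\<^sub>R W (x + s *\<^sub>R e)) (at s within S)"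
    proof (rule vector_diff_chain_within)
      show "((\<lambda>u. u - s) has_vector_derivative 1) (at s within S)" by (auto intro!: derivative_eq_intros)
      show "((\<lambda>h. F ((x + s *\<^sub>R e) + h *\<^sub>R e)) has_vector_derivative W (x + s *\<^sub>R e)) (at (s - s) within (\<lambda>u. u - s) ` S)"
        using d[of "x + s *\<^sub>R e"] by (auto intro: has_vector_derivative_at_within)
    qed
    moreover have "(\<lambda>h. F ((x + s *\<^sub>R e) + h *\<^sub>R e)) \<circ> (\<lambda>u. u - s) = (\<lambda>h. F (x + h *\<^sub>R e))"
      by (auto simp: algebra_simps)
    ultimately show ?thesis by simp
  qed
  obtain B where B: "\<And>x. cmod (W x) \<le> B" "B \<ge> 0"
  proof -
    have "bounded (W ` K)" by (intro compact_imp_bounded compact_continuous_image continuous_on_subset[OF W] K(1)) simp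
    then obtain B where "\<And>x. x \<in> K \<Longrightarrow> cmod (W x) \<le> B" by (auto simp: bounded_iff)
    then have "cmod (W x) \<le> max B 0" for x using K(3)[of x] by (cases "x \<in> K") (auto simp: le_max_iff_disj)
    then show ?thesis by (intro that[of "max B 0"]) auto
  qed
  obtain R where R: "\<And>x. x \<in> K \<Longrightarrow> norm x \<le> R" using compact_imp_bounded[OF K(1)] by (auto simp: bounded_iff)
  let ?h = "\<lambda>n. inverse (real (Suc n))"
  have h: "0 < ?h n" "?h n \<le> 1" for n by (auto simp: inverse_le_1_iff)
  let ?Q = "\<lambda>n x. (F (x + ?h n *\<^sub>R e) - F x) /\<^sub>R ?h n"
  \<comment> \<open>The difference quotients with step at most one vanish outside this ball.\<close>
  let ?K = "cball (0::'a) (R + norm e)"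
  have Fi: "integrable lborel F" by (rule integrable_continuous_compact_support[OF F K(1,2)])
  have Fai: "integrable lborel (\<lambda>x. F (x + a))" for a
  proof (rule integrable_continuous_compact_support)
    show "continuous_on UNIV (\<lambda>x. F (x + a))" by (intro continuous_on_compose2[OF F] continuous_intros) auto
    show "compact ((\<lambda>x. x - a) ` K)" by (intro compact_continuous_image continuous_intros K(1))
    show "F (x + a) = 0" if "x \<notin> (\<lambda>x. x - a) ` K" for x
    proof (rule K(2), rule notI)
      assume "x + a \<in> K"
      then have "(x + a) - a \<in> (\<lambda>x. x - a) ` K" by (rule imageI)
      then show False using that by simp
    qed
  qed
  have "(LINT x|lborel. ?Q n x) = 0" for n
  proof -
    have "(LINT x|lborel. ?Q n x) = ((LINT x|lborel. F (x + ?h n *\<^sub>R e)) - (LINT x|lborel. F x)) /\<^sub>R ?h n"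
      by (subst integral_scaleR_right) (simp add: Bochner_Integration.integral_diff[OF Fai Fi])
    also have "(LINT x|lborel. F (x + ?h n *\<^sub>R e)) = (LINT x|lborel. F x)" by (rule integral_translate) measurable
    finally show ?thesis by simp
  qed
  moreover have "(\<lambda>n. LINT x|lborel. ?Q n x) \<longlonglongrightarrow> (LINT x|lborel. W x)"
  proof (rule integral_dominated_convergence)
    show "integrable lborel (\<lambda>x. B * indicat_real ?K x)"
      by (intro integrable_mult_right integrable_real_indicator) (auto simp: emeasure_lborel_cball_finite[simplified])
    show "AE x in lborel. (\<lambda>n. ?Q n x) \<longlonglongrightarrow> W x"
    proof (intro AE_I2)
      fix x
      have "((\<lambda>h. norm (F (x + h *\<^sub>R e) - F x - h *\<^sub>R W x) / norm h) \<longlongrightarrow> 0) (at 0)"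
        using d[of x] by (simp add: has_vector_derivative_def has_derivative_at)
      moreover have "filterlim ?h (at 0) sequentially"
        unfolding filterlim_at using LIMSEQ_inverse_real_of_nat by auto
      ultimately have "(\<lambda>n. norm (F (x + ?h n *\<^sub>R e) - F x - ?h n *\<^sub>R W x) / norm (?h n)) \<longlonglongrightarrow> 0"
        by (rule filterlim_compose)
      moreover have "norm (F (x + ?h n *\<^sub>R e) - F x - ?h n *\<^sub>R W x) / norm (?h n) = norm (?Q n x - W x)" for n
      proof -
        have "?Q n x - W x = (F (x + ?h n *\<^sub>R e) - F x - ?h n *\<^sub>R W x) /\<^sub>R ?h n"
          using h(1)[of n] by (simp add: scaleR_diff_right del: of_nat_Suc)
        then show ?thesis by (simp add: divide_inverse mult.commute del: of_nat_Suc)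
      qed
      ultimately have "(\<lambda>n. norm (?Q n x - W x)) \<longlonglongrightarrow> 0" by simp
      then show "(\<lambda>n. ?Q n x) \<longlonglongrightarrow> W x" by (simp only: LIM_zero_cancel tendsto_norm_zero_iff)
    qed
    show "AE x in lborel. norm (?Q n x) \<le> B * indicator ?K x" for n
    proof (intro AE_I2)
      fix x
      show "norm (?Q n x) \<le> B * indicator ?K x"
      proof (cases "x \<in> ?K")
        case True
        have "((\<lambda>s. W (x + s *\<^sub>R e)) has_integral (F (x + ?h n *\<^sub>R e) - F (x + 0 *\<^sub>R e))) {0..?h n}"
          by (rule fundamental_theorem_of_calculus) (use h(1)[of n] d' in auto)
        then have "norm (F (x + ?h n *\<^sub>R e) - F (x + 0 *\<^sub>R e)) \<le> B * measure lborel (cbox 0 (?h n))"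
          using B by (intro has_integral_bound) (auto simp: cbox_interval)
        also have "measure lborel (cbox 0 (?h n)) = ?h n" using h(1)[of n] by (simp add: cbox_interval del: of_nat_Suc)
        finally have "norm (F (x + ?h n *\<^sub>R e) - F x) \<le> B * ?h n" by (simp del: of_nat_Suc)
        then have "inverse (?h n) * norm (F (x + ?h n *\<^sub>R e) - F x) \<le> inverse (?h n) * (B * ?h n)"
          by (rule mult_left_mono) (use h(1)[of n] in simp)
        also have "\<dots> = B" by simp
        finally have "norm (?Q n x) \<le> B" by (simp del: of_nat_Suc)
        then show ?thesis using True by simp
      next
        case False
        then have nx: "R + norm e < norm x" by simp
        have "norm x \<le> norm (x + ?h n *\<^sub>R e) + norm (?h n *\<^sub>R e)" using norm_triangle_ineq4[of "x + ?h n *\<^sub>R e" "?h n *\<^sub>R e"] by simp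
        moreover have "norm (?h n *\<^sub>R e) \<le> norm e" using h[of n] by (simp add: mult_left_le_one_le del: of_nat_Suc)
        ultimately have "x + ?h n *\<^sub>R e \<notin> K" using R[of "x + ?h n *\<^sub>R e"] nx by linarith
        moreover have "x \<notin> K" using R[of x] nx norm_ge_zero[of e] by linarith
        ultimately show ?thesis using K(2) False by simp
      qed
    qed
  qed measurable
  ultimately show ?thesis by (simp add: LIMSEQ_const_iff)
qed

lemma integration_by_parts_test:
  fixes u u' :: "real^'d::finite \<Rightarrow> complex"
  assumes u: "continuous_on UNIV u" and u': "continuous_on UNIV u'"
    and d: "\<And>x. ((\<lambda>h. u (x + h *\<^sub>R axis i 1)) has_vector_derivative u' x) (at 0)"
    and \<eta>: "\<eta> \<in> test_functions"
  shows "(LINT x|lborel. u x * partial_derivative i \<eta> x) = - (LINT x|lborel. u' x * \<eta> x)"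
proof -
  let ?K = "closure {x. \<eta> x \<noteq> 0}"
  have K: "compact ?K" using \<eta> by (simp add: test_functions_def)
  have z: "\<eta> x = 0" if "x \<notin> ?K" for x using that closure_subset[of "{x. \<eta> x \<noteq> 0}"] by blast
  let ?K' = "?K \<union> closure {x. partial_derivative i \<eta> x \<noteq> 0}"
  note t = test_function_partial[OF \<eta>, of i]
  have K': "compact ?K'" using K t by (auto simp: test_functions_def)
  have z': "\<eta> x = 0" "partial_derivative i \<eta> x = 0" if "x \<notin> ?K'" for x
    using that closure_subset[of "{x. \<eta> x \<noteq> 0}"] closure_subset[of "{x. partial_derivative i \<eta> x \<noteq> 0}"] by blast+
  note c = test_function_continuous[OF \<eta>] test_function_continuous[OF t]
  have cont: "continuous_on UNIV (\<lambda>x. u x * partial_derivative i \<eta> x)" "continuous_on UNIV (\<lambda>x. u' x * \<eta> x)"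
    "continuous_on UNIV (\<lambda>x. u x * \<eta> x)"
    by (rule continuous_on_mult[OF u c(2)] continuous_on_mult[OF u' c(1)] continuous_on_mult[OF u c(1)])+
  have zz: "u x * \<eta> x = 0" "u' x * \<eta> x = 0" "u x * partial_derivative i \<eta> x = 0" if "x \<notin> ?K'" for x
    using z'[OF that] by (simp_all only: mult_zero_right)
  have "(LINT x|lborel. u x * partial_derivative i \<eta> x + u' x * \<eta> x) = 0"
  proof (rule integral_directional_derivative_0[where F = "\<lambda>x. u x * \<eta> x" and e = "axis i 1" and K = ?K'])
    show "((\<lambda>h. u (x + h *\<^sub>R axis i 1) * \<eta> (x + h *\<^sub>R axis i 1)) has_vector_derivative u x * partial_derivative i \<eta> x + u' x * \<eta> x) (at 0)" for x
      using has_vector_derivative_mult[OF d[of x] test_function_derivative[OF \<eta>, of x i]] by simp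
    show "continuous_on UNIV (\<lambda>x. u x * partial_derivative i \<eta> x + u' x * \<eta> x)"
      by (rule continuous_on_add[OF cont(1,2)])
    show "u x * partial_derivative i \<eta> x + u' x * \<eta> x = 0" if "x \<notin> ?K'" for x
      by (simp only: zz[OF that] add_0)
  qed (rule cont(3) K' zz(1), assumption?)+
  moreover have "integrable lborel (\<lambda>x. u x * partial_derivative i \<eta> x)"
    by (rule integrable_continuous_compact_support[OF cont(1) K' zz(3)])
  moreover have "integrable lborel (\<lambda>x. u' x * \<eta> x)"
    by (rule integrable_continuous_compact_support[OF cont(2) K' zz(2)])
  ultimately show ?thesis by (simp add: eq_neg_iff_add_eq_0)
qed

lemma L2_laplacian_smooth:
  fixes u :: "real^'d::finite \<Rightarrow> complex" and u1 u2 :: "'d \<Rightarrow> real^'d \<Rightarrow> complex"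
  assumes u: "continuous_on UNIV u" and u1: "\<And>i. continuous_on UNIV (u1 i)" and u2: "\<And>i. continuous_on UNIV (u2 i)"
    and d1: "\<And>i x. ((\<lambda>h. u (x + h *\<^sub>R axis i 1)) has_vector_derivative u1 i x) (at 0)"
    and d2: "\<And>i x. ((\<lambda>h. u1 i (x + h *\<^sub>R axis i 1)) has_vector_derivative u2 i x) (at 0)"
    and L: "u \<in> L2" "(\<lambda>x. \<Sum>i\<in>UNIV. u2 i x) \<in> L2"
  shows "L2_laplacian u (\<lambda>x. \<Sum>i\<in>UNIV. u2 i x)"
  unfolding L2_laplacian_def
proof (intro conjI L ballI)
  fix \<phi> :: "real^'d \<Rightarrow> complex" assume \<phi>: "\<phi> \<in> test_functions"
  note t = test_function_partial[OF \<phi>]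
  note c = test_function_continuous[OF \<phi>] test_function_continuous[OF t] test_function_continuous[OF test_function_partial[OF t]]
  have supp: "integrable lborel (\<lambda>x. w x * \<eta> x)" if "continuous_on UNIV w" "\<eta> \<in> test_functions" for w \<eta> :: "real^'d \<Rightarrow> complex"
  proof (rule integrable_continuous_compact_support)
    show "continuous_on UNIV (\<lambda>x. w x * \<eta> x)" by (intro continuous_intros that test_function_continuous)
    show "compact (closure {x. \<eta> x \<noteq> 0})" using that by (simp add: test_functions_def)
    show "w x * \<eta> x = 0" if "x \<notin> closure {x. \<eta> x \<noteq> 0}" for x
      using that closure_subset[of "{x. \<eta> x \<noteq> 0}"] by auto
  qed
  have [measurable]: "u \<in> borel_measurable borel" "\<phi> \<in> borel_measurable borel" "\<And>i. u2 i \<in> borel_measurable borel"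
     "\<And>i. partial_derivative i (partial_derivative i \<phi>) \<in> borel_measurable borel"
    using u u2 c by (auto intro: borel_measurable_continuous_onI)
  have "(LINT x|lebesgue. u x * laplacian \<phi> x) = (LINT x|lborel. u x * laplacian \<phi> x)"
    unfolding laplacian_def by (rule integral_completion) measurable
  also have "\<dots> = (LINT x|lborel. (\<Sum>i\<in>UNIV. u x * partial_derivative i (partial_derivative i \<phi>) x))"
    unfolding laplacian_def sum_distrib_left ..
  also have "\<dots> = (\<Sum>i\<in>UNIV. LINT x|lborel. u x * partial_derivative i (partial_derivative i \<phi>) x)"
    by (intro Bochner_Integration.integral_sum supp u test_function_partial t)
  also have "\<dots> = (\<Sum>i\<in>UNIV. LINT x|lborel. u2 i x * \<phi> x)"
  proof (rule sum.cong[OF refl])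
    fix i
    have "(LINT x|lborel. u x * partial_derivative i (partial_derivative i \<phi>) x) = - (LINT x|lborel. u1 i x * partial_derivative i \<phi> x)"
      by (rule integration_by_parts_test[OF u u1 d1 t])
    also have "\<dots> = (LINT x|lborel. u2 i x * \<phi> x)"
      using integration_by_parts_test[OF u1 u2 d2 \<phi>] by simp
    finally show "(LINT x|lborel. u x * partial_derivative i (partial_derivative i \<phi>) x) = (LINT x|lborel. u2 i x * \<phi> x)" .
  qed
  also have "\<dots> = (LINT x|lborel. (\<Sum>i\<in>UNIV. u2 i x * \<phi> x))"
    by (intro Bochner_Integration.integral_sum[symmetric] supp u2 \<phi>)
  also have "\<dots> = (LINT x|lborel. (\<Sum>i\<in>UNIV. u2 i x) * \<phi> x)" by (simp only: sum_distrib_right)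
  also have "\<dots> = (LINT x|lebesgue. (\<Sum>i\<in>UNIV. u2 i x) * \<phi> x)"
    by (rule integral_completion[symmetric]) measurable
  finally show "(LINT x|lebesgue. u x * laplacian \<phi> x) = (LINT x|lebesgue. (\<Sum>i\<in>UNIV. u2 i x) * \<phi> x)" .
qed

section \<open>Free evolution of Gaussians\<close>

lemma sq_integrable_imp_L2:
  fixes f :: "real^'d::finite \<Rightarrow> complex"
  assumes f: "sq_integrable f"
  shows "f \<in> L2"
proof (rule L2_I)
  have [measurable]: "f \<in> borel_measurable borel" using f by (simp add: sq_integrable_def)
  show "f \<in> borel_measurable lebesgue" by (rule measurable_completion) simp
  have "integrable lborel (\<lambda>x. (cmod (f x))\<^sup>2)" using f by (simp add: sq_integrable_def)
  then show "integrable lebesgue (\<lambda>x. (cmod (f x))\<^sup>2)" by (subst integrable_completion) auto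
qed

lemma L2_norm_lborel:
  fixes f :: "real^'d::finite \<Rightarrow> complex"
  assumes [measurable]: "f \<in> borel_measurable borel"
  shows "(L2_norm f)\<^sup>2 = (LINT x|lborel. (cmod (f x))\<^sup>2)"
  unfolding L2_norm_sq by (rule integral_completion) measurable

text \<open>
  The free evolution of \<open>exp (\<lambda>\<cdot>x - |x|\<^sup>2/c)\<close>, \<open>Re c > 0\<close>, with \<open>\<mu> = c \<lambda>\<close>, stays within the class of complex
  Gaussians; \<open>c\<close> moves along the line \<open>c + 4it\<close>.
\<close>

definition gden :: "complex \<Rightarrow> real \<Rightarrow> complex" where
  "gden c t = c + 4 * \<i> * of_real t"

text \<open>
  The exponent at time \<open>t\<close>.  The difference of two logarithms in the right half-plane fixes the
  branch of \<open>((c + 4it)/c)\<^bsup>-d/2\<^esup>\<close>.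
\<close>

definition gphase :: "complex \<Rightarrow> complex^'d::finite \<Rightarrow> real \<Rightarrow> real^'d \<Rightarrow> complex" where
  "gphase c \<mu> t x = (\<Sum>i\<in>UNIV. (\<mu> $ i)\<^sup>2) * (1 / c - 1 / gden c t) / 4
     - of_nat CARD('d) / 2 * (Ln (gden c t) - Ln c)
     + (\<Sum>i\<in>UNIV. \<mu> $ i * of_real (x $ i)) / gden c t - of_real ((norm x)\<^sup>2) / gden c t"

text \<open>
  The Gaussian solution.
\<close>

definition gwave :: "complex \<Rightarrow> complex^'d::finite \<Rightarrow> real \<Rightarrow> real^'d \<Rightarrow> complex" where
  "gwave c \<mu> t x = exp (gphase c \<mu> t x)"

text \<open>
  The factor by which the Laplacian multiplies \<open>gwave\<close>, a quadratic polynomial in \<open>x\<close>.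
\<close>

definition gmult :: "complex \<Rightarrow> complex^'d::finite \<Rightarrow> real \<Rightarrow> real^'d \<Rightarrow> complex" where
  "gmult c \<mu> t x = (\<Sum>i\<in>UNIV. ((\<mu> $ i - 2 * of_real (x $ i)) / gden c t)\<^sup>2 - 2 / gden c t)"

lemma norm_sq_vec: "(norm (x :: real^'d::finite))\<^sup>2 = (\<Sum>i\<in>UNIV. (x $ i)\<^sup>2)"
  unfolding power2_norm_eq_inner inner_vec_def by (simp add: power2_eq_square)

lemma norm_sq_axis: "(norm (x + h *\<^sub>R axis i 1 :: real^'d::finite))\<^sup>2 = (norm x)\<^sup>2 + 2 * h * x $ i + h\<^sup>2"
proof -
  have "(norm (x + h *\<^sub>R axis i 1))\<^sup>2 = x \<bullet> x + 2 * h * (x \<bullet> axis i 1) + h\<^sup>2 * (axis i 1 \<bullet> axis i (1::real))"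
    unfolding power2_norm_eq_inner by (simp add: inner_add_left inner_add_right inner_commute power2_eq_square algebra_simps)
  then show ?thesis by (simp add: inner_axis power2_norm_eq_inner inner_axis_axis)
qed

lemma borel_measurable_gwave [measurable]: "gwave c \<mu> t \<in> borel_measurable borel"
  unfolding gwave_def[abs_def] gphase_def by measurable

lemma borel_measurable_gmult [measurable]: "gmult c \<mu> t \<in> borel_measurable borel"
  unfolding gmult_def[abs_def] by measurable

context
  fixes c :: complex and \<mu> :: "complex^'d::finite"
  assumes c: "Re c > 0"
begin

lemma Re_gden: "Re (gden c t) = Re c"
  by (simp add: gden_def)

lemma gden_nz [simp]: "gden c t \<noteq> 0"
  using Re_gden[of t] c by (metis less_irrefl zero_complex.sel(1))

lemma c_nz [simp]: "c \<noteq> 0"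
  using c by auto

lemma gden_lower: "Re c \<le> cmod (gden c t)"
  using Re_gden[of t] complex_Re_le_cmod[of "gden c t"] by simp

lemma gden_upper: "\<bar>t\<bar> \<le> T \<Longrightarrow> cmod (gden c t) \<le> cmod c + 4 * T"
  unfolding gden_def by (rule order_trans[OF norm_triangle_ineq]) (simp add: norm_mult)

lemma continuous_on_gwave: "continuous_on S (gwave c \<mu> t)"
  unfolding gwave_def[abs_def] gphase_def by (intro continuous_intros) auto

lemma gwave_time_derivative:
  "((\<lambda>t. gwave c \<mu> t x) has_vector_derivative \<i> * gmult c \<mu> t x * gwave c \<mu> t x) (at t within S)"
proof -
  \<comment> \<open>The exponent is holomorphic in a complex time \<open>z\<close>, which allows field derivatives.\<close>
  let ?q = "\<Sum>i\<in>UNIV. (\<mu> $ i)\<^sup>2"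
  let ?L = "\<Sum>i\<in>UNIV. \<mu> $ i * of_real (x $ i)"
  let ?n = "of_real ((norm x)\<^sup>2) :: complex"
  let ?d = "of_nat CARD('d) :: complex"
  define D where "D = gden c t"
  have D: "D \<noteq> 0" by (simp add: D_def)
  have Dz: "c + 4 * \<i> * of_real t = D" by (simp add: D_def gden_def)
  have npos: "D \<notin> \<real>\<^sub>\<le>\<^sub>0" using c by (auto simp: D_def Re_gden complex_nonpos_Reals_iff)
  let ?P = "\<lambda>z. ?q * (1 / c - 1 / (c + 4 * \<i> * z)) / 4 - ?d / 2 * (Ln (c + 4 * \<i> * z) - Ln c)
     + ?L / (c + 4 * \<i> * z) - ?n / (c + 4 * \<i> * z)"
  have 1: "((\<lambda>z. c + 4 * \<i> * z) has_field_derivative 4 * \<i>) (at (of_real t))" by (auto intro!: derivative_eq_intros)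
  have 2: "((\<lambda>z. inverse (c + 4 * \<i> * z)) has_field_derivative - (4 * \<i>) / D\<^sup>2) (at (of_real t))"
    using DERIV_inverse_fun[OF 1] D unfolding Dz by (simp add: power2_eq_square divide_inverse)
  have 3: "((\<lambda>z. Ln (c + 4 * \<i> * z)) has_field_derivative 4 * \<i> / D) (at (of_real t))"
    using DERIV_chain2[OF has_field_derivative_Ln 1] npos unfolding Dz by (simp add: divide_inverse mult.commute)
  have P: "((\<lambda>z. ?q * (1 / c - inverse (c + 4 * \<i> * z)) / 4 - ?d / 2 * (Ln (c + 4 * \<i> * z) - Ln c)
     + ?L * inverse (c + 4 * \<i> * z) - ?n * inverse (c + 4 * \<i> * z)) has_field_derivative
     (?q * (0 - (- (4 * \<i>) / D\<^sup>2)) / 4 - ?d / 2 * (4 * \<i> / D - 0) + ?L * (- (4 * \<i>) / D\<^sup>2) - ?n * (- (4 * \<i>) / D\<^sup>2))) (at (of_real t))"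
    by (intro DERIV_diff DERIV_add DERIV_cmult DERIV_cdivide DERIV_const 2 3)
  have S: "(\<Sum>i\<in>UNIV. (\<mu> $ i - 2 * of_real (x $ i))\<^sup>2) = ?q - 4 * ?L + 4 * ?n"
  proof -
    have "(\<mu> $ i - 2 * of_real (x $ i))\<^sup>2 = (\<mu> $ i)\<^sup>2 - 4 * (\<mu> $ i * of_real (x $ i)) + 4 * of_real ((x $ i)\<^sup>2)" for i
      by (simp add: power2_eq_square algebra_simps)
    then show ?thesis unfolding norm_sq_vec
      by (simp only: sum.distrib sum_subtractf sum_distrib_left[symmetric] of_real_sum)
  qed
  have G: "gmult c \<mu> t x = (?q - 4 * ?L + 4 * ?n) / D\<^sup>2 - ?d * (2 / D)"
    unfolding gmult_def D_def[symmetric] S[symmetric] sum_subtractf power_divide sum_divide_distrib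
    by simp
  have eq: "?q * (0 - (- (4 * \<i>) / D\<^sup>2)) / 4 - ?d / 2 * (4 * \<i> / D - 0) + ?L * (- (4 * \<i>) / D\<^sup>2) - ?n * (- (4 * \<i>) / D\<^sup>2)
     = \<i> * gmult c \<mu> t x"
    unfolding G by (simp add: diff_divide_distrib add_divide_distrib algebra_simps)
  let ?Q = "\<lambda>z. ?q * (1 / c - inverse (c + 4 * \<i> * z)) / 4 - ?d / 2 * (Ln (c + 4 * \<i> * z) - Ln c)
     + ?L * inverse (c + 4 * \<i> * z) - ?n * inverse (c + 4 * \<i> * z)"
  have Q: "gwave c \<mu> s x = exp (?Q (of_real s))" for s
  proof -
    have "gphase c \<mu> s x = ?Q (of_real s)"
      unfolding gphase_def gden_def by (simp only: inverse_eq_divide times_divide_eq_right mult_1_right)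
    then show ?thesis by (simp only: gwave_def)
  qed
  have E: "((\<lambda>z. exp (?Q z)) has_field_derivative exp (?Q (of_real t)) * (\<i> * gmult c \<mu> t x)) (at (of_real t))"
    by (rule DERIV_chain2[OF DERIV_exp P[unfolded eq]])
  have "\<i> * gmult c \<mu> t x * gwave c \<mu> t x = exp (?Q (of_real t)) * (\<i> * gmult c \<mu> t x)"
    unfolding Q by (rule mult.commute)
  then show ?thesis using has_vector_derivative_real_field[OF E, of S] by (simp only: Q)
qed

lemma gwave_shift:
  "gwave c \<mu> t (x + h *\<^sub>R axis i 1) = gwave c \<mu> t x * exp ((of_real h * (\<mu> $ i - 2 * of_real (x $ i)) - of_real (h\<^sup>2)) / gden c t)"
proof -
  have L: "(\<Sum>j\<in>UNIV. \<mu> $ j * of_real ((x + h *\<^sub>R axis i 1) $ j)) = (\<Sum>j\<in>UNIV. \<mu> $ j * of_real (x $ j)) + of_real h * \<mu> $ i"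
  proof -
    have "\<mu> $ j * of_real ((x + h *\<^sub>R axis i 1) $ j) = \<mu> $ j * of_real (x $ j) + (if j = i then of_real h * \<mu> $ i else 0)" for j
      by (simp add: axis_def algebra_simps)
    then show ?thesis by (simp add: sum.distrib)
  qed
  have "gphase c \<mu> t (x + h *\<^sub>R axis i 1) = gphase c \<mu> t x + (of_real h * (\<mu> $ i - 2 * of_real (x $ i)) - of_real (h\<^sup>2)) / gden c t"
    unfolding gphase_def L norm_sq_axis
    by (simp add: add_divide_distrib diff_divide_distrib algebra_simps)
  then show ?thesis by (simp add: gwave_def exp_add)
qed

lemma gwave_space_derivative:
  "((\<lambda>h. gwave c \<mu> t (x + h *\<^sub>R axis i 1)) has_vector_derivative
     ((\<mu> $ i - 2 * of_real (x $ i)) / gden c t) * gwave c \<mu> t x) (at 0)"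
proof -
  have "((\<lambda>z. gwave c \<mu> t x * exp ((z * (\<mu> $ i - 2 * of_real (x $ i)) - z\<^sup>2) / gden c t)) has_field_derivative
     ((\<mu> $ i - 2 * of_real (x $ i)) / gden c t) * gwave c \<mu> t x) (at (of_real 0))"
    by (auto intro!: derivative_eq_intros)
  from has_vector_derivative_real_field[OF this, of UNIV] show ?thesis unfolding gwave_shift by simp
qed

lemma gwave_space_derivative2:
  "((\<lambda>h. ((\<mu> $ i - 2 * of_real ((x + h *\<^sub>R axis i 1) $ i)) / gden c t) * gwave c \<mu> t (x + h *\<^sub>R axis i 1)) has_vector_derivative
     (((\<mu> $ i - 2 * of_real (x $ i)) / gden c t)\<^sup>2 - 2 / gden c t) * gwave c \<mu> t x) (at 0)"
proof -
  have "((\<lambda>z. (\<mu> $ i - 2 * of_real (x $ i) - 2 * z) / gden c t) has_field_derivative - 2 / gden c t) (at (of_real 0))"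
    by (auto intro!: derivative_eq_intros)
  from has_vector_derivative_real_field[OF this, of UNIV]
  have "((\<lambda>h. (\<mu> $ i - 2 * of_real ((x + h *\<^sub>R axis i 1) $ i)) / gden c t) has_vector_derivative - 2 / gden c t) (at 0)"
    by (simp add: axis_def algebra_simps)
  note m = has_vector_derivative_mult[OF this gwave_space_derivative[of t x i]]
  define a where "a = (\<mu> $ i - 2 * of_real (x $ i)) / gden c t"
  have "a * (a * gwave c \<mu> t x) + (- 2 / gden c t) * gwave c \<mu> t x = (a\<^sup>2 - 2 / gden c t) * gwave c \<mu> t x"
    by (simp add: power2_eq_square algebra_simps)
  moreover have "(\<mu> $ i - 2 * of_real ((x + 0 *\<^sub>R axis i 1) $ i)) / gden c t = a" by (simp add: a_def)
  moreover have "gwave c \<mu> t (x + 0 *\<^sub>R axis i 1) = gwave c \<mu> t x" by simp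
  ultimately show ?thesis using m unfolding a_def[symmetric] by (simp only:)
qed

lemma inverse_gden_bound: "cmod (1 / gden c t) \<le> 1 / Re c"
  using gden_lower[of t] c by (simp add: norm_divide frac_le)

text \<open>
  On bounded time intervals the solution has a fixed Gaussian majorant.
\<close>

lemma gwave_bound:
  assumes T: "T \<ge> 0"
  shows "\<exists>C>0. \<exists>k>0. \<forall>t x. \<bar>t\<bar> \<le> T \<longrightarrow> cmod (gwave c \<mu> t x) \<le> C * exp (- k * (norm x)\<^sup>2)"
proof -
  \<comment> \<open>Half of the Gaussian decay absorbs the linear term of the exponent.\<close>
  define k where "k = Re c / (cmod c + 4 * T)\<^sup>2 / 2"
  define r where "r = 1 / Re c"
  define q where "q = (\<Sum>i\<in>UNIV. (\<mu> $ i)\<^sup>2)"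
  define M where "M = (\<Sum>i\<in>UNIV. cmod (\<mu> $ i))"
  define A where "A = cmod q * (r + r) / 4 + real CARD('d) / 2 * (ln (cmod c) - ln (Re c))"
  have cT: "cmod c + 4 * T > 0" using T c by (auto intro: add_pos_nonneg)
  have k: "k > 0" using c cT by (simp add: k_def)
  have r: "r > 0" using c by (simp add: r_def)
  have inv: "cmod (1 / gden c t) \<le> r" for t
    unfolding r_def by (rule inverse_gden_bound)
  have invc: "cmod (1 / c) \<le> r"
    using complex_Re_le_cmod[of c] c by (simp add: r_def norm_divide frac_le)
  have main: "Re (gphase c \<mu> t x) \<le> (A + M\<^sup>2 * r\<^sup>2 / (4 * k)) - k * (norm x)\<^sup>2" if t: "\<bar>t\<bar> \<le> T" for t x
  proof -
    have a1: "Re (q * (1 / c - 1 / gden c t) / 4) \<le> cmod q * (r + r) / 4"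
    proof -
      have "Re (q * (1 / c - 1 / gden c t) / 4) \<le> cmod (q * (1 / c - 1 / gden c t) / 4)" by (rule complex_Re_le_cmod)
      also have "\<dots> = cmod q * cmod (1 / c - 1 / gden c t) / 4" by (simp add: norm_mult norm_divide)
      also have "\<dots> \<le> cmod q * (r + r) / 4"
        using inv[of t] invc by (intro divide_right_mono mult_left_mono order_trans[OF norm_triangle_ineq4] add_mono) auto
      finally show ?thesis .
    qed
    have a2: "Re (- (of_nat CARD('d) / 2 * (Ln (gden c t) - Ln c))) \<le> real CARD('d) / 2 * (ln (cmod c) - ln (Re c))"
    proof -
      have "ln (Re c) \<le> ln (cmod (gden c t))" using gden_lower[of t] c by (intro ln_mono) auto
      then have "real CARD('d) / 2 * (ln (cmod c) - ln (cmod (gden c t))) \<le> real CARD('d) / 2 * (ln (cmod c) - ln (Re c))"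
        by (intro mult_left_mono) auto
      moreover have "Re (- (of_nat CARD('d) / 2 * (Ln (gden c t) - Ln c))) = real CARD('d) / 2 * (ln (cmod c) - ln (cmod (gden c t)))"
      proof -
        have "of_nat CARD('d) / 2 = complex_of_real (real CARD('d) / 2)" by simp
        then have "Re (of_nat CARD('d) / 2 * (Ln (gden c t) - Ln c)) = real CARD('d) / 2 * Re (Ln (gden c t) - Ln c)"
          by (simp only: Re_complex_of_real Im_complex_of_real times_complex.sel)
        then show ?thesis by (simp add: Re_Ln algebra_simps)
      qed
      ultimately show ?thesis by simp
    qed
    have a3: "Re ((\<Sum>i\<in>UNIV. \<mu> $ i * of_real (x $ i)) / gden c t) \<le> M * r * norm x"
    proof -
      have "cmod (\<Sum>i\<in>UNIV. \<mu> $ i * of_real (x $ i)) \<le> (\<Sum>i\<in>UNIV. cmod (\<mu> $ i) * norm x)"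
        by (rule sum_norm_le) (simp add: norm_mult mult_left_mono component_le_norm_cart)
      also have "\<dots> = M * norm x" by (simp add: M_def sum_distrib_right)
      finally have 1: "cmod (\<Sum>i\<in>UNIV. \<mu> $ i * of_real (x $ i)) \<le> M * norm x" .
      have "Re ((\<Sum>i\<in>UNIV. \<mu> $ i * of_real (x $ i)) / gden c t) \<le> cmod ((\<Sum>i\<in>UNIV. \<mu> $ i * of_real (x $ i)) / gden c t)"
        by (rule complex_Re_le_cmod)
      also have "\<dots> = cmod (\<Sum>i\<in>UNIV. \<mu> $ i * of_real (x $ i)) * cmod (1 / gden c t)" by (simp add: norm_divide)
      also have "\<dots> \<le> (M * norm x) * r"
        by (rule mult_mono[OF 1 inv]) (auto simp: M_def intro!: sum_nonneg mult_nonneg_nonneg)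
      finally show ?thesis by (simp only: mult.assoc mult.commute mult.left_commute)
    qed
    have a4: "2 * k * (norm x)\<^sup>2 \<le> Re (of_real ((norm x)\<^sup>2) / gden c t)"
    proof -
      have "Re (of_real ((norm x)\<^sup>2) / gden c t) = (norm x)\<^sup>2 * (Re c / (cmod (gden c t))\<^sup>2)"
        by (simp add: Re_divide cmod_power2 Re_gden)
      moreover have "2 * k \<le> Re c / (cmod (gden c t))\<^sup>2"
        unfolding k_def using gden_upper[OF t] c cT gden_lower[of t]
        by (auto intro!: divide_left_mono power_mono mult_pos_pos zero_less_power)
      ultimately show ?thesis using mult_left_mono[of "2 * k" "Re c / (cmod (gden c t))\<^sup>2" "(norm x)\<^sup>2"] by (simp add: mult.commute)
    qed
    have a5: "M * r * norm x \<le> M\<^sup>2 * r\<^sup>2 / (4 * k) + k * (norm x)\<^sup>2"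
    proof -
      have "0 \<le> (M * r - 2 * k * norm x)\<^sup>2 / (4 * k)" using k by simp
      also have "\<dots> = M\<^sup>2 * r\<^sup>2 / (4 * k) + k * (norm x)\<^sup>2 - M * r * norm x"
        using k by (simp add: power2_eq_square field_simps)
      finally show ?thesis by simp
    qed
    have "Re (gphase c \<mu> t x) = Re (q * (1 / c - 1 / gden c t) / 4) + Re (- (of_nat CARD('d) / 2 * (Ln (gden c t) - Ln c)))
       + Re ((\<Sum>i\<in>UNIV. \<mu> $ i * of_real (x $ i)) / gden c t) - Re (of_real ((norm x)\<^sup>2) / gden c t)"
      unfolding gphase_def q_def by (simp only: plus_complex.sel minus_complex.sel uminus_complex.sel)
    then show ?thesis using a1 a2 a3 a4 a5 unfolding A_def by linarith
  qed
  show ?thesis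
  proof (intro exI conjI allI impI)
    show "exp (A + M\<^sup>2 * r\<^sup>2 / (4 * k)) > 0" by simp
    show "k > 0" by (rule k)
    fix t x assume "\<bar>t\<bar> \<le> T"
    then have "exp (Re (gphase c \<mu> t x)) \<le> exp ((A + M\<^sup>2 * r\<^sup>2 / (4 * k)) + - k * (norm x)\<^sup>2)"
      using main[of t x] by simp
    then show "cmod (gwave c \<mu> t x) \<le> exp (A + M\<^sup>2 * r\<^sup>2 / (4 * k)) * exp (- k * (norm x)\<^sup>2)"
      unfolding gwave_def norm_exp_eq_Re exp_add .
  qed
qed

lemma gmult_bound: "\<exists>B>0. \<forall>t x. cmod (gmult c \<mu> t x) \<le> B * (1 + (norm x)\<^sup>2)"
proof -
  define r where "r = 1 / Re c"
  define M where "M = (\<Sum>i\<in>UNIV. cmod (\<mu> $ i))"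
  have r: "r > 0" using c by (simp add: r_def)
  have M: "M \<ge> 0" by (simp add: M_def sum_nonneg)
  define B where "B = real CARD('d) * (r\<^sup>2 * (2 * M\<^sup>2 + 8) + 2 * r)"
  have "B > 0" using r by (simp add: B_def add_nonneg_pos)
  moreover have "cmod (gmult c \<mu> t x) \<le> B * (1 + (norm x)\<^sup>2)" for t x
  proof -
    have inv: "cmod (1 / gden c t) \<le> r"
      unfolding r_def by (rule inverse_gden_bound)
    have "cmod (((\<mu> $ i - 2 * of_real (x $ i)) / gden c t)\<^sup>2 - 2 / gden c t) \<le> (r\<^sup>2 * (2 * M\<^sup>2 + 8) + 2 * r) * (1 + (norm x)\<^sup>2)" for i
    proof -
      have "cmod (\<mu> $ i) \<le> M" unfolding M_def by (rule member_le_sum) auto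
      moreover have "\<bar>x $ i\<bar> \<le> norm x" by (rule component_le_norm_cart)
      ultimately have "cmod (\<mu> $ i - 2 * of_real (x $ i)) \<le> M + 2 * norm x"
        using norm_triangle_ineq4[of "\<mu> $ i" "2 * of_real (x $ i)"] by (simp add: norm_mult)
      then have "(cmod (\<mu> $ i - 2 * of_real (x $ i)))\<^sup>2 \<le> (M + 2 * norm x)\<^sup>2" by (intro power_mono) auto
      also have "\<dots> \<le> 2 * M\<^sup>2 + 8 * (norm x)\<^sup>2"
        using zero_le_power2[of "M - 2 * norm x"] by (simp add: power2_eq_square algebra_simps)
      finally have 1: "(cmod (\<mu> $ i - 2 * of_real (x $ i)))\<^sup>2 \<le> 2 * M\<^sup>2 + 8 * (norm x)\<^sup>2" .
      have "cmod (((\<mu> $ i - 2 * of_real (x $ i)) / gden c t)\<^sup>2) = (cmod (\<mu> $ i - 2 * of_real (x $ i)))\<^sup>2 * (cmod (1 / gden c t))\<^sup>2"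
        by (simp add: norm_power norm_divide power_divide)
      also have "\<dots> \<le> (2 * M\<^sup>2 + 8 * (norm x)\<^sup>2) * r\<^sup>2"
        by (rule mult_mono[OF 1 power_mono[OF inv]]) auto
      finally have 2: "cmod (((\<mu> $ i - 2 * of_real (x $ i)) / gden c t)\<^sup>2) \<le> (2 * M\<^sup>2 + 8 * (norm x)\<^sup>2) * r\<^sup>2" .
      have 3: "cmod (2 / gden c t) \<le> 2 * r"
        using inv by (simp add: norm_divide)
      have "cmod (((\<mu> $ i - 2 * of_real (x $ i)) / gden c t)\<^sup>2 - 2 / gden c t) \<le> (2 * M\<^sup>2 + 8 * (norm x)\<^sup>2) * r\<^sup>2 + 2 * r"
        by (rule order_trans[OF norm_triangle_ineq4 add_mono[OF 2 3]])
      also have "\<dots> \<le> (2 * M\<^sup>2 + 8 * (norm x)\<^sup>2) * r\<^sup>2 + 2 * r + (8 * r\<^sup>2 + 2 * M\<^sup>2 * (norm x)\<^sup>2 * r\<^sup>2 + 2 * r * (norm x)\<^sup>2)"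
        using r by (simp add: add_nonneg_nonneg)
      also have "\<dots> = (r\<^sup>2 * (2 * M\<^sup>2 + 8) + 2 * r) * (1 + (norm x)\<^sup>2)" by (simp add: algebra_simps)
      finally show ?thesis .
    qed
    then have "cmod (gmult c \<mu> t x) \<le> (\<Sum>i\<in>(UNIV::'d set). (r\<^sup>2 * (2 * M\<^sup>2 + 8) + 2 * r) * (1 + (norm x)\<^sup>2))"
      unfolding gmult_def by (rule sum_norm_le)
    then show ?thesis by (simp add: B_def)
  qed
  ultimately show ?thesis by blast
qed

lemma gmult_gwave_bound:
  assumes T: "T \<ge> 0"
  shows "\<exists>C>0. \<exists>k>0. \<forall>t x. \<bar>t\<bar> \<le> T \<longrightarrow> cmod (\<i> * gmult c \<mu> t x * gwave c \<mu> t x) \<le> C * exp (- k * (norm x)\<^sup>2)"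
proof -
  obtain C k where C: "C > 0" and k: "k > 0" and 1: "\<And>t x. \<bar>t\<bar> \<le> T \<Longrightarrow> cmod (gwave c \<mu> t x) \<le> C * exp (- k * (norm x)\<^sup>2)"
    using gwave_bound[OF T] by blast
  obtain B where B: "B > 0" and 2: "\<And>t x. cmod (gmult c \<mu> t x) \<le> B * (1 + (norm x)\<^sup>2)"
    using gmult_bound by blast
  show ?thesis
  proof (intro exI conjI allI impI)
    show "B * C * (1 + 2 / k) > 0" using B C k by (simp add: add_pos_pos)
    show "k / 2 > 0" using k by simp
    fix t x assume t: "\<bar>t\<bar> \<le> T"
    have "cmod (\<i> * gmult c \<mu> t x * gwave c \<mu> t x) = cmod (gmult c \<mu> t x) * cmod (gwave c \<mu> t x)" by (simp add: norm_mult)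
    also have "\<dots> \<le> (B * (1 + (norm x)\<^sup>2)) * (C * exp (- k * (norm x)\<^sup>2))"
      by (rule mult_mono[OF 2 1[OF t]]) (use B in auto)
    also have "\<dots> = B * C * (exp (- k * (norm x)\<^sup>2) + (norm x)\<^sup>2 * exp (- k * (norm x)\<^sup>2))" by (simp add: algebra_simps)
    also have "\<dots> \<le> B * C * (1 * exp (- (k / 2) * (norm x)\<^sup>2) + (2 / k) * exp (- (k / 2) * (norm x)\<^sup>2))"
      using B C k by (intro mult_left_mono add_mono sq_norm_mult_exp_le) auto
    also have "\<dots> = B * C * (1 + 2 / k) * exp (- (k / 2) * (norm x)\<^sup>2)" by (simp only: distrib_right mult.assoc)
    finally show "cmod (\<i> * gmult c \<mu> t x * gwave c \<mu> t x) \<le> B * C * (1 + 2 / k) * exp (- (k / 2) * (norm x)\<^sup>2)" .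
  qed
qed

lemma gwave_L2: "gwave c \<mu> t \<in> L2"
proof -
  obtain C k where "k > 0" "\<forall>s x. \<bar>s\<bar> \<le> \<bar>t\<bar> \<longrightarrow> cmod (gwave c \<mu> s x) \<le> C * exp (- k * (norm x)\<^sup>2)"
    using gwave_bound[of "\<bar>t\<bar>"] by auto
  then show ?thesis by (intro sq_integrable_imp_L2 sq_integrable_exp_norm[of k]) auto
qed

lemma gmult_gwave_L2: "(\<lambda>x. \<i> * gmult c \<mu> t x * gwave c \<mu> t x) \<in> L2"
proof -
  obtain C k where "k > 0" "\<forall>s x. \<bar>s\<bar> \<le> \<bar>t\<bar> \<longrightarrow> cmod (\<i> * gmult c \<mu> s x * gwave c \<mu> s x) \<le> C * exp (- k * (norm x)\<^sup>2)"
    using gmult_gwave_bound[of "\<bar>t\<bar>"] by auto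
  then show ?thesis by (intro sq_integrable_imp_L2 sq_integrable_exp_norm[of k _ C]) auto
qed

lemma gwave_laplacian: "L2_laplacian (gwave c \<mu> t) (\<lambda>x. gmult c \<mu> t x * gwave c \<mu> t x)"
proof -
  let ?u2 = "\<lambda>i x. (((\<mu> $ i - 2 * of_real (x $ i)) / gden c t)\<^sup>2 - 2 / gden c t) * gwave c \<mu> t x"
  have e: "(\<lambda>x. \<Sum>i\<in>UNIV. ?u2 i x) = (\<lambda>x. gmult c \<mu> t x * gwave c \<mu> t x)"
    by (simp only: gmult_def sum_distrib_right)
  have "(\<lambda>x. gmult c \<mu> t x * gwave c \<mu> t x) \<in> L2"
    using L2_scale[OF gmult_gwave_L2[of t], of "- \<i>"] by (simp add: mult.assoc[symmetric])
  then show ?thesis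
    unfolding e[symmetric]
    by (intro L2_laplacian_smooth[where ?u1.0 = "\<lambda>i x. ((\<mu> $ i - 2 * of_real (x $ i)) / gden c t) * gwave c \<mu> t x"]
       gwave_L2 gwave_space_derivative gwave_space_derivative2 continuous_intros continuous_on_gwave) auto
qed

lemma gwave_L2_derivative:
  "((\<lambda>h. L2_norm (\<lambda>x. (gwave c \<mu> (t + h) x - gwave c \<mu> t x) / of_real h - \<i> * gmult c \<mu> t x * gwave c \<mu> t x)) \<longlongrightarrow> 0) (at 0)"
proof -
  let ?v = "\<lambda>t x. \<i> * gmult c \<mu> t x * gwave c \<mu> t x"
  let ?R = "\<lambda>h x. (gwave c \<mu> (t + h) x - gwave c \<mu> t x) / of_real h - ?v t x"
  obtain C k where C: "C > 0" and k: "k > 0" and b: "\<And>s x. \<bar>s\<bar> \<le> \<bar>t\<bar> + 1 \<Longrightarrow> cmod (?v s x) \<le> C * exp (- k * (norm x)\<^sup>2)"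
    using gmult_gwave_bound[of "\<bar>t\<bar> + 1"] by auto
  have Rb: "cmod (?R h x) \<le> 2 * C * exp (- k * (norm x)\<^sup>2)" if h: "\<bar>h\<bar> \<le> 1" "h \<noteq> 0" for h x
  proof -
    let ?S = "{t - 1..t + 1}"
    have "norm (gwave c \<mu> (t + h) x - gwave c \<mu> t x) \<le> (C * exp (- k * (norm x)\<^sup>2)) * norm ((t + h) - t)"
    proof (rule differentiable_bound)
      show "convex ?S" by simp
      show "((\<lambda>s. gwave c \<mu> s x) has_derivative (\<lambda>h. h *\<^sub>R ?v s x)) (at s within ?S)" for s
        using gwave_time_derivative[of x s ?S] by (simp add: has_vector_derivative_def)
      show "onorm (\<lambda>h. h *\<^sub>R ?v s x) \<le> C * exp (- k * (norm x)\<^sup>2)" if "s \<in> ?S" for s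
      proof (rule onorm_le)
        have "\<bar>s\<bar> \<le> \<bar>t\<bar> + 1" using that by auto
        then show "norm (h *\<^sub>R ?v s x) \<le> C * exp (- k * (norm x)\<^sup>2) * norm h" for h
          using mult_left_mono[OF b[of s x], of "\<bar>h\<bar>"] by (simp add: mult.commute)
      qed
      show "t + h \<in> ?S" "t \<in> ?S" using h by auto
    qed
    then have "norm (gwave c \<mu> (t + h) x - gwave c \<mu> t x) / \<bar>h\<bar> \<le> C * exp (- k * (norm x)\<^sup>2)"
      using h by (simp add: pos_divide_le_eq)
    then have "cmod ((gwave c \<mu> (t + h) x - gwave c \<mu> t x) / of_real h) \<le> C * exp (- k * (norm x)\<^sup>2)" by (simp add: norm_divide)
    moreover have "cmod (?v t x) \<le> C * exp (- k * (norm x)\<^sup>2)" by (rule b) simp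
    ultimately show ?thesis
      using norm_triangle_ineq4[of "(gwave c \<mu> (t + h) x - gwave c \<mu> t x) / of_real h" "?v t x"] by simp
  qed
  have sq: "integrable lborel (\<lambda>x::real^'d. (2 * C * exp (- k * (norm x)\<^sup>2))\<^sup>2)"
  proof -
    have "(2 * C * exp (- k * (norm x)\<^sup>2))\<^sup>2 = (2 * C)\<^sup>2 * exp (- (2 * k) * (norm x)\<^sup>2)" for x :: "real^'d"
      by (simp add: power_mult_distrib exp_of_nat_mult[symmetric] mult.assoc)
    then show ?thesis using k by (simp only:) (intro integrable_mult_right integrable_exp_norm, simp)
  qed
  have pt: "((\<lambda>h. ?R h x) \<longlongrightarrow> 0) (at 0)" for x
  proof -
    have "((\<lambda>h. norm (gwave c \<mu> (t + h) x - gwave c \<mu> t x - h *\<^sub>R ?v t x) / norm h) \<longlongrightarrow> 0) (at 0)"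
      using gwave_time_derivative[of x t UNIV] by (simp add: has_vector_derivative_def has_derivative_at)
    then have "((\<lambda>h. norm (?R h x)) \<longlongrightarrow> 0) (at 0)"
    proof (rule Lim_transform_eventually)
      show "\<forall>\<^sub>F h in at 0. norm (gwave c \<mu> (t + h) x - gwave c \<mu> t x - h *\<^sub>R ?v t x) / norm h = norm (?R h x)"
        unfolding eventually_at_filter
      proof (rule always_eventually, intro allI impI)
        fix h :: real assume h: "h \<noteq> 0"
        have "?R h x = (gwave c \<mu> (t + h) x - gwave c \<mu> t x - h *\<^sub>R ?v t x) / of_real h"
          using h by (simp add: diff_divide_distrib scaleR_conv_of_real)
        then show "norm (gwave c \<mu> (t + h) x - gwave c \<mu> t x - h *\<^sub>R ?v t x) / norm h = norm (?R h x)"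
          by (simp add: norm_divide)
      qed
    qed
    then show ?thesis by (rule tendsto_norm_zero_cancel)
  qed
  show ?thesis
    unfolding tendsto_at_iff_sequentially comp_def
  proof (intro allI impI)
    fix X :: "nat \<Rightarrow> real" assume X0: "\<forall>i. X i \<in> UNIV - {0}" and X: "X \<longlonglongrightarrow> 0"
    have Xat: "filterlim X (at 0) sequentially" unfolding filterlim_at using X X0 by auto
    have ev: "\<forall>\<^sub>F i in sequentially. \<bar>X i\<bar> \<le> 1"
      using order_tendstoD(2)[OF tendsto_rabs_zero[OF X], of 1] by (auto elim: eventually_mono)
    then obtain N where N: "\<And>i. i \<ge> N \<Longrightarrow> \<bar>X i\<bar> \<le> 1" by (auto simp: eventually_sequentially)
    have "(\<lambda>i. LINT x|lborel. (cmod (?R (X (i + N)) x))\<^sup>2) \<longlonglongrightarrow> (LINT x::real^'d|lborel. 0)"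
    proof (rule integral_dominated_convergence[OF _ _ sq])
      show "AE x in lborel. (\<lambda>i. (cmod (?R (X (i + N)) x))\<^sup>2) \<longlonglongrightarrow> 0"
      proof (intro AE_I2)
        fix x
        have "(\<lambda>i. ?R (X i) x) \<longlonglongrightarrow> 0" by (rule filterlim_compose[OF pt Xat])
        then have "(\<lambda>i. ?R (X (i + N)) x) \<longlonglongrightarrow> 0" by (rule LIMSEQ_ignore_initial_segment)
        from tendsto_power[OF tendsto_norm_zero[OF this], of 2]
        show "(\<lambda>i. (cmod (?R (X (i + N)) x))\<^sup>2) \<longlonglongrightarrow> 0" by simp
      qed
      show "AE x in lborel. norm ((cmod (?R (X (i + N)) x))\<^sup>2) \<le> (2 * C * exp (- k * (norm x)\<^sup>2))\<^sup>2" for i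
      proof (intro AE_I2)
        fix x :: "real^'d"
        have "cmod (?R (X (i + N)) x) \<le> 2 * C * exp (- k * (norm x)\<^sup>2)" using X0 by (intro Rb N) auto
        then have "(cmod (?R (X (i + N)) x))\<^sup>2 \<le> (2 * C * exp (- k * (norm x)\<^sup>2))\<^sup>2" by (rule power_mono) simp
        then show "norm ((cmod (?R (X (i + N)) x))\<^sup>2) \<le> (2 * C * exp (- k * (norm x)\<^sup>2))\<^sup>2" by simp
      qed
    qed measurable
    then have "(\<lambda>i. LINT x|lborel. (cmod (?R (X (i + N)) x))\<^sup>2) \<longlonglongrightarrow> 0" by simp
    then have "(\<lambda>i. (L2_norm (?R (X (i + N))))\<^sup>2) \<longlonglongrightarrow> 0" by (subst L2_norm_lborel) measurable
    from tendsto_real_sqrt[OF this] have "(\<lambda>i. L2_norm (?R (X (i + N)))) \<longlonglongrightarrow> 0" by simp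
    then show "(\<lambda>i. L2_norm (?R (X i))) \<longlonglongrightarrow> 0" by (rule LIMSEQ_offset)
  qed
qed

text \<open>
  The group moves Gaussians along the explicit solution.
\<close>

lemma gwave_evolution:
  assumes U: "free_schroedinger_group U"
  shows "L2_eq (U t (gwave c \<mu> 0)) (gwave c \<mu> t)"
proof (rule evolution_unique)
  show "L2_unitary_group U" using U by (simp add: free_schroedinger_group_def)
  show "gwave c \<mu> s \<in> L2" for s by (rule gwave_L2)
  show "L2_generator U (gwave c \<mu> s) (\<lambda>x. \<i> * gmult c \<mu> s x * gwave c \<mu> s x)" for s
    using U gwave_laplacian[of s] gmult_gwave_L2[of s] unfolding free_schroedinger_group_def
    by (auto simp: mult.assoc intro!: exI[of _ "\<lambda>x. gmult c \<mu> s x * gwave c \<mu> s x"])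
qed (rule gwave_L2_derivative)

end

section \<open>Explicit evolution at a fixed time\<close>

text \<open>
  The time at which the evolution is the Fourier transform in the normalisation \<open>e\<^bsup>-2\<pi>ix\<xi>\<^esup>\<close>, up to
  factors of modulus one.
\<close>

definition quarter_time :: real where
  "quarter_time = 1 / (4 * pi)"

text \<open>
  The chirp \<open>e\<^bsup>i\<pi>|x|\<^sup>2\<^esup>\<close>.
\<close>

definition chirp :: "real^'d::finite \<Rightarrow> complex" where
  "chirp x = cis (pi * (norm x)\<^sup>2)"

text \<open>
  The constant \<open>e\<^bsup>i\<pi>d/4\<^esup>\<close> that compensates the phase \<open>i\<^bsup>-d/2\<^esup>\<close> of the propagator.
\<close>

definition maslov :: "'d::finite itself \<Rightarrow> complex" where
  "maslov _ = cis (pi * real CARD('d) / 4)"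

lemma borel_measurable_chirp [measurable]: "chirp \<in> borel_measurable borel"
  unfolding chirp_def[abs_def] by measurable

lemma cmod_chirp [simp]: "cmod (chirp x) = 1"
  by (simp add: chirp_def)

lemma cmod_maslov [simp]: "cmod (maslov TYPE('d::finite)) = 1"
  by (simp add: maslov_def)

lemma cnj_cis_exp: "cnj (cis a) = exp (- (\<i> * of_real a))"
  by (subst cis_cnj) (simp add: cis_conv_exp)

text \<open>
  Gaussians with an arbitrary complex linear term; imaginary \<open>w\<close> gives modulated, real \<open>w\<close> gives
  translated Gaussians.
\<close>

definition ggauss :: "real \<Rightarrow> complex^'d::finite \<Rightarrow> real^'d \<Rightarrow> complex" where
  "ggauss r w x = exp (of_real (- pi * r * (norm x)\<^sup>2) + 2 * of_real pi * (\<Sum>i\<in>UNIV. w $ i * of_real (x $ i)))"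

text \<open>
  Up to the chirps and the constant, this is the Fourier transform of \<open>ggauss r w\<close>.
\<close>

lemma chirped_gaussian_evolution:
  fixes U :: "real \<Rightarrow> (real^'d::finite \<Rightarrow> complex) \<Rightarrow> (real^'d \<Rightarrow> complex)" and w :: "complex^'d"
  assumes U: "free_schroedinger_group U" and r: "r > 0"
  shows "(\<lambda>x. cnj (chirp x) * ggauss r w x) \<in> L2"
    and "(\<lambda>x. chirp x * cnj (maslov TYPE('d)) * of_real (r powr (- (real CARD('d) / 2)))
         * exp (of_real (pi / r) * (\<Sum>i\<in>UNIV. (w $ i - \<i> * of_real (x $ i))\<^sup>2))) \<in> L2"
    and "L2_eq (U quarter_time (\<lambda>x. cnj (chirp x) * ggauss r w x))
      (\<lambda>x. chirp x * cnj (maslov TYPE('d)) * of_real (r powr (- (real CARD('d) / 2)))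
         * exp (of_real (pi / r) * (\<Sum>i\<in>UNIV. (w $ i - \<i> * of_real (x $ i))\<^sup>2)))"
proof -
  \<comment> \<open>The chirp turns \<open>\<pi> r\<close> into \<open>\<pi> (r + \<i>) = 1 / c\<close>, and then \<open>c + 4 \<i> \<tau> = \<i> r c\<close> at \<open>\<tau> = 1 / (4 \<pi>)\<close>.\<close>
  define z where "z = of_real r + \<i>"
  define c where "c = 1 / (of_real pi * z)"
  define \<mu> :: "complex^'d" where "\<mu> = (\<chi> i. 2 * of_real pi * c * w $ i)"
  have z: "z \<noteq> 0" by (simp add: z_def complex_eq_iff)
  have c0: "c \<noteq> 0" using z by (simp add: c_def)
  have cz: "c * z = 1 / of_real pi" using z by (simp add: c_def)
  have ic: "1 / c = of_real pi * z" by (simp add: c_def)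
  have Rec: "Re c > 0"
  proof -
    have "Re c = Re (of_real pi * z) / (cmod (of_real pi * z))\<^sup>2"
      unfolding c_def by (simp add: Re_divide cmod_power2)
    moreover have "Re (of_real pi * z) > 0" using r by (simp add: z_def)
    ultimately show ?thesis using z by simp
  qed
  have den0: "gden c 0 = c" by (simp add: gden_def)
  have den: "gden c quarter_time = \<i> * of_real r * c"
  proof -
    have "gden c quarter_time = c + \<i> * (1 / of_real pi)" by (simp add: gden_def quarter_time_def)
    also have "\<dots> = c + \<i> * (c * z)" by (simp add: cz)
    also have "\<dots> = \<i> * of_real r * c" by (simp add: z_def algebra_simps)
    finally show ?thesis .
  qed
  have g0: "gwave c \<mu> 0 x = cnj (chirp x) * ggauss r w x" for x
  proof -
    have "(\<Sum>i\<in>UNIV. \<mu> $ i * of_real (x $ i)) / c = 2 * of_real pi * (\<Sum>i\<in>UNIV. w $ i * of_real (x $ i))"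
      using c0 by (simp add: \<mu>_def sum_divide_distrib sum_distrib_left mult.assoc)
    moreover have "of_real ((norm x)\<^sup>2) / c = of_real (pi * r * (norm x)\<^sup>2) + \<i> * of_real (pi * (norm x)\<^sup>2)"
    proof -
      have "of_real ((norm x)\<^sup>2) / c = of_real ((norm x)\<^sup>2) * (1 / c)" by simp
      then show ?thesis unfolding ic by (simp add: z_def algebra_simps)
    qed
    ultimately have "gphase c \<mu> 0 x = - (\<i> * of_real (pi * (norm x)\<^sup>2)) + (of_real (- pi * r * (norm x)\<^sup>2) + 2 * of_real pi * (\<Sum>i\<in>UNIV. w $ i * of_real (x $ i)))"
      unfolding gphase_def den0 by simp
    moreover have "cnj (chirp x) = exp (- (\<i> * of_real (pi * (norm x)\<^sup>2)))"
      by (simp only: chirp_def cnj_cis_exp)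
    ultimately show ?thesis by (simp only: gwave_def ggauss_def exp_add)
  qed
  have g1: "gwave c \<mu> quarter_time x = chirp x * cnj (maslov TYPE('d)) * of_real (r powr (- (real CARD('d) / 2)))
         * exp (of_real (pi / r) * (\<Sum>i\<in>UNIV. (w $ i - \<i> * of_real (x $ i))\<^sup>2))" for x
  proof -
    let ?ww = "\<Sum>i\<in>UNIV. (w $ i)\<^sup>2"
    let ?wx = "\<Sum>i\<in>UNIV. w $ i * of_real (x $ i)"
    let ?n = "of_real ((norm x)\<^sup>2) :: complex"
    have rz: "of_real r \<noteq> (0::complex)" using r by simp
    have ir: "1 / (\<i> * of_real r) = - \<i> / of_real r" using rz by (simp add: field_simps)
    have t1: "(\<Sum>i\<in>UNIV. (\<mu> $ i)\<^sup>2) * (1 / c - 1 / gden c quarter_time) / 4 = of_real (pi / r) * ?ww"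
    proof -
      have "(\<Sum>i\<in>UNIV. (\<mu> $ i)\<^sup>2) = 4 * (of_real pi)\<^sup>2 * c\<^sup>2 * ?ww"
        by (simp add: \<mu>_def power_mult_distrib sum_distrib_left)
      moreover have "1 / c - 1 / gden c quarter_time = (1 / c) * (z / of_real r)"
      proof -
        have "1 / gden c quarter_time = (1 / c) * (1 / (\<i> * of_real r))" by (simp add: den)
        then have "1 / c - 1 / gden c quarter_time = (1 / c) * (1 - 1 / (\<i> * of_real r))" by (simp add: right_diff_distrib)
        also have "1 - 1 / (\<i> * of_real r) = z / of_real r" unfolding ir z_def using rz by (simp add: field_simps)
        finally show ?thesis .
      qed
      ultimately have "(\<Sum>i\<in>UNIV. (\<mu> $ i)\<^sup>2) * (1 / c - 1 / gden c quarter_time) / 4 = (of_real pi)\<^sup>2 * (c * z) * ?ww / of_real r"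
        using c0 by (simp add: power2_eq_square)
      then show ?thesis unfolding cz by (simp add: power2_eq_square)
    qed
    \<comment> \<open>Both logarithms have imaginary part below \<open>\<pi>/2\<close>, so no multiple of \<open>2\<pi>\<close> intervenes.\<close>
    have t2: "Ln (gden c quarter_time) - Ln c = of_real (ln r) + \<i> * of_real (pi / 2)"
    proof -
      have D0: "gden c quarter_time \<noteq> 0" using rz c0 by (simp add: den)
      have "Re (gden c quarter_time) > 0" using Rec by (simp add: gden_def)
      then have "\<bar>Im (Ln (gden c quarter_time))\<bar> < pi / 2" using Re_Ln_pos_lt[OF D0] by simp
      moreover have "\<bar>Im (Ln c)\<bar> < pi / 2" using Re_Ln_pos_lt[OF c0] Rec by simp
      ultimately have im: "- pi < Im (Ln (gden c quarter_time) - Ln c)" "Im (Ln (gden c quarter_time) - Ln c) \<le> pi"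
        by (auto simp: abs_less_iff)
      have "exp (Ln (gden c quarter_time) - Ln c) = \<i> * of_real r"
        using D0 c0 by (simp add: exp_diff den)
      then have 1: "Ln (\<i> * of_real r) = Ln (gden c quarter_time) - Ln c" by (rule Ln_unique[OF _ im])
      have 2: "Ln (\<i> * of_real r) = of_real (ln r) + \<i> * of_real (pi / 2)"
      proof (rule Ln_unique)
        have "exp (of_real (ln r) + \<i> * of_real (pi / 2)) = exp (of_real (ln r)) * cis (pi / 2)"
          by (simp only: exp_add cis_conv_exp)
        also have "exp (of_real (ln r)) = complex_of_real r" using r by (simp only: exp_of_real exp_ln)
        finally show "exp (of_real (ln r) + \<i> * of_real (pi / 2)) = \<i> * of_real r" by simp
      qed auto
      show ?thesis using 1 2 by simp
    qed
    have t3: "(\<Sum>i\<in>UNIV. \<mu> $ i * of_real (x $ i)) / gden c quarter_time = - 2 * \<i> * of_real (pi / r) * ?wx"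
    proof -
      have "(\<Sum>i\<in>UNIV. \<mu> $ i * of_real (x $ i)) = c * (2 * of_real pi * ?wx)"
        by (simp add: \<mu>_def sum_distrib_left mult.assoc mult.left_commute)
      then have "(\<Sum>i\<in>UNIV. \<mu> $ i * of_real (x $ i)) / gden c quarter_time = (2 * of_real pi * ?wx) * (1 / (\<i> * of_real r))"
        using c0 by (simp add: den)
      then show ?thesis unfolding ir by (simp add: mult.commute mult.left_commute)
    qed
    have t4: "?n / gden c quarter_time = of_real (pi / r) * ?n - \<i> * of_real (pi * (norm x)\<^sup>2)"
    proof -
      have "?n / gden c quarter_time = ?n * (1 / c) * (1 / (\<i> * of_real r))" by (simp add: den)
      also have "\<dots> = ?n * of_real pi * (z * (- \<i> / of_real r))" unfolding ic ir by simp
      also have "z * (- \<i> / of_real r) = 1 / of_real r - \<i>" unfolding z_def using rz by (simp add: field_simps)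
      finally show ?thesis by (simp add: algebra_simps)
    qed
    have sq: "(\<Sum>i\<in>UNIV. (w $ i - \<i> * of_real (x $ i))\<^sup>2) = ?ww - 2 * \<i> * ?wx - ?n"
    proof -
      have "(w $ i - \<i> * of_real (x $ i))\<^sup>2 = (w $ i)\<^sup>2 - 2 * \<i> * (w $ i * of_real (x $ i)) - of_real ((x $ i)\<^sup>2)" for i
        by (simp add: power2_eq_square algebra_simps)
      then show ?thesis unfolding norm_sq_vec by (simp only: sum_subtractf sum_distrib_left[symmetric] of_real_sum)
    qed
    have "gphase c \<mu> quarter_time x = \<i> * of_real (pi * (norm x)\<^sup>2) + - (\<i> * of_real (pi * real CARD('d) / 4))
        + of_real (- (real CARD('d) / 2) * ln r) + of_real (pi / r) * (\<Sum>i\<in>UNIV. (w $ i - \<i> * of_real (x $ i))\<^sup>2)"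
    proof -
      have alg: "P * a - d / 2 * (l + \<i> * (p / 2)) + - 2 * \<i> * P * e - (P * m - \<i> * k)
         = \<i> * k + - (\<i> * (p * d / 4)) + - (d / 2) * l + P * (a - 2 * \<i> * e - m)" for P a d l p e m k :: complex
        by (simp add: algebra_simps)
      have "complex_of_real (pi * real CARD('d) / 4) = of_real pi * of_nat CARD('d) / 4"
        "complex_of_real (- (real CARD('d) / 2) * ln r) = - (of_nat CARD('d) / 2) * of_real (ln r)"
        "complex_of_real (pi / 2) = of_real pi / 2" by simp_all
      then show ?thesis unfolding gphase_def t1 t2 t3 t4 sq by (simp only: alg)
    qed
    moreover have "chirp x = exp (\<i> * of_real (pi * (norm x)\<^sup>2))" by (simp add: chirp_def cis_conv_exp)
    moreover have "cnj (maslov TYPE('d)) = exp (- (\<i> * of_real (pi * real CARD('d) / 4)))"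
      by (simp only: maslov_def cnj_cis_exp)
    moreover have "of_real (r powr (- (real CARD('d) / 2))) = exp (complex_of_real (- (real CARD('d) / 2) * ln r))"
      using r by (simp only: exp_of_real powr_def) simp
    ultimately show ?thesis by (simp only: gwave_def exp_add)
  qed
  have e0: "gwave c \<mu> 0 = (\<lambda>x. cnj (chirp x) * ggauss r w x)" by (rule ext) (rule g0)
  have e1: "gwave c \<mu> quarter_time = (\<lambda>x. chirp x * cnj (maslov TYPE('d)) * of_real (r powr (- (real CARD('d) / 2)))
         * exp (of_real (pi / r) * (\<Sum>i\<in>UNIV. (w $ i - \<i> * of_real (x $ i))\<^sup>2)))" by (rule ext) (rule g1)
  show "(\<lambda>x. cnj (chirp x) * ggauss r w x) \<in> L2" using gwave_L2[OF Rec, of \<mu> 0] unfolding e0 .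
  show "(\<lambda>x. chirp x * cnj (maslov TYPE('d)) * of_real (r powr (- (real CARD('d) / 2)))
         * exp (of_real (pi / r) * (\<Sum>i\<in>UNIV. (w $ i - \<i> * of_real (x $ i))\<^sup>2))) \<in> L2"
    using gwave_L2[OF Rec, of \<mu> quarter_time] unfolding e1 .
  show "L2_eq (U quarter_time (\<lambda>x. cnj (chirp x) * ggauss r w x))
      (\<lambda>x. chirp x * cnj (maslov TYPE('d)) * of_real (r powr (- (real CARD('d) / 2)))
         * exp (of_real (pi / r) * (\<Sum>i\<in>UNIV. (w $ i - \<i> * of_real (x $ i))\<^sup>2)))"
    using gwave_evolution[OF Rec U, of quarter_time \<mu>] unfolding e0 e1 .
qed

text \<open>
  The Fourier transform of a modulated Gaussian is a translated one.
\<close>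

lemma chirped_plane_wave_evolution:
  fixes U :: "real \<Rightarrow> (real^'d::finite \<Rightarrow> complex) \<Rightarrow> (real^'d \<Rightarrow> complex)" and b :: "real^'d"
  assumes U: "free_schroedinger_group U" and r: "r > 0"
  shows "(\<lambda>x. cnj (chirp x) * (of_real (bell r x) * wave b x)) \<in> L2" (is "?u \<in> _")
    and "(\<lambda>x. chirp x * cnj (maslov TYPE('d)) * of_real (gauss r (b - x))) \<in> L2" (is "?v \<in> _")
    and "L2_eq (U quarter_time (\<lambda>x. cnj (chirp x) * (of_real (bell r x) * wave b x)))
      (\<lambda>x. chirp x * cnj (maslov TYPE('d)) * of_real (gauss r (b - x)))"
proof -
  define w :: "complex^'d" where "w = (\<chi> i. \<i> * of_real (b $ i))"
  have 1: "ggauss r w x = of_real (bell r x) * wave b x" for x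
  proof -
    have "2 * of_real pi * (\<Sum>i\<in>UNIV. w $ i * of_real (x $ i)) = \<i> * of_real (2 * pi * (b \<bullet> x))"
      by (simp add: w_def inner_vec_def sum_distrib_left mult.assoc mult.left_commute)
    then show ?thesis unfolding ggauss_def exp_add cis_conv_exp by (simp only: exp_of_real)
  qed
  have 2: "of_real (r powr (- (real CARD('d) / 2))) * exp (of_real (pi / r) * (\<Sum>i\<in>UNIV. (w $ i - \<i> * of_real (x $ i))\<^sup>2))
     = complex_of_real (gauss r (b - x))" for x
  proof -
    have "(w $ i - \<i> * of_real (x $ i))\<^sup>2 = - of_real (((b - x) $ i)\<^sup>2)" for i
    proof -
      have "w $ i - \<i> * of_real (x $ i) = \<i> * of_real ((b - x) $ i)" by (simp add: w_def algebra_simps)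
      then show ?thesis by (simp only: power_mult_distrib) simp
    qed
    then have "(\<Sum>i\<in>UNIV. (w $ i - \<i> * of_real (x $ i))\<^sup>2) = - of_real ((norm (b - x))\<^sup>2)"
      unfolding norm_sq_vec by (simp only: sum_negf of_real_sum)
    then have "of_real (pi / r) * (\<Sum>i\<in>UNIV. (w $ i - \<i> * of_real (x $ i))\<^sup>2) = complex_of_real (- pi * (norm (b - x))\<^sup>2 / r)" by simp
    then show ?thesis by (simp only: exp_of_real gauss_def of_real_mult DIM_cart DIM_real mult_1_right)
  qed
  note g = chirped_gaussian_evolution[OF U r, of w, unfolded mult.assoc 2, unfolded 1]
  show "?u \<in> L2" using g(1) by simp
  show "?v \<in> L2" using g(2) by (simp add: mult.assoc)
  show "L2_eq (U quarter_time ?u) ?v" using g(3) by (simp add: mult.assoc)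
qed

text \<open>
  The Fourier transform of a translated Gaussian is a modulated one.
\<close>

lemma chirped_bump_evolution:
  fixes U :: "real \<Rightarrow> (real^'d::finite \<Rightarrow> complex) \<Rightarrow> (real^'d \<Rightarrow> complex)" and b :: "real^'d"
  assumes U: "free_schroedinger_group U" and r: "r > 0"
  shows "(\<lambda>x. cnj (chirp x) * of_real (gauss r (b - x))) \<in> L2" (is "?u \<in> _")
    and "(\<lambda>x. chirp x * cnj (maslov TYPE('d)) * (of_real (bell r x) * cnj (wave b x))) \<in> L2" (is "?v \<in> _")
    and "L2_eq (U quarter_time (\<lambda>x. cnj (chirp x) * of_real (gauss r (b - x))))
     (\<lambda>x. chirp x * cnj (maslov TYPE('d)) * (of_real (bell r x) * cnj (wave b x)))"
proof -
  define w :: "complex^'d" where "w = (\<chi> i. of_real (b $ i / r))"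
  define A where "A = r powr (- (real CARD('d) / 2)) * exp (- pi * (norm b)\<^sup>2 / r)"
  have r': "1 / r > 0" using r by simp
  have nb: "(norm (b - x))\<^sup>2 = (norm x)\<^sup>2 + (norm b)\<^sup>2 - 2 * (b \<bullet> x)" for x
    unfolding power2_norm_eq_inner by (simp add: inner_diff inner_commute)
  have 1: "of_real A * ggauss (1 / r) w x = of_real (gauss r (b - x))" for x
  proof -
    have "2 * of_real pi * (\<Sum>i\<in>UNIV. w $ i * of_real (x $ i)) = complex_of_real (2 * pi * (b \<bullet> x) / r)"
      by (simp add: w_def inner_vec_def sum_distrib_left sum_divide_distrib mult.assoc)
    then have "ggauss (1 / r) w x = of_real (exp (- pi * (1 / r) * (norm x)\<^sup>2 + 2 * pi * (b \<bullet> x) / r))"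
      unfolding ggauss_def by (simp only: of_real_add[symmetric] exp_of_real)
    moreover have "exp (- pi * (norm b)\<^sup>2 / r) * exp (- pi * (1 / r) * (norm x)\<^sup>2 + 2 * pi * (b \<bullet> x) / r) = exp (- pi * (norm (b - x))\<^sup>2 / r)"
    proof -
      have "- pi * (norm b)\<^sup>2 / r + (- pi * (1 / r) * (norm x)\<^sup>2 + 2 * pi * (b \<bullet> x) / r) = - pi * (norm (b - x))\<^sup>2 / r"
        unfolding nb using r by (simp add: field_simps)
      then show ?thesis by (simp only: exp_add[symmetric])
    qed
    ultimately show ?thesis by (simp only: A_def gauss_def of_real_mult[symmetric] mult.assoc DIM_cart DIM_real mult_1_right)
  qed
  have 2: "of_real A * (of_real ((1 / r) powr (- (real CARD('d) / 2))) * exp (of_real (pi / (1 / r)) * (\<Sum>i\<in>UNIV. (w $ i - \<i> * of_real (x $ i))\<^sup>2)))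
     = of_real (bell r x) * cnj (wave b x)" for x
  proof -
    have "(w $ i - \<i> * of_real (x $ i))\<^sup>2 = of_real ((b $ i)\<^sup>2 / r\<^sup>2 - (x $ i)\<^sup>2) - \<i> * of_real (2 / r * (b $ i * x $ i))" for i
      using r by (simp add: w_def power2_eq_square algebra_simps)
    then have "(\<Sum>i\<in>UNIV. (w $ i - \<i> * of_real (x $ i))\<^sup>2) = of_real ((norm b)\<^sup>2 / r\<^sup>2 - (norm x)\<^sup>2) - \<i> * of_real (2 / r * (b \<bullet> x))"
      unfolding norm_sq_vec inner_vec_def inner_real_def
      by (simp only: sum_subtractf sum_distrib_left[symmetric] of_real_sum[symmetric] sum_divide_distrib[symmetric])
    note S = this
    have r1: "pi / (1 / r) * ((norm b)\<^sup>2 / r\<^sup>2 - (norm x)\<^sup>2) = pi * (norm b)\<^sup>2 / r + - pi * r * (norm x)\<^sup>2"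
      using r by (simp add: field_simps power2_eq_square)
    have r2: "pi / (1 / r) * (2 / r * (b \<bullet> x)) = 2 * pi * (b \<bullet> x)" using r by simp
    have alg: "of_real p * (of_real s - \<i> * of_real t) = complex_of_real (p * s) - \<i> * of_real (p * t)" for p s t
      by (simp add: algebra_simps)
    have "of_real (pi / (1 / r)) * (\<Sum>i\<in>UNIV. (w $ i - \<i> * of_real (x $ i))\<^sup>2)
       = of_real (pi * (norm b)\<^sup>2 / r) + (of_real (- pi * r * (norm x)\<^sup>2) + - (\<i> * of_real (2 * pi * (b \<bullet> x))))"
      unfolding S alg r1 r2 by (simp only: of_real_add) simp
    then have e: "exp (of_real (pi / (1 / r)) * (\<Sum>i\<in>UNIV. (w $ i - \<i> * of_real (x $ i))\<^sup>2))
       = of_real (exp (pi * (norm b)\<^sup>2 / r)) * (of_real (bell r x) * cnj (wave b x))"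
      by (simp only: exp_add exp_of_real cis_cnj[symmetric] cis_conv_exp exp_cnj complex_cnj_mult complex_cnj_i complex_cnj_complex_of_real mult_minus_left)
    have "A * (1 / r) powr (- (real CARD('d) / 2)) * exp (pi * (norm b)\<^sup>2 / r) = 1"
    proof -
      have "r powr (- (real CARD('d) / 2)) * (1 / r) powr (- (real CARD('d) / 2)) = 1"
        using r by (subst powr_mult[symmetric]) auto
      moreover have "exp (- pi * (norm b)\<^sup>2 / r) * exp (pi * (norm b)\<^sup>2 / r) = 1"
        by (simp only: exp_add[symmetric]) simp
      moreover have "(a * e) * q * k = (a * q) * (e * k)" for a e q k :: real by simp
      ultimately show ?thesis unfolding A_def by (simp only: mult_1_right)
    qed
    then have "complex_of_real A * of_real ((1 / r) powr (- (real CARD('d) / 2))) * of_real (exp (pi * (norm b)\<^sup>2 / r)) = 1"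
      by (simp only: of_real_mult[symmetric] of_real_1)
    moreover have "a * (q * (k * m)) = (a * q * k) * m" for a q k m :: complex by simp
    note this[of "of_real A" "of_real ((1 / r) powr (- (real CARD('d) / 2)))" "of_real (exp (pi * (norm b)\<^sup>2 / r))"
      "of_real (bell r x) * cnj (wave b x)"]
    ultimately show ?thesis unfolding e by (simp only: mult_1_left)
  qed
  note g = chirped_gaussian_evolution[OF U r', of w]
  have gr: "L2_unitary_group U" using U by (simp add: free_schroedinger_group_def)
  let ?p = "\<lambda>x. cnj (chirp x) * ggauss (1 / r) w x"
  let ?q = "\<lambda>x. chirp x * cnj (maslov TYPE('d)) * of_real ((1 / r) powr (- (real CARD('d) / 2)))
         * exp (of_real (pi / (1 / r)) * (\<Sum>i\<in>UNIV. (w $ i - \<i> * of_real (x $ i))\<^sup>2))"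
  have u: "?u = (\<lambda>x. of_real A * ?p x)"
    by (rule ext) (simp only: 1[symmetric] mult.left_commute)
  have v: "?v = (\<lambda>x. of_real A * ?q x)"
  proof
    fix x
    have "m * (a * (q * k)) = a * (m * q * k)" for m a q k :: complex by simp
    then show "chirp x * cnj (maslov TYPE('d)) * (of_real (bell r x) * cnj (wave b x)) = of_real A * ?q x"
      unfolding 2[of x, symmetric] .
  qed
  show "?u \<in> L2" unfolding u by (rule L2_scale[OF g(1)])
  show "?v \<in> L2" unfolding v by (rule L2_scale[OF g(2)])
  have "L2_eq (U quarter_time (\<lambda>x. of_real A * ?p x + 0 * ?p x)) (\<lambda>x. of_real A * U quarter_time ?p x + 0 * U quarter_time ?p x)"
    by (rule group_linear[OF gr g(1) g(1)])
  then have "L2_eq (U quarter_time ?u) (\<lambda>x. of_real A * U quarter_time ?p x)" unfolding u by simp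
  moreover have "L2_eq (\<lambda>x. of_real A * U quarter_time ?p x) ?v"
    unfolding v using g(3) unfolding L2_eq_def by eventually_elim simp
  ultimately show "L2_eq (U quarter_time ?u) ?v" by (rule L2_eq_trans)
qed

section \<open>Observability\<close>

text \<open>
  \<open>f\<close> and \<open>g\<close> are Borel representatives of the chirped initial datum and of its Fourier transform,
  the latter read off from the state at time \<open>quarter_time\<close>.
\<close>

definition fourier_pair ::
  "(real \<Rightarrow> (real^'d::finite \<Rightarrow> complex) \<Rightarrow> (real^'d \<Rightarrow> complex)) \<Rightarrow> (real^'d \<Rightarrow> complex) \<Rightarrow> (real^'d \<Rightarrow> complex) \<Rightarrow> (real^'d \<Rightarrow> complex) \<Rightarrow> bool" where
  "fourier_pair U u0 f g \<longleftrightarrow> u0 \<in> L2 \<and> f \<in> borel_measurable borel \<and> g \<in> borel_measurable borel \<and>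
     (AE x in lebesgue. f x = chirp x * u0 x) \<and>
     (AE x in lebesgue. g x = maslov TYPE('d) * cnj (chirp x) * U quarter_time u0 x)"

lemma borel_measurable_lebesgueI: "f \<in> borel_measurable borel \<Longrightarrow> f \<in> borel_measurable lebesgue"
  by (rule measurable_completion) simp

lemma lebesgue_borel_version:
  fixes f :: "'a::euclidean_space \<Rightarrow> complex"
  assumes f: "f \<in> borel_measurable lebesgue"
  shows "\<exists>f'. f' \<in> borel_measurable borel \<and> (AE x in lebesgue. f' x = f x)"
proof -
  have "(\<lambda>x. Re (f x)) \<in> borel_measurable lebesgue" "(\<lambda>x. Im (f x)) \<in> borel_measurable lebesgue"
    using f by (auto intro: borel_measurable_Re borel_measurable_Im)
  then obtain a b where a: "a \<in> borel_measurable lborel" "AE x in lborel. Re (f x) = a x"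
    and b: "b \<in> borel_measurable lborel" "AE x in lborel. Im (f x) = b x"
    using completion_ex_borel_measurable_real[of "\<lambda>x. Re (f x)" lborel] completion_ex_borel_measurable_real[of "\<lambda>x. Im (f x)" lborel] by blast
  have [measurable]: "a \<in> borel_measurable borel" "b \<in> borel_measurable borel" using a b by auto
  have "AE x in lebesgue. Re (f x) = a x" "AE x in lebesgue. Im (f x) = b x"
    using a(2) b(2) by (auto intro: AE_completion)
  then have "AE x in lebesgue. of_real (a x) + \<i> * of_real (b x) = f x"
    by eventually_elim (simp add: complex_eq_iff)
  moreover have "(\<lambda>x. of_real (a x) + \<i> * of_real (b x)) \<in> borel_measurable borel" by measurable
  ultimately show ?thesis by blast
qed

lemma sq_integrable_of_L2:
  fixes f :: "real^'d::finite \<Rightarrow> complex"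
  assumes u: "u \<in> L2" and f: "f \<in> borel_measurable borel" and e: "AE x in lebesgue. cmod (f x) = cmod (u x)"
  shows "sq_integrable f" and "(LINT x|lborel. (cmod (f x))\<^sup>2) = (L2_norm u)\<^sup>2"
proof -
  have [measurable]: "f \<in> borel_measurable borel" by fact
  have [measurable]: "f \<in> borel_measurable lebesgue" "u \<in> borel_measurable lebesgue"
    using f u by (auto intro: borel_measurable_lebesgueI simp: L2_def)
  have e2: "AE x in lebesgue. (cmod (f x))\<^sup>2 = (cmod (u x))\<^sup>2" using e by eventually_elim simp
  have "integrable lebesgue (\<lambda>x. (cmod (f x))\<^sup>2)"
    using L2_integrable_sq[OF u] by (subst integrable_cong_AE[OF _ _ e2]) auto
  then show "sq_integrable f" unfolding sq_integrable_def by (subst (asm) integrable_completion) auto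
  have "(LINT x|lborel. (cmod (f x))\<^sup>2) = (LINT x|lebesgue. (cmod (f x))\<^sup>2)"
    by (rule integral_completion[symmetric]) measurable
  also have "\<dots> = (LINT x|lebesgue. (cmod (u x))\<^sup>2)" by (rule integral_cong_AE[OF _ _ e2]) measurable
  finally show "(LINT x|lborel. (cmod (f x))\<^sup>2) = (L2_norm u)\<^sup>2" by (simp add: L2_norm_sq)
qed

context
  fixes U :: "real \<Rightarrow> (real^'d::finite \<Rightarrow> complex) \<Rightarrow> (real^'d \<Rightarrow> complex)"
  assumes S: "free_schroedinger_group U"
begin

lemma unitary_group: "L2_unitary_group U"
  using S by (simp add: free_schroedinger_group_def)

lemma fourier_pair_exists:
  assumes u: "u0 \<in> L2" and f: "f \<in> borel_measurable borel" "AE x in lebesgue. f x = chirp x * u0 x"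
  shows "\<exists>g. fourier_pair U u0 f g"
proof -
  have [measurable]: "U quarter_time u0 \<in> borel_measurable lebesgue" using group_L2[OF unitary_group u] by (simp add: L2_def)
  have [measurable]: "(chirp :: real^'d \<Rightarrow> complex) \<in> borel_measurable lebesgue" by (rule borel_measurable_lebesgueI) simp
  have "(\<lambda>x. maslov TYPE('d) * cnj (chirp x) * U quarter_time u0 x) \<in> borel_measurable lebesgue" by measurable
  from lebesgue_borel_version[OF this] show ?thesis unfolding fourier_pair_def using u f by blast
qed

lemma fourier_pair_sq_integrable:
  assumes p: "fourier_pair U u0 f g"
  shows "sq_integrable f" "sq_integrable g"
    "(LINT x|lborel. (cmod (f x))\<^sup>2) = (L2_norm u0)\<^sup>2" "(LINT x|lborel. (cmod (g x))\<^sup>2) = (L2_norm u0)\<^sup>2"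
proof -
  have u: "u0 \<in> L2" and f: "f \<in> borel_measurable borel" and g: "g \<in> borel_measurable borel"
    using p by (auto simp: fourier_pair_def)
  have "AE x in lebesgue. f x = chirp x * u0 x" using p by (simp add: fourier_pair_def)
  then have ef: "AE x in lebesgue. cmod (f x) = cmod (u0 x)" by eventually_elim (simp add: norm_mult)
  have "AE x in lebesgue. g x = maslov TYPE('d) * cnj (chirp x) * U quarter_time u0 x" using p by (simp add: fourier_pair_def)
  then have eg: "AE x in lebesgue. cmod (g x) = cmod (U quarter_time u0 x)" by eventually_elim (simp add: norm_mult)
  show "sq_integrable f" "(LINT x|lborel. (cmod (f x))\<^sup>2) = (L2_norm u0)\<^sup>2" by (rule sq_integrable_of_L2[OF u f ef])+
  show "sq_integrable g" by (rule sq_integrable_of_L2(1)[OF group_L2[OF unitary_group u] g eg])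
  show "(LINT x|lborel. (cmod (g x))\<^sup>2) = (L2_norm u0)\<^sup>2"
    using sq_integrable_of_L2(2)[OF group_L2[OF unitary_group u] g eg] group_norm[OF unitary_group u] by simp
qed

text \<open>
  Parseval's identity, from the unitarity of the group, for every function \<open>a\<close> whose Fourier
  transform \<open>b\<close> is known.
\<close>

lemma fourier_pair_inner:
  assumes p: "fourier_pair U u0 f g" and "r > 0"
    and [measurable]: "a \<in> borel_measurable borel" "b \<in> borel_measurable borel"
    and L: "(\<lambda>x. cnj (chirp x) * a x) \<in> L2" "(\<lambda>x. chirp x * cnj (maslov TYPE('d)) * b x) \<in> L2"
    and e: "L2_eq (U quarter_time (\<lambda>x. cnj (chirp x) * a x)) (\<lambda>x. chirp x * cnj (maslov TYPE('d)) * b x)"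
  shows "(LINT x|lborel. f x * cnj (a x)) = (LINT x|lborel. g x * cnj (b x))"
proof -
  have u: "u0 \<in> L2" and [measurable]: "f \<in> borel_measurable borel" "g \<in> borel_measurable borel"
    using p by (auto simp: fourier_pair_def)
  have [measurable]: "f \<in> borel_measurable lebesgue" "g \<in> borel_measurable lebesgue" "a \<in> borel_measurable lebesgue" "b \<in> borel_measurable lebesgue"
    "u0 \<in> borel_measurable lebesgue" "(chirp :: real^'d \<Rightarrow> complex) \<in> borel_measurable lebesgue"
    "U quarter_time u0 \<in> borel_measurable lebesgue"
    using u group_L2[OF unitary_group u, of quarter_time] by (auto intro: borel_measurable_lebesgueI simp: L2_def)
  have "(LINT x|lborel. f x * cnj (a x)) = (LINT x|lebesgue. f x * cnj (a x))"
    by (rule integral_completion[symmetric]) measurable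
  also have "\<dots> = L2_inner u0 (\<lambda>x. cnj (chirp x) * a x)"
    unfolding L2_inner_def
  proof (rule integral_cong_AE)
    have "AE x in lebesgue. f x = chirp x * u0 x" using p by (simp add: fourier_pair_def)
    then show "AE x in lebesgue. f x * cnj (a x) = u0 x * cnj (cnj (chirp x) * a x)"
      by eventually_elim simp
  qed measurable
  also have "\<dots> = L2_inner (U quarter_time u0) (U quarter_time (\<lambda>x. cnj (chirp x) * a x))"
    by (rule group_inner[OF unitary_group u L(1), symmetric])
  also have "\<dots> = L2_inner (U quarter_time u0) (\<lambda>x. chirp x * cnj (maslov TYPE('d)) * b x)"
    by (rule L2_inner_cong[OF L2_eq_refl e]) (intro group_L2[OF unitary_group] u L)+
  also have "\<dots> = (LINT x|lebesgue. g x * cnj (b x))"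
    unfolding L2_inner_def
  proof (rule integral_cong_AE)
    have "AE x in lebesgue. g x = maslov TYPE('d) * cnj (chirp x) * U quarter_time u0 x" using p by (simp add: fourier_pair_def)
    then show "AE x in lebesgue. U quarter_time u0 x * cnj (chirp x * cnj (maslov TYPE('d)) * b x) = g x * cnj (b x)"
      by eventually_elim simp
  qed measurable
  also have "\<dots> = (LINT x|lborel. g x * cnj (b x))" by (rule integral_completion) measurable
  finally show ?thesis .
qed

lemma fourier_pair_links:
  assumes p: "fourier_pair U u0 f g"
  shows "fourier_link f g" and "fourier_link (\<lambda>x. cnj (g x)) (\<lambda>x. cnj (f x))"
proof -
  show "fourier_link f g"
    unfolding fourier_link_def
  proof (intro allI impI)
    fix r :: real and x :: "real^'d" assume r: "r > 0"
    note b = chirped_bump_evolution[OF S r, of x]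
    have "(LINT y|lborel. f y * cnj (of_real (gauss r (x - y)))) = (LINT y|lborel. g y * cnj (of_real (bell r y) * cnj (wave x y)))"
      by (rule fourier_pair_inner[OF p r _ _ b]) measurable
    then show "(LINT \<xi>|lborel. of_real (bell r \<xi>) * g \<xi> * wave x \<xi>) = (LINT y|lborel. of_real (gauss r (x - y)) * f y)"
      by (simp add: mult.commute mult.left_commute)
  qed
  show "fourier_link (\<lambda>x. cnj (g x)) (\<lambda>x. cnj (f x))"
    unfolding fourier_link_def
  proof (intro allI impI)
    fix r :: real and x :: "real^'d" assume r: "r > 0"
    note b = chirped_plane_wave_evolution[OF S r, of x]
    have "(LINT y|lborel. f y * cnj (of_real (bell r y) * wave x y)) = (LINT y|lborel. g y * cnj (of_real (gauss r (x - y))))"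
      by (rule fourier_pair_inner[OF p r _ _ b]) measurable
    then have "cnj (LINT y|lborel. f y * cnj (of_real (bell r y) * wave x y)) = cnj (LINT y|lborel. g y * cnj (of_real (gauss r (x - y))))"
      by simp
    then show "(LINT \<xi>|lborel. of_real (bell r \<xi>) * cnj (f \<xi>) * wave x \<xi>) = (LINT y|lborel. of_real (gauss r (x - y)) * cnj (g y))"
      unfolding Bochner_Integration.integral_cnj[symmetric] by (simp add: mult.commute mult.left_commute)
  qed
qed

lemma fourier_pair_tendsto:
  assumes p: "fourier_pair U u0 f g"
  shows "((\<lambda>r. LINT z|(lborel \<Otimes>\<^sub>M lborel). rihaczek f g r z) \<longlongrightarrow> of_real ((L2_norm u0)\<^sup>2)) (at_right 0)"
proof (rule rihaczek_tendsto)
  note s = fourier_pair_sq_integrable[OF p]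
  show "sq_integrable f" "sq_integrable g" "(LINT x|lborel. (cmod (g x))\<^sup>2) = (L2_norm u0)\<^sup>2" by (rule s)+
  show "fourier_link (\<lambda>x. cnj (g x)) (\<lambda>x. cnj (f x))" by (rule fourier_pair_links[OF p])
  have u: "u0 \<in> L2" and [measurable]: "f \<in> borel_measurable borel" "g \<in> borel_measurable borel"
    using p by (auto simp: fourier_pair_def)
  fix r :: real assume r: "r > 0"
  let ?a = "\<lambda>x::real^'d. complex_of_real (bell r x)"
  let ?u = "\<lambda>x. ?a x * u0 x"
  have [measurable]: "u0 \<in> borel_measurable lebesgue" using u by (simp add: L2_def)
  have [measurable]: "?a \<in> borel_measurable lebesgue" by (rule borel_measurable_lebesgueI) measurable
  have um: "?u \<in> borel_measurable lebesgue" by measurable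
  have u': "?u \<in> L2"
    by (rule L2_bound[OF u um, of 1]) (use r in \<open>simp add: norm_mult mult_left_le_one_le\<close>)
  have fe: "AE x in lebesgue. f x = chirp x * u0 x" using p by (simp add: fourier_pair_def)
  have "AE x in lebesgue. ?a x * f x = chirp x * ?u x"
    using fe by eventually_elim simp
  then obtain h where h: "fourier_pair U ?u (\<lambda>x. ?a x * f x) h"
    using fourier_pair_exists[OF u', of "\<lambda>x. ?a x * f x"] by auto
  have [measurable]: "h \<in> borel_measurable borel" using h by (simp add: fourier_pair_def)
  have "(LINT x|lborel. (cmod (h x - g x))\<^sup>2) = (L2_norm (\<lambda>x. U quarter_time ?u x - U quarter_time u0 x))\<^sup>2"
  proof (rule sq_integrable_of_L2(2))
    show "(\<lambda>x. U quarter_time ?u x - U quarter_time u0 x) \<in> L2" by (intro L2_diff group_L2[OF unitary_group] u u')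
    have "AE x in lebesgue. g x = maslov TYPE('d) * cnj (chirp x) * U quarter_time u0 x"
      "AE x in lebesgue. h x = maslov TYPE('d) * cnj (chirp x) * U quarter_time ?u x"
      using p h by (auto simp: fourier_pair_def)
    then show "AE x in lebesgue. cmod (h x - g x) = cmod (U quarter_time ?u x - U quarter_time u0 x)"
    proof eventually_elim
      case (elim x)
      then have "h x - g x = maslov TYPE('d) * cnj (chirp x) * (U quarter_time ?u x - U quarter_time u0 x)"
        by (simp add: right_diff_distrib)
      then show ?case by (simp add: norm_mult)
    qed
  qed measurable
  also have "L2_norm (\<lambda>x. U quarter_time ?u x - U quarter_time u0 x) = L2_norm (\<lambda>x. ?u x - u0 x)"
    by (rule group_norm_diff[OF unitary_group u' u])
  also have "(L2_norm (\<lambda>x. ?u x - u0 x))\<^sup>2 = (LINT x|lborel. (cmod (?a x * f x - f x))\<^sup>2)"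
  proof (rule sq_integrable_of_L2(2)[symmetric])
    show "(\<lambda>x. ?u x - u0 x) \<in> L2" by (intro L2_diff u u')
    show "AE x in lebesgue. cmod (?a x * f x - f x) = cmod (?u x - u0 x)"
      using fe
    proof eventually_elim
      case (elim x)
      then have "?a x * f x - f x = chirp x * (?u x - u0 x)" by (simp add: algebra_simps)
      then show ?case by (simp add: norm_mult)
    qed
  qed measurable
  finally have "(LINT x|lborel. (cmod (h x - g x))\<^sup>2) = (LINT x|lborel. (cmod (?a x * f x - f x))\<^sup>2)" .
  then show "\<exists>h. sq_integrable h \<and> fourier_link (\<lambda>x. cnj (h x)) (\<lambda>x. cnj (?a x * f x)) \<and>
      (LINT x|lborel. (cmod (h x - g x))\<^sup>2) = (LINT x|lborel. (cmod (?a x * f x - f x))\<^sup>2)"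
    using fourier_pair_sq_integrable(2)[OF h] fourier_pair_links(2)[OF h] by blast
qed

end

lemma set_integral_lebesgue_borel:
  fixes f :: "real^'d::finite \<Rightarrow> complex"
  assumes u: "u \<in> L2" and f: "f \<in> borel_measurable borel" and e: "AE x in lebesgue. cmod (f x) = cmod (u x)"
    and E: "E \<in> sets borel" and \<Omega>: "\<Omega> \<in> sets lebesgue" and ae: "AE x in lebesgue. x \<in> \<Omega> \<longleftrightarrow> x \<notin> E"
  shows "(LINT x|lborel. (cmod (f x))\<^sup>2 * indicator (- E) x) = (LINT x:\<Omega>|lebesgue. (cmod (u x))\<^sup>2)"
proof -
  have [measurable]: "f \<in> borel_measurable borel" "E \<in> sets borel" "\<Omega> \<in> sets lebesgue" by fact+
  have [measurable]: "f \<in> borel_measurable lebesgue" "u \<in> borel_measurable lebesgue" "E \<in> sets lebesgue"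
    using f u E by (auto intro: borel_measurable_lebesgueI simp: L2_def)
  have "(LINT x|lborel. (cmod (f x))\<^sup>2 * indicator (- E) x) = (LINT x|lebesgue. (cmod (f x))\<^sup>2 * indicator (- E) x)"
    by (rule integral_completion[symmetric]) measurable
  also have "\<dots> = (LINT x|lebesgue. indicator \<Omega> x *\<^sub>R (cmod (u x))\<^sup>2)"
  proof (rule integral_cong_AE)
    show "AE x in lebesgue. (cmod (f x))\<^sup>2 * indicator (- E) x = indicator \<Omega> x *\<^sub>R (cmod (u x))\<^sup>2"
      using e ae by eventually_elim (auto simp: indicator_def)
  qed measurable
  finally show ?thesis by (simp add: set_lebesgue_integral_def)
qed

text \<open>
  The complement of a thick set is thin; up to a null set it is Borel.
\<close>

lemma thick_complement_borel:
  fixes \<rho> :: "real^'d::finite \<Rightarrow> real"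
  assumes \<Omega>: "\<Omega> \<in> sets lebesgue" and th: "thick \<gamma> \<rho> \<Omega>"
  obtains E where "E \<in> sets borel" "AE x in lebesgue. x \<in> \<Omega> \<longleftrightarrow> x \<notin> E"
    "\<forall>x. measure lebesgue (E \<inter> ball x (\<rho> x)) \<le> (1 - \<gamma>) * measure lebesgue (ball x (\<rho> x))"
proof -
  have "- \<Omega> \<in> sets lebesgue" using \<Omega> by (simp add: Compl_in_sets_lebesgue)
  then obtain E N N' where E: "- \<Omega> = E \<union> N" "N \<subseteq> N'" "N' \<in> null_sets lborel" "E \<in> sets lborel"
    by (rule sets_completionE)
  have Eb: "E \<in> sets borel" using E by simp
  have "AE x in lborel. x \<notin> N'" by (rule AE_not_in[OF E(3)])
  then have "AE x in lebesgue. x \<notin> N'" by (rule AE_completion)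
  then have ae: "AE x in lebesgue. x \<in> \<Omega> \<longleftrightarrow> x \<notin> E"
    by eventually_elim (use E in blast)
  have "measure lebesgue (E \<inter> ball x (\<rho> x)) \<le> (1 - \<gamma>) * measure lebesgue (ball x (\<rho> x))" for x
  proof -
    let ?B = "ball x (\<rho> x)"
    have m1: "E \<inter> ?B \<in> lmeasurable" using Eb fmeasurable_Int_fmeasurable[OF lmeasurable_ball, of E x "\<rho> x"] by (simp add: Int_commute)
    have m2: "\<Omega> \<inter> ?B \<in> lmeasurable" using \<Omega> fmeasurable_Int_fmeasurable[OF lmeasurable_ball, of \<Omega> x "\<rho> x"] by (simp add: Int_commute)
    have disj: "(E \<inter> ?B) \<inter> (\<Omega> \<inter> ?B) = {}" using E(1) by blast
    have "measure lebesgue (E \<inter> ?B) + measure lebesgue (\<Omega> \<inter> ?B) = measure lebesgue ((E \<inter> ?B) \<union> (\<Omega> \<inter> ?B))"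
      using measure_Un2[OF m1 m2] disj by (simp add: Diff_triv Int_commute measure_Un3 m1 m2)
    also have "\<dots> \<le> measure lebesgue ?B"
      by (rule measure_mono_fmeasurable) (use m1 m2 in auto)
    finally show ?thesis using th unfolding thick_def by (simp add: algebra_simps) (smt (verit))
  qed
  then show ?thesis using that[OF Eb ae] by blast
qed

text \<open>
  The decay at infinity and continuity give a bound on the whole space.
\<close>

lemma radius_bound:
  fixes \<rho> :: "real^'d::finite \<Rightarrow> real"
  assumes cont: "continuous_on UNIV \<rho>" and pos: "\<And>x. \<rho> x > 0"
    and O: "\<rho> \<in> O[at_infinity](\<lambda>x. inverse (norm x))"
  shows "\<exists>C0. \<forall>x. \<rho> x \<le> C0 / (1 + norm x)"
proof -
  obtain c where c: "c > 0" "\<forall>\<^sub>F x in at_infinity. norm (\<rho> x) \<le> c * norm (inverse (norm x))"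
    using landau_o.bigE[OF O] by blast
  then obtain b where b: "\<And>x. b \<le> norm x \<Longrightarrow> norm (\<rho> x) \<le> c * norm (inverse (norm x))"
    unfolding eventually_at_infinity by blast
  define b' where "b' = max b 1"
  have "bounded (\<rho> ` cball 0 b')"
    by (intro compact_imp_bounded compact_continuous_image continuous_on_subset[OF cont]) auto
  then obtain M where "\<forall>y\<in>\<rho> ` cball 0 b'. norm y \<le> M" unfolding bounded_iff by blast
  then have M: "norm (\<rho> x) \<le> M" if "x \<in> cball 0 b'" for x using that by blast
  have "\<rho> x \<le> max (2 * c) (M * (1 + b')) / (1 + norm x)" for x
  proof -
    have n: "1 + norm x > 0" by (auto intro: add_pos_nonneg)
    have "\<rho> x * (1 + norm x) \<le> max (2 * c) (M * (1 + b'))"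
    proof (cases "norm x \<le> b'")
      case True
      then have "\<rho> x \<le> M" using M[of x] by auto
      then have "\<rho> x * (1 + norm x) \<le> M * (1 + b')" using True pos[of x] by (intro mult_mono) auto
      then show ?thesis by simp
    next
      case False
      then have x: "b \<le> norm x" "1 \<le> norm x" by (auto simp: b'_def)
      have "\<rho> x \<le> c / norm x" using b[OF x(1)] pos[of x] by (simp add: divide_inverse)
      then have "\<rho> x * (1 + norm x) \<le> c / norm x * (2 * norm x)" using x pos[of x] c by (intro mult_mono) auto
      also have "\<dots> = 2 * c"
      proof -
        have "norm x \<noteq> 0" using x(2) by linarith
        then show ?thesis by (simp del: norm_eq_zero)
      qed
      finally show ?thesis by simp
    qed
    then show ?thesis using n by (simp add: pos_le_divide_eq)
  qed
  then show ?thesis by blast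
qed

text \<open>
  The state is controlled by its restrictions to \<open>\<Omega>\<close> at two fixed times.  The constant depends on
  \<open>\<Omega>\<close> only through the thickness.
\<close>

theorem two_time_observability:
  fixes \<rho> :: "real^'d::finite \<Rightarrow> real"
    and U :: "real \<Rightarrow> (real^'d \<Rightarrow> complex) \<Rightarrow> (real^'d \<Rightarrow> complex)"
  assumes S: "free_schroedinger_group U"
    and cont: "continuous_on UNIV \<rho>" and pos: "\<And>x. \<rho> x > 0"
    and O: "\<rho> \<in> O[at_infinity](\<lambda>x. inverse (norm x))"
  shows "\<exists>\<gamma>. 0 < \<gamma> \<and> \<gamma> < 1 \<and> (\<exists>C>0. \<forall>\<Omega>. \<Omega> \<in> sets lebesgue \<longrightarrow> thick \<gamma> \<rho> \<Omega> \<longrightarrow> (\<forall>u\<in>L2.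
     (L2_norm u)\<^sup>2 \<le> C * ((LINT x:\<Omega>|lebesgue. (cmod (u x))\<^sup>2) + (LINT x:\<Omega>|lebesgue. (cmod (U quarter_time u x))\<^sup>2))))"
proof -
  obtain C0 where C0: "\<And>x. \<rho> x \<le> C0 / (1 + norm x)" using radius_bound[OF cont pos O] by blast
  obtain A where A: "A > 0" and thin: "\<forall>E \<epsilon> z t. E \<in> sets lebesgue \<longrightarrow> t \<ge> 0 \<longrightarrow>
     (\<forall>x. measure lebesgue (E \<inter> ball x (\<rho> x)) \<le> \<epsilon> * measure lebesgue (ball x (\<rho> x))) \<longrightarrow>
     measure lebesgue (E \<inter> cball z t) \<le> \<epsilon> * A * (t + 1 / (1 + norm z)) ^ DIM(real^'d)"
    using thin_cball[OF cont pos C0] by blast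
  obtain \<epsilon> C where eps: "\<epsilon> > 0" and C: "C > 0" and core: "\<forall>(E::(real^'d) set) f g S. thin_above \<epsilon> E \<longrightarrow> sq_integrable f \<longrightarrow> sq_integrable g \<longrightarrow>
     fourier_link f g \<longrightarrow> fourier_link (\<lambda>x. cnj (g x)) (\<lambda>x. cnj (f x)) \<longrightarrow>
     (LINT x|lborel. (cmod (f x))\<^sup>2) = S \<longrightarrow> (LINT x|lborel. (cmod (g x))\<^sup>2) = S \<longrightarrow>
     ((\<lambda>r. LINT z|(lborel \<Otimes>\<^sub>M lborel). rihaczek f g r z) \<longlongrightarrow> of_real S) (at_right 0) \<longrightarrow>
     S \<le> C * ((LINT x|lborel. (cmod (f x))\<^sup>2 * indicator (- E) x) + (LINT x|lborel. (cmod (g x))\<^sup>2 * indicator (- E) x))"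
    using uncertainty_thin[where 'a = "real^'d"] by (elim exE conjE)
  \<comment> \<open>The complement then has density at most \<open>\<epsilon> / A\<close>; the minimum keeps \<open>\<gamma>\<close> positive.\<close>
  define \<gamma> where "\<gamma> = 1 - min (\<epsilon> / A) (1 / 2)"
  have \<gamma>: "0 < \<gamma>" "\<gamma> < 1" using eps A by (auto simp: \<gamma>_def min_def)
  have gA: "(1 - \<gamma>) * A \<le> \<epsilon>"
  proof -
    have "(1 - \<gamma>) * A \<le> (\<epsilon> / A) * A" using A by (intro mult_right_mono) (auto simp: \<gamma>_def)
    then show ?thesis using A by simp
  qed
  have "(L2_norm u)\<^sup>2 \<le> C * ((LINT x:\<Omega>|lebesgue. (cmod (u x))\<^sup>2) + (LINT x:\<Omega>|lebesgue. (cmod (U quarter_time u x))\<^sup>2))"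
    if \<Omega>: "\<Omega> \<in> sets lebesgue" "thick \<gamma> \<rho> \<Omega>" and u: "u \<in> L2" for \<Omega> u
  proof -
    obtain E where E: "E \<in> sets borel" "AE x in lebesgue. x \<in> \<Omega> \<longleftrightarrow> x \<notin> E"
      "\<forall>x. measure lebesgue (E \<inter> ball x (\<rho> x)) \<le> (1 - \<gamma>) * measure lebesgue (ball x (\<rho> x))"
      using thick_complement_borel[OF \<Omega>] by blast
    have Ethin: "thin_above \<epsilon> E"
      unfolding thin_above_def
    proof (intro conjI allI impI E(1))
      fix z :: "real^'d" and t :: real assume t: "t \<ge> 0"
      have Eb: "E \<in> sets lebesgue" using E(1) by simp
      have m: "measure lebesgue (E \<inter> cball z t) \<le> (1 - \<gamma>) * A * (t + 1 / (1 + norm z)) ^ DIM(real^'d)"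
        using thin Eb t E(3) by blast
      also have "\<dots> \<le> \<epsilon> * (t + 1 / (1 + norm z)) ^ DIM(real^'d)"
        using gA t by (intro mult_right_mono) auto
      finally have "measure lborel (E \<inter> cball z t) \<le> \<epsilon> * (t + 1 / (1 + norm z)) ^ DIM(real^'d)"
        using E(1) by (simp add: measure_completion)
      moreover have "emeasure lborel (E \<inter> cball z t) = ennreal (measure lborel (E \<inter> cball z t))"
      proof (rule emeasure_eq_ennreal_measure)
        have "emeasure lborel (E \<inter> cball z t) \<le> emeasure lborel (cball z t)" by (rule emeasure_mono) auto
        also have "\<dots> < \<infinity>" by (rule emeasure_lborel_cball_finite)
        finally show "emeasure lborel (E \<inter> cball z t) \<noteq> top" by simp
      qed
      ultimately show "emeasure lborel (E \<inter> cball z t) \<le> ennreal (\<epsilon> * (t + 1 / (1 + norm z)) ^ DIM(real^'d))"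
        by (simp only: ennreal_leI)
    qed
    have [measurable]: "u \<in> borel_measurable lebesgue" using u by (simp add: L2_def)
    have [measurable]: "(chirp :: real^'d \<Rightarrow> complex) \<in> borel_measurable lebesgue" by (rule borel_measurable_lebesgueI) simp
    have "(\<lambda>x. chirp x * u x) \<in> borel_measurable lebesgue" by measurable
    then obtain f where f: "f \<in> borel_measurable borel" "AE x in lebesgue. f x = chirp x * u x"
      using lebesgue_borel_version by blast
    obtain g where p: "fourier_pair U u f g" using fourier_pair_exists[OF S u f] by blast
    have g: "g \<in> borel_measurable borel" "AE x in lebesgue. g x = maslov TYPE('d) * cnj (chirp x) * U quarter_time u x"
      using p by (auto simp: fourier_pair_def)
    note s = fourier_pair_sq_integrable[OF S p]
    have "(L2_norm u)\<^sup>2 \<le> C * ((LINT x|lborel. (cmod (f x))\<^sup>2 * indicator (- E) x) + (LINT x|lborel. (cmod (g x))\<^sup>2 * indicator (- E) x))"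
      by (rule core[rule_format, OF Ethin s(1,2) fourier_pair_links[OF S p] s(3,4) fourier_pair_tendsto[OF S p]])
    also have "(LINT x|lborel. (cmod (f x))\<^sup>2 * indicator (- E) x) = (LINT x:\<Omega>|lebesgue. (cmod (u x))\<^sup>2)"
    proof (rule set_integral_lebesgue_borel[OF u f(1) _ E(1) \<Omega>(1) E(2)])
      show "AE x in lebesgue. cmod (f x) = cmod (u x)" using f(2) by eventually_elim (simp add: norm_mult)
    qed
    also have "(LINT x|lborel. (cmod (g x))\<^sup>2 * indicator (- E) x) = (LINT x:\<Omega>|lebesgue. (cmod (U quarter_time u x))\<^sup>2)"
    proof (rule set_integral_lebesgue_borel[OF group_L2[OF unitary_group[OF S] u] g(1) _ E(1) \<Omega>(1) E(2)])
      show "AE x in lebesgue. cmod (g x) = cmod (U quarter_time u x)" using g(2) by eventually_elim (simp add: norm_mult)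
    qed
    finally show ?thesis .
  qed
  then have h: "\<forall>\<Omega>. \<Omega> \<in> sets lebesgue \<longrightarrow> thick \<gamma> \<rho> \<Omega> \<longrightarrow> (\<forall>u\<in>L2.
     (L2_norm u)\<^sup>2 \<le> C * ((LINT x:\<Omega>|lebesgue. (cmod (u x))\<^sup>2) + (LINT x:\<Omega>|lebesgue. (cmod (U quarter_time u x))\<^sup>2)))"
    by simp
  show ?thesis
    by (rule exI[where x = \<gamma>], rule conjI[OF \<gamma>(1)], rule conjI[OF \<gamma>(2)], rule exI[where x = C], rule conjI[OF C h])
qed

context
  fixes U :: "real \<Rightarrow> (real^'d::finite \<Rightarrow> complex) \<Rightarrow> (real^'d \<Rightarrow> complex)" and \<Omega> :: "(real^'d) set"
    and u0 :: "real^'d \<Rightarrow> complex"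
  assumes U: "L2_unitary_group U" and \<Omega>: "\<Omega> \<in> sets lebesgue" and u0: "u0 \<in> L2"
begin

text \<open>
  The energy in \<open>\<Omega>\<close> at time \<open>t\<close>.
\<close>

definition local_energy :: "real \<Rightarrow> real" where
  "local_energy t = (LINT x:\<Omega>|lebesgue. (cmod (U t u0 x))\<^sup>2)"

lemma local_energy_nonneg: "local_energy t \<ge> 0"
  unfolding local_energy_def set_lebesgue_integral_def by (rule Bochner_Integration.integral_nonneg) simp

lemma local_energy_continuous: "isCont local_energy t"
proof -
  let ?P = "\<lambda>f x. indicator \<Omega> x *\<^sub>R f x :: complex"
  have PL: "?P f \<in> L2" if f: "f \<in> L2" for f
  proof (rule L2_bound[OF f, of _ 1])
    show "?P f \<in> borel_measurable lebesgue"
      using \<Omega> f by (intro borel_measurable_scaleR borel_measurable_indicator) (auto simp: L2_def)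
  qed (simp add: indicator_def)
  have Pn: "L2_norm (?P f) \<le> L2_norm f" if f: "f \<in> L2" for f
    unfolding L2_norm_def
  proof (rule real_sqrt_le_mono, rule integral_mono)
    show "integrable lebesgue (\<lambda>x. (cmod (?P f x))\<^sup>2)" by (rule L2_integrable_sq[OF PL[OF f]])
    show "integrable lebesgue (\<lambda>x. (cmod (f x))\<^sup>2)" by (rule L2_integrable_sq[OF f])
  qed (simp add: indicator_def)
  have e: "of_real (local_energy s) = L2_inner (?P (U s u0)) (U s u0)" for s
  proof -
    have "L2_inner (?P (U s u0)) (U s u0) = (LINT x|lebesgue. of_real (indicator \<Omega> x *\<^sub>R (cmod (U s u0 x))\<^sup>2))"
      unfolding L2_inner_def
      by (intro Bochner_Integration.integral_cong refl) (simp add: indicator_def complex_norm_square del: of_real_power)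
    also have "\<dots> = of_real (LINT x|lebesgue. indicator \<Omega> x *\<^sub>R (cmod (U s u0 x))\<^sup>2)" by (rule integral_complex_of_real)
    finally show ?thesis by (simp add: local_energy_def set_lebesgue_integral_def)
  qed
  have bound: "\<bar>local_energy (t + h) - local_energy t\<bar> \<le> 2 * L2_norm u0 * L2_norm (\<lambda>x. U (t + h) u0 x - U t u0 x)" for h
  proof -
    let ?a = "U (t + h) u0" and ?b = "U t u0"
    have a: "?a \<in> L2" and b: "?b \<in> L2" by (intro group_L2[OF U] u0)+
    have d: "(\<lambda>x. ?a x - ?b x) \<in> L2" by (intro L2_diff a b)
    have Pd: "(\<lambda>x. ?P ?a x - ?P ?b x) = ?P (\<lambda>x. ?a x - ?b x)" by (simp add: scaleR_diff_right)
    have "of_real (local_energy (t + h) - local_energy t) = L2_inner (?P (\<lambda>x. ?a x - ?b x)) ?a + L2_inner (?P ?b) (\<lambda>x. ?a x - ?b x)"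
      unfolding of_real_diff e Pd[symmetric] L2_inner_diff_left[OF PL[OF a] PL[OF b] a] L2_inner_diff_right[OF a b PL[OF b]] by simp
    then have "\<bar>local_energy (t + h) - local_energy t\<bar> = cmod (L2_inner (?P (\<lambda>x. ?a x - ?b x)) ?a + L2_inner (?P ?b) (\<lambda>x. ?a x - ?b x))"
      by (metis norm_of_real)
    also have "\<dots> \<le> L2_norm (?P (\<lambda>x. ?a x - ?b x)) * L2_norm ?a + L2_norm (?P ?b) * L2_norm (\<lambda>x. ?a x - ?b x)"
      by (rule order_trans[OF norm_triangle_ineq add_mono[OF L2_inner_cauchy_schwarz[OF PL[OF d] a] L2_inner_cauchy_schwarz[OF PL[OF b] d]]])
    also have "\<dots> \<le> L2_norm (\<lambda>x. ?a x - ?b x) * L2_norm ?a + L2_norm ?b * L2_norm (\<lambda>x. ?a x - ?b x)"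
      by (intro add_mono mult_right_mono Pn d b) auto
    also have "\<dots> = 2 * L2_norm u0 * L2_norm (\<lambda>x. ?a x - ?b x)" using u0 by (simp add: group_norm[OF U])
    finally show ?thesis .
  qed
  have "((\<lambda>h. 2 * L2_norm u0 * L2_norm (\<lambda>x. U (t + h) u0 x - U t u0 x)) \<longlongrightarrow> 0) (at 0)"
    by (rule tendsto_mult_right_zero[OF group_continuous_at[OF U u0]])
  then have "((\<lambda>h. local_energy (t + h) - local_energy t) \<longlongrightarrow> 0) (at 0)"
    by (rule Lim_null_comparison[rotated]) (use bound in auto)
  then show ?thesis by (simp add: isCont_iff LIM_zero_iff)
qed

lemma local_energy_borel [measurable]: "local_energy \<in> borel_measurable borel"
  by (intro borel_measurable_continuous_onI continuous_at_imp_continuous_on ballI local_energy_continuous)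

lemma local_energy_integrable:
  "integrable lborel (\<lambda>s. indicator {a<..<b} s *\<^sub>R local_energy s)"
proof -
  have "set_integrable lborel {a..b} local_energy"
    unfolding set_integrable_def by (rule borel_integrable_compact) (auto intro: continuous_at_imp_continuous_on local_energy_continuous)
  then have "set_integrable lborel {a<..<b} local_energy" by (rule set_integrable_subset) auto
  then show ?thesis by (simp add: set_integrable_def)
qed

lemma observed_energy_eq: "observed_energy U T \<Omega> u0 = (LINT s|lborel. indicator {0<..<T} s *\<^sub>R local_energy s)"
proof -
  have "observed_energy U T \<Omega> u0 = (LINT s|lebesgue. indicator {0<..<T} s *\<^sub>R local_energy s)"
    by (simp add: observed_energy_def set_lebesgue_integral_def local_energy_def)
  also have "\<dots> = (LINT s|lborel. indicator {0<..<T} s *\<^sub>R local_energy s)" by (rule integral_completion) measurable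
  finally show ?thesis .
qed

text \<open>
  The two-time inequality at the times \<open>s\<close> and \<open>s + \<tau>\<close>, integrated over \<open>0 < s < 1\<close>.
\<close>

lemma observability_from_two_times:
  assumes two: "\<And>u. u \<in> L2 \<Longrightarrow> (L2_norm u)\<^sup>2 \<le> C * ((LINT x:\<Omega>|lebesgue. (cmod (u x))\<^sup>2) + (LINT x:\<Omega>|lebesgue. (cmod (U \<tau> u x))\<^sup>2))"
    and C: "C > 0" and \<tau>: "0 \<le> \<tau>" "\<tau> + 1 \<le> T"
  shows "(L2_norm u0)\<^sup>2 \<le> 2 * C * observed_energy U T \<Omega> u0"
proof -
  let ?e = local_energy
  let ?I = "\<lambda>a b. LINT s|lborel. indicator {a<..<b} s *\<^sub>R ?e s"
  have pt: "(L2_norm u0)\<^sup>2 \<le> C * (?e s + ?e (\<tau> + s))" for s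
  proof -
    have us: "U s u0 \<in> L2" by (rule group_L2[OF U u0])
    have "(LINT x:\<Omega>|lebesgue. (cmod (U \<tau> (U s u0) x))\<^sup>2) = ?e (\<tau> + s)"
      unfolding local_energy_def set_lebesgue_integral_def
    proof (rule integral_cong_AE)
      have [measurable]: "\<Omega> \<in> sets lebesgue" "U \<tau> (U s u0) \<in> borel_measurable lebesgue" "U (\<tau> + s) u0 \<in> borel_measurable lebesgue"
        using \<Omega> group_L2[OF U us, of \<tau>] group_L2[OF U u0, of "\<tau> + s"] by (auto simp: L2_def)
      show "(\<lambda>x. indicator \<Omega> x *\<^sub>R (cmod (U \<tau> (U s u0) x))\<^sup>2) \<in> borel_measurable lebesgue"
        "(\<lambda>x. indicator \<Omega> x *\<^sub>R (cmod (U (\<tau> + s) u0 x))\<^sup>2) \<in> borel_measurable lebesgue" by measurable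
      show "AE x in lebesgue. indicator \<Omega> x *\<^sub>R (cmod (U \<tau> (U s u0) x))\<^sup>2 = indicator \<Omega> x *\<^sub>R (cmod (U (\<tau> + s) u0 x))\<^sup>2"
        using group_add[OF U u0, of \<tau> s] unfolding L2_eq_def by eventually_elim simp
    qed
    then show ?thesis using two[OF us] group_norm[OF U u0, of s] by (simp add: local_energy_def)
  qed
  have i1: "integrable lborel (\<lambda>s. indicator {0<..<1} s *\<^sub>R ?e s)" by (rule local_energy_integrable)
  have shift: "(\<lambda>s. indicator {\<tau><..<\<tau> + 1} (\<tau> + 1 * s) *\<^sub>R ?e (\<tau> + 1 * s)) = (\<lambda>s. indicator {0<..<1} s *\<^sub>R ?e (\<tau> + s))"
    by (auto simp: indicator_def)
  have i2: "integrable lborel (\<lambda>s. indicator {0<..<1} s *\<^sub>R ?e (\<tau> + s))"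
    using lborel_integrable_real_affine[OF local_energy_integrable[of \<tau> "\<tau> + 1"], of 1 \<tau>] unfolding shift by simp
  have s2: "(LINT s|lborel. indicator {0<..<1} s *\<^sub>R ?e (\<tau> + s)) = ?I \<tau> (\<tau> + 1)"
    using lborel_integral_real_affine[of 1 "\<lambda>s. indicator {\<tau><..<\<tau> + 1} s *\<^sub>R ?e s" \<tau>] unfolding shift by simp
  have ind: "integrable lborel (indicat_real {0<..<1::real})" by (rule integrable_real_indicator) auto
  have "(L2_norm u0)\<^sup>2 = (LINT s|lborel. (L2_norm u0)\<^sup>2 * indicator {0<..<1::real} s)" by simp
  also have "\<dots> \<le> (LINT s|lborel. C * (indicator {0<..<1} s *\<^sub>R ?e s + indicator {0<..<1} s *\<^sub>R ?e (\<tau> + s)))"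
  proof (rule integral_mono)
    show "integrable lborel (\<lambda>s. (L2_norm u0)\<^sup>2 * indicator {0<..<1::real} s)" using ind by (rule integrable_mult_right)
    show "integrable lborel (\<lambda>s. C * (indicator {0<..<1} s *\<^sub>R ?e s + indicator {0<..<1} s *\<^sub>R ?e (\<tau> + s)))"
      by (intro integrable_mult_right Bochner_Integration.integrable_add i1 i2)
    show "(L2_norm u0)\<^sup>2 * indicator {0<..<1} s \<le> C * (indicator {0<..<1} s *\<^sub>R ?e s + indicator {0<..<1} s *\<^sub>R ?e (\<tau> + s))" for s
      using pt[of s] by (cases "s \<in> {0<..<1}") auto
  qed
  also have "\<dots> = C * (?I 0 1 + ?I \<tau> (\<tau> + 1))"
    unfolding integral_mult_right_zero by (simp only: Bochner_Integration.integral_add[OF i1 i2] s2)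
  also have "\<dots> \<le> C * (?I 0 T + ?I 0 T)"
  proof (intro mult_left_mono add_mono)
    have mono: "?I a b \<le> ?I 0 T" if "{a<..<b} \<subseteq> {0<..<T}" for a b
    proof (rule integral_mono[OF local_energy_integrable local_energy_integrable])
      show "indicator {a<..<b} s *\<^sub>R ?e s \<le> indicator {0<..<T} s *\<^sub>R ?e s" for s
        using that local_energy_nonneg[of s] by (auto simp: indicator_def)
    qed
    show "?I 0 1 \<le> ?I 0 T" by (rule mono) (use \<tau> in auto)
    show "?I \<tau> (\<tau> + 1) \<le> ?I 0 T" by (rule mono) (use \<tau> in auto)
  qed (use C in simp)
  finally show ?thesis by (simp add: observed_energy_eq)
qed

end

theorem theorem1p3:
  fixes \<rho> :: "real^'d::finite \<Rightarrow> real"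
    and U :: "real \<Rightarrow> (real^'d \<Rightarrow> complex) \<Rightarrow> (real^'d \<Rightarrow> complex)"
  assumes "free_schroedinger_group U"
    and "continuous_on UNIV \<rho>"
    and "\<And>x. \<rho> x > 0"
    and "\<rho> \<in> O[at_infinity](\<lambda>x. inverse (norm x))"
  shows "\<exists>\<gamma>. 0 < \<gamma> \<and> \<gamma> < 1 \<and>
    (\<forall>\<Omega>. \<Omega> \<in> sets lebesgue \<longrightarrow> thick \<gamma> \<rho> \<Omega> \<longrightarrow>
       (\<exists>T>0. observable U T \<Omega>) \<and>
       (\<exists>T0>0. \<exists>C>0. \<forall>T\<ge>T0. \<forall>u0\<in>L2.
          (L2_norm u0)\<^sup>2 \<le> C * observed_energy U T \<Omega> u0))"
proof -
  obtain \<gamma> C where \<gamma>: "0 < \<gamma>" "\<gamma> < 1" and C: "C > 0"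
    and two: "\<And>\<Omega> u. \<Omega> \<in> sets lebesgue \<Longrightarrow> thick \<gamma> \<rho> \<Omega> \<Longrightarrow> u \<in> L2 \<Longrightarrow>
     (L2_norm u)\<^sup>2 \<le> C * ((LINT x:\<Omega>|lebesgue. (cmod (u x))\<^sup>2) + (LINT x:\<Omega>|lebesgue. (cmod (U quarter_time u x))\<^sup>2))"
    using two_time_observability[OF assms] by blast
  have U: "L2_unitary_group U" using assms(1) by (simp add: free_schroedinger_group_def)
  have q: "0 \<le> quarter_time" "quarter_time + 1 \<le> 2"
    using pi_ge_two by (auto simp: quarter_time_def divide_le_eq)
  have main: "(L2_norm u0)\<^sup>2 \<le> 2 * C * observed_energy U T \<Omega> u0"
    if "\<Omega> \<in> sets lebesgue" "thick \<gamma> \<rho> \<Omega>" "T \<ge> 2" "u0 \<in> L2" for \<Omega> T u0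
    by (rule observability_from_two_times[OF U that(1,4) two[OF that(1,2)] C q(1)]) (use q that in auto)
  have C2: "2 * C > 0" using C by simp
  show ?thesis
  proof (rule exI[of _ \<gamma>], intro conjI \<gamma> allI impI)
    fix \<Omega> assume \<Omega>: "\<Omega> \<in> sets lebesgue" "thick \<gamma> \<rho> \<Omega>"
    have "observable U 2 \<Omega>"
      unfolding observable_def using main[OF \<Omega> order_refl] C2 by blast
    then show "\<exists>T>0. observable U T \<Omega>" by (intro exI[of _ 2]) simp
    show "\<exists>T0>0. \<exists>C>0. \<forall>T\<ge>T0. \<forall>u0\<in>L2. (L2_norm u0)\<^sup>2 \<le> C * observed_energy U T \<Omega> u0"
      using main[OF \<Omega>] C2 by (intro exI[of _ 2] conjI exI[of _ "2 * C"]) auto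
  qed
qed

end
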